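(* For every integer $g \geq 3$, the toric variety $\mathcal{V}(\Theta_g)$ (denoted $DM_g$ by Tyurin), i.e. the toric variety associated to the pair $(P(\Theta_g), \Lambda(\Theta_g))$ coming from the multi-theta graph $\Theta_g$ of genus $g$, is singular (not smooth).
   Context: Multi-theta graph. For $g \geq 2$, the multi-theta graph $\Theta_g$ is a vertical oval crossed by $g-1$ horizontal edges. Explicitly, it is the trivalent multigraph with $2g-2$ vertices $a_1,\dots,a_{g-1},b_1,\dots,b_{g-1}$ and the following $3g-3$ edges: one edge $a_ib_i$ for each $1 \leq i \leq g-1$ (the horizontal edges), one edge $a_ia_{i+1}$ and one edge $b_ib_{i+1}$ for each $1 \leq i \leq g-2$, and two further edges, one joining $a_1$ to $b_1$ and one joining $a_{g-1}$ to $b_{g-1}$ (the top and bottom arcs of the oval). Thus for $g \ge 3$ the top pair and the bottom pair are each joined by a double edge, and for $g=2$ the graph has two vertices joined by three edges. Polytope. Number the edges of $\Theta_g$ by $1,\dots,3g-3$ and the vertices by $1,\dots,2g-2$. For the $j$-th vertex let $j_1,j_2,j_3$ be the three (distinct) edges incident to it. The polytope $P(\Theta_g) \subset \mathbb{R}^{3g-3}$ is the set of all $(x_1,\dots,x_{3g-3})$ such that for every $j \in \{1,\dots,2g-2\}$ $$x_{j_1}+x_{j_2}+x_{j_3} \leq 2,\quad x_{j_1}+x_{j_2}-x_{j_3}\geq 0,\quad x_{j_1}-x_{j_2}+x_{j_3}\geq 0,\quad -x_{j_1}+x_{j_2}+x_{j_3}\geq 0.$$ It is a convex polytope of dimension $3g-3$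 contained in $[0,1]^{3g-3}$. Lattice. $\Lambda(\Theta_g) \subset \mathbb{R}^{3g-3}$ is the rank $3g-3$ lattice spanned by the standard basis vectors $e_1,\dots,e_{3g-3}$ together with the vectors $\frac{1}{2}(e_{j_1}+e_{j_2}+e_{j_3})$ for $j=1,\dots,2g-2$. Toric variety. $\mathcal{V}(\Theta_g)$ is the complex toric variety of the normal fan of $P(\Theta_g)$ (the complete fan in $\mathbb{R}^{3g-3}$ whose rays are generated by the inward-pointing normals to the facets of $P(\Theta_g)$, normals being taken with respect to the standard inner product, and whose maximal cones correspond to the vertices of $P(\Theta_g)$, each being generated by the inward normals of the facets containing that vertex), this fan being regarded as a rational fan with respect to the lattice $\Lambda(\Theta_g)$. That is, $\Lambda(\Theta_g)$ is the lattice of one-parameter subgroups of the torus, the compact torus being $K = \mathbb{R}^{3g-3}/\Lambda(\Theta_g)$. *)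

theory Defs
  imports
    "HOL-Analysis.Analysis"
    "HOL-Algebra.QuotRing"
    "HOL-Algebra.Ring_Divisibility"
    "HOL-Computational_Algebra.Group_Closure"
    "HOL-Library.Extended_Nat"
begin

section \<open>Regular local rings\<close>

definition krull_dim :: "('a, 'b) ring_scheme \<Rightarrow> enat" where
  "krull_dim R = Sup {enat n | n. \<exists>P :: nat \<Rightarrow> 'a set.
     (\<forall>i\<le>n. primeideal (P i) R) \<and> (\<forall>i<n. P i \<subset> P (Suc i))}"

text \<open>The minimal number of generators of a finitely generated ideal.\<close>

definition min_gens :: "('a, 'b) ring_scheme \<Rightarrow> 'a set \<Rightarrow> nat" where
  "min_gens R I = (LEAST k. \<exists>A. A \<subseteq> carrier R \<and> finite A \<and> card A = k \<and> Idl\<^bsub>R\<^esub> A = I)"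

definition regular_local_ring :: "('a, 'b) ring_scheme \<Rightarrow> bool" where
  "regular_local_ring R \<longleftrightarrow>
     cring R \<and> noetherian_ring R \<and> (\<exists>!\<mm>. maximalideal \<mm> R) \<and>
     (\<forall>\<mm>. maximalideal \<mm> R \<longrightarrow> enat (min_gens R \<mm>) = krull_dim R)"


section \<open>Complex varieties as spaces with functions\<close>

text \<open>A classical complex variety is given by its set of closed points with the Zariski
  topology, together with the sheaf of regular functions. Sections over an open set \<open>W\<close> are
  represented by total functions, whose values outside \<open>W\<close> carry no meaning.\<close>

record 'x space_with_functions =
  zariski :: "'x topology"
  regular :: "'x set \<Rightarrow> ('x \<Rightarrow> complex) set"

definition functions_near :: "'x space_with_functions \<Rightarrow> 'x \<Rightarrow> ('x \<Rightarrow> complex) ring" where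
  "functions_near X x =
     \<lparr>carrier = {f. \<exists>W. openin (zariski X) W \<and> x \<in> W \<and> f \<in> regular X W},
      mult = (\<lambda>f h y. f y * h y), one = (\<lambda>_. 1),
      zero = (\<lambda>_. 0), add = (\<lambda>f h y. f y + h y)\<rparr>"

text \<open>The ring of germs at \<open>x\<close>: two functions regular near \<open>x\<close> have the same germ iff
  their difference vanishes on a neighbourhood of \<open>x\<close>.\<close>

definition local_ring :: "'x space_with_functions \<Rightarrow> 'x \<Rightarrow> ('x \<Rightarrow> complex) set ring" where
  "local_ring X x = functions_near X x Quot
     {f \<in> carrier (functions_near X x).
        \<exists>W. openin (zariski X) W \<and> x \<in> W \<and> (\<forall>y\<in>W. f y = 0)}"

definition smooth_variety :: "'x space_with_functions \<Rightarrow> bool" where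
  "smooth_variety X \<longleftrightarrow> (\<forall>x \<in> topspace (zariski X). regular_local_ring (local_ring X x))"


section \<open>Affine toric varieties\<close>

text \<open>Throughout, \<open>\<Lambda>\<close> is the lattice of one-parameter subgroups, and the character lattice is
  identified with the dual lattice of \<open>\<Lambda>\<close> by means of the inner product.\<close>

definition dual_lattice :: "'a::euclidean_space set \<Rightarrow> 'a set" where
  "dual_lattice \<Lambda> = {m. \<forall>l\<in>\<Lambda>. m \<bullet> l \<in> \<int>}"

definition cone_semigroup :: "'a::euclidean_space set \<Rightarrow> 'a set \<Rightarrow> 'a set" where
  "cone_semigroup \<Lambda> \<sigma> = {m \<in> dual_lattice \<Lambda>. \<forall>u\<in>\<sigma>. 0 \<le> m \<bullet> u}"

text \<open>The closed points of the spectrum of the semigroup algebra are the homomorphisms from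
  the semigroup to the multiplicative monoid of complex numbers.\<close>

definition affine_points :: "'a::euclidean_space set \<Rightarrow> 'a set \<Rightarrow> ('a \<Rightarrow> complex) set" where
  "affine_points \<Lambda> \<sigma> = {\<gamma> \<in> extensional (cone_semigroup \<Lambda> \<sigma>).
     \<gamma> 0 = 1 \<and>
     (\<forall>m \<in> cone_semigroup \<Lambda> \<sigma>. \<forall>m' \<in> cone_semigroup \<Lambda> \<sigma>. \<gamma> (m + m') = \<gamma> m * \<gamma> m')}"

text \<open>The semigroup algebra, acting as functions on the closed points: the character \<open>m\<close>
  takes the value \<open>\<gamma> m\<close> at \<open>\<gamma>\<close>.\<close>

definition coord_ring :: "'a::euclidean_space set \<Rightarrow> 'a set \<Rightarrow> (('a \<Rightarrow> complex) \<Rightarrow> complex) set" where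
  "coord_ring \<Lambda> \<sigma> =
     {(\<lambda>\<gamma>. \<Sum>m\<in>A. c m * \<gamma> m) | A c. finite A \<and> A \<subseteq> cone_semigroup \<Lambda> \<sigma>}"

definition affine_zariski :: "'a::euclidean_space set \<Rightarrow> 'a set \<Rightarrow> ('a \<Rightarrow> complex) topology" where
  "affine_zariski \<Lambda> \<sigma> =
     topology_generated_by {{\<gamma> \<in> affine_points \<Lambda> \<sigma>. p \<gamma> \<noteq> 0} | p. p \<in> coord_ring \<Lambda> \<sigma>}"


section \<open>The toric variety of a fan\<close>

text \<open>The affine pieces of two cones \<open>\<sigma>\<close>, \<open>\<tau>\<close> are glued along the affine piece of
  \<open>\<sigma> \<inter> \<tau>\<close>, which is an open subset of both by restriction of homomorphisms.\<close>

definition glue ::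
    "'a::euclidean_space set \<Rightarrow> 'a set set \<Rightarrow> (('a set \<times> ('a \<Rightarrow> complex)) \<times> ('a set \<times> ('a \<Rightarrow> complex))) set"
  where
  "glue \<Lambda> \<Sigma> = {((\<sigma>, \<gamma>), (\<tau>, \<delta>)).
     \<sigma> \<in> \<Sigma> \<and> \<tau> \<in> \<Sigma> \<and> \<gamma> \<in> affine_points \<Lambda> \<sigma> \<and> \<delta> \<in> affine_points \<Lambda> \<tau> \<and>
     (\<exists>\<epsilon> \<in> affine_points \<Lambda> (\<sigma> \<inter> \<tau>).
        \<gamma> = restrict \<epsilon> (cone_semigroup \<Lambda> \<sigma>) \<and> \<delta> = restrict \<epsilon> (cone_semigroup \<Lambda> \<tau>))}"

type_synonym 'a toric_point = "('a set \<times> ('a \<Rightarrow> complex)) set"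

definition fan_points :: "'a::euclidean_space set \<Rightarrow> 'a set set \<Rightarrow> 'a toric_point set" where
  "fan_points \<Lambda> \<Sigma> = (SIGMA \<sigma>:\<Sigma>. affine_points \<Lambda> \<sigma>) // glue \<Lambda> \<Sigma>"

definition chart ::
    "'a::euclidean_space set \<Rightarrow> 'a set set \<Rightarrow> 'a set \<Rightarrow> ('a \<Rightarrow> complex) \<Rightarrow> 'a toric_point" where
  "chart \<Lambda> \<Sigma> \<sigma> \<gamma> = glue \<Lambda> \<Sigma> `` {(\<sigma>, \<gamma>)}"

definition chart_preimage ::
    "'a::euclidean_space set \<Rightarrow> 'a set set \<Rightarrow> 'a set \<Rightarrow> 'a toric_point set \<Rightarrow> ('a \<Rightarrow> complex) set" where
  "chart_preimage \<Lambda> \<Sigma> \<sigma> W = {\<gamma> \<in> affine_points \<Lambda> \<sigma>. chart \<Lambda> \<Sigma> \<sigma> \<gamma> \<in> W}"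

definition fan_open :: "'a::euclidean_space set \<Rightarrow> 'a set set \<Rightarrow> 'a toric_point set \<Rightarrow> bool" where
  "fan_open \<Lambda> \<Sigma> W \<longleftrightarrow> W \<subseteq> fan_points \<Lambda> \<Sigma> \<and>
     (\<forall>\<sigma>\<in>\<Sigma>. openin (affine_zariski \<Lambda> \<sigma>) (chart_preimage \<Lambda> \<Sigma> \<sigma> W))"

lemma istopology_fan_open: "istopology (fan_open \<Lambda> \<Sigma>)"
proof -
  have int: "chart_preimage \<Lambda> \<Sigma> \<sigma> (S \<inter> T) =
      chart_preimage \<Lambda> \<Sigma> \<sigma> S \<inter> chart_preimage \<Lambda> \<Sigma> \<sigma> T" for \<sigma> S T
    by (auto simp: chart_preimage_def)
  have un: "chart_preimage \<Lambda> \<Sigma> \<sigma> (\<Union>K) = \<Union> (chart_preimage \<Lambda> \<Sigma> \<sigma> ` K)" for \<sigma> K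
    by (auto simp: chart_preimage_def)
  show ?thesis
    unfolding istopology_def fan_open_def int un by (blast intro: openin_Int openin_Union)
qed

definition toric_variety_of_fan ::
    "'a::euclidean_space set \<Rightarrow> 'a set set \<Rightarrow> 'a toric_point space_with_functions" where
  "toric_variety_of_fan \<Lambda> \<Sigma> =
     \<lparr>zariski = topology (fan_open \<Lambda> \<Sigma>),
      regular = (\<lambda>W. {f. \<forall>\<sigma>\<in>\<Sigma>. \<forall>\<gamma> \<in> chart_preimage \<Lambda> \<Sigma> \<sigma> W.
        \<exists>p \<in> coord_ring \<Lambda> \<sigma>. \<exists>q \<in> coord_ring \<Lambda> \<sigma>. \<exists>D.
          openin (affine_zariski \<Lambda> \<sigma>) D \<and> \<gamma> \<in> D \<and> D \<subseteq> chart_preimage \<Lambda> \<Sigma> \<sigma> W \<and>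
          (\<forall>\<delta>\<in>D. q \<delta> \<noteq> 0 \<and> f (chart \<Lambda> \<Sigma> \<sigma> \<delta>) = p \<delta> / q \<delta>)})\<rparr>"


section \<open>The toric variety of a polytope\<close>

definition inward_normal :: "'a::euclidean_space set \<Rightarrow> 'a set \<Rightarrow> 'a \<Rightarrow> bool" where
  "inward_normal P F u \<longleftrightarrow> u \<noteq> 0 \<and>
     (\<exists>c. (\<forall>x\<in>P. c \<le> u \<bullet> x) \<and> F = {x \<in> P. u \<bullet> x = c})"

definition vertex_cone :: "'a::euclidean_space set \<Rightarrow> 'a \<Rightarrow> 'a set" where
  "vertex_cone P v = convex_cone hull {u. \<exists>F. F facet_of P \<and> v \<in> F \<and> inward_normal P F u}"

text \<open>All cones of the normal fan are the faces of the maximal ones; the empty set, which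
  counts as a face in the library, is excluded.\<close>

definition normal_fan :: "'a::euclidean_space set \<Rightarrow> 'a set set" where
  "normal_fan P = {\<tau>. \<tau> \<noteq> {} \<and> (\<exists>v. v extreme_point_of P \<and> \<tau> face_of vertex_cone P v)}"

definition toric_variety ::
    "'a::euclidean_space set \<Rightarrow> 'a set \<Rightarrow> 'a toric_point space_with_functions" where
  "toric_variety P \<Lambda> = toric_variety_of_fan \<Lambda> (normal_fan P)"


section \<open>Trivalent multigraphs and the multi-theta graph\<close>

record ('v, 'e) multigraph =
  verts :: "'v set"
  edges :: "'e set"
  ends :: "'e \<Rightarrow> 'v set"

definition edges_at :: "('v, 'e) multigraph \<Rightarrow> 'v \<Rightarrow> 'e \<Rightarrow> 'e \<Rightarrow> 'e \<Rightarrow> bool" where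
  "edges_at G v e1 e2 e3 \<longleftrightarrow>
     distinct [e1, e2, e3] \<and> {e \<in> edges G. v \<in> ends G e} = {e1, e2, e3}"

text \<open>The coordinates are indexed by a finite type, by means of a numbering \<open>num\<close> of the
  edges.\<close>

definition graph_polytope :: "('e \<Rightarrow> 'n::finite) \<Rightarrow> ('v, 'e) multigraph \<Rightarrow> (real ^ 'n) set" where
  "graph_polytope num G = {x. \<forall>v \<in> verts G. \<forall>e1 e2 e3. edges_at G v e1 e2 e3 \<longrightarrow>
       x $ num e1 + x $ num e2 + x $ num e3 \<le> 2 \<and>
       x $ num e1 + x $ num e2 - x $ num e3 \<ge> 0 \<and>
       x $ num e1 - x $ num e2 + x $ num e3 \<ge> 0 \<and>
       - x $ num e1 + x $ num e2 + x $ num e3 \<ge> 0}"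

definition graph_lattice :: "('e \<Rightarrow> 'n::finite) \<Rightarrow> ('v, 'e) multigraph \<Rightarrow> (real ^ 'n) set" where
  "graph_lattice num G = group_closure
     ({axis (num e) 1 | e. e \<in> edges G} \<union>
      {(1/2) *\<^sub>R (axis (num e1) 1 + axis (num e2) 1 + axis (num e3) 1) | v e1 e2 e3.
         v \<in> verts G \<and> edges_at G v e1 e2 e3})"

datatype theta_vertex = VA nat | VB nat

datatype theta_edge =
    Rung nat \<comment> \<open>joins \<open>a\<^sub>i\<close> and \<open>b\<^sub>i\<close>\<close>
  | RailA nat \<comment> \<open>joins \<open>a\<^sub>i\<close> and \<open>a\<^sub>i\<^sub>+\<^sub>1\<close>\<close>
  | RailB nat \<comment> \<open>joins \<open>b\<^sub>i\<close> and \<open>b\<^sub>i\<^sub>+\<^sub>1\<close>\<close>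
  | TopArc
  | BottomArc

fun theta_ends :: "nat \<Rightarrow> theta_edge \<Rightarrow> theta_vertex set" where
  "theta_ends g (Rung i) = {VA i, VB i}"
| "theta_ends g (RailA i) = {VA i, VA (i + 1)}"
| "theta_ends g (RailB i) = {VB i, VB (i + 1)}"
| "theta_ends g TopArc = {VA 1, VB 1}"
| "theta_ends g BottomArc = {VA (g - 1), VB (g - 1)}"

definition multi_theta :: "nat \<Rightarrow> (theta_vertex, theta_edge) multigraph" where
  "multi_theta g =
     \<lparr>verts = VA ` {1..g - 1} \<union> VB ` {1..g - 1},
      edges = Rung ` {1..g - 1} \<union> RailA ` {1..g - 2} \<union> RailB ` {1..g - 2} \<union> {TopArc, BottomArc},
      ends = theta_ends g\<rparr>"

end

theory Submission
  imports Defs "HOL-Library.Poly_Mapping"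
begin

text \<open>The origin is a vertex of the polytope, and the semigroup of its chart consists of the
  even integral labellings of the edges that satisfy the triangle inequalities. At the
  corresponding fixed point the irreducible elements of the semigroup give independent tangent
  vectors, so that the maximal ideal needs at least as many generators as there are irreducible
  elements. The simple cycles of the graph, together with one dumbbell, are
  \<open>g (g + 1) / 2 + 1\<close> irreducible elements. On the other hand the Krull dimension is at most
  \<open>3 g - 3\<close>: among any \<open>3 g - 2\<close> quotients of Laurent polynomials there is an algebraic
  relation by counting monomials, and an algebraic relation between elements \<open>f\<^sub>i\<close> of
  \<open>Q\<^sub>i\<^sub>+\<^sub>1 - Q\<^sub>i\<close> for a chain of primes \<open>Q\<^sub>i\<close> is impossible.\<close>

text \<open>The number of irreducible elements has to beat \<open>3 g - 3\<close> strictly. For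
  \<open>g = 3\<close> there are exactly 6 = \<open>3 g - 3\<close> simple cycles, so the cycles
  alone do not contradict regularity; the dumbbell, built on two disjoint double edges, is the extra
  element. Regularity equates the Krull dimension with the number of generators, so an upper bound
  for the dimension is enough. The local ring consists of functions on a glued variety, and two
  facts carry the affine argument over to it. A function that vanishes on a nonempty open part of
  the chart has zero germ: torus points lie in every chart, and far out in a generic direction they
  avoid the zeros of finitely many nonzero Laurent polynomials. A character of the chart is regular
  near the fixed point as seen from every other chart: for this the cones of the normal fan are
  separated by lattice vectors. Such a vector is found by Dirichlet approximation to a multiple of
  the vertex, without first showing that the vertex is rational.\<close>

section \<open>Krull dimension of rings of functions\<close>

text \<open>Elimination: solving an equation with a nonzero coefficient for one unknown leaves one
  equation and one unknown fewer. It serves twice: for the algebraic relation, where monomials give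
  the equations, and for a tangent vector that vanishes on a small set of generators.\<close>

lemma homogeneous_system_nontrivial_solution:
  fixes a :: "'j \<Rightarrow> 'e \<Rightarrow> 'k::field"
  assumes "finite J" "finite E" "card J < card E"
  shows "\<exists>x. (\<exists>e\<in>E. x e \<noteq> 0) \<and> (\<forall>j\<in>J. (\<Sum>e\<in>E. a j e * x e) = 0)"
  using assms
proof (induction J arbitrary: E a rule: finite_induct)
  case empty
  then show ?case by (intro exI[of _ "\<lambda>_. 1"]) (auto simp: card_gt_0_iff)
next
  case (insert j J)
  show ?case
  proof (cases "\<forall>e\<in>E. a j e = 0")
    case True
    obtain x where "\<exists>e\<in>E. x e \<noteq> 0" "\<forall>j\<in>J. (\<Sum>e\<in>E. a j e * x e) = 0"
      using insert.IH[of E a] insert.prems insert.hyps by auto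
    then show ?thesis using True by (intro exI[of _ x]) auto
  next
    case False
    then obtain e0 where e0: "e0 \<in> E" "a j e0 \<noteq> 0" by auto
    define E' where "E' = E - {e0}"
    have E: "E = insert e0 E'" "e0 \<notin> E'" "finite E'"
      using e0 insert.prems by (auto simp: E'_def)
    have "card J < card E'"
      using insert.prems insert.hyps E by simp
    from insert.IH[OF E(3) this, of "\<lambda>i e. a i e - a i e0 * a j e / a j e0"] obtain x where
      x: "\<exists>e\<in>E'. x e \<noteq> 0" "\<And>i. i \<in> J \<Longrightarrow> (\<Sum>e\<in>E'. (a i e - a i e0 * a j e / a j e0) * x e) = 0"
      by auto
    define t where "t = - (\<Sum>e\<in>E'. a j e * x e) / a j e0"
    define z where "z = x(e0 := t)"
    have sum_z: "(\<Sum>e\<in>E. a i e * z e) = a i e0 * t + (\<Sum>e\<in>E'. a i e * x e)" for i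
    proof -
      have "(\<Sum>e\<in>E'. a i e * z e) = (\<Sum>e\<in>E'. a i e * x e)"
        using E(2) by (intro sum.cong) (auto simp: z_def)
      then show ?thesis using E by (simp add: z_def)
    qed
    have "(\<Sum>e\<in>E. a i e * z e) = 0" if "i \<in> insert j J" for i
    proof (cases "i = j")
      case True
      then show ?thesis using e0 by (simp add: sum_z t_def)
    next
      case False
      then have "0 = (\<Sum>e\<in>E'. a i e * x e - a i e0 / a j e0 * (a j e * x e))"
        using x(2)[of i] that by (simp add: algebra_simps)
      also have "\<dots> = (\<Sum>e\<in>E'. a i e * x e) - a i e0 / a j e0 * (\<Sum>e\<in>E'. a j e * x e)"
        by (simp add: sum_subtractf sum_distrib_left)
      finally show ?thesis by (simp add: sum_z t_def)
    qed
    moreover have "\<exists>e\<in>E. z e \<noteq> 0" using x(1) E by (auto simp: z_def)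
    ultimately show ?thesis by blast
  qed
qed

text \<open>The operations of \<open>functions_near\<close> with a free carrier, so that the local
  ring is literally a quotient \<open>function_ring C Quot I\<close>.\<close>

definition function_ring :: "('x \<Rightarrow> complex) set \<Rightarrow> ('x \<Rightarrow> complex) ring" where
  "function_ring C = \<lparr>carrier = C, mult = (\<lambda>f h y. f y * h y), one = (\<lambda>_. 1),
      zero = (\<lambda>_. 0), add = (\<lambda>f h y. f y + h y)\<rparr>"

text \<open>Closure under negation is implicit: it is multiplication by the constant -1.\<close>

definition function_algebra :: "('x \<Rightarrow> complex) set \<Rightarrow> bool" where
  "function_algebra C \<longleftrightarrow> (\<forall>c. (\<lambda>_. c) \<in> C) \<and>
     (\<forall>f\<in>C. \<forall>h\<in>C. (\<lambda>y. f y + h y) \<in> C \<and> (\<lambda>y. f y * h y) \<in> C)"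

lemma function_ring_simps [simp]:
  "carrier (function_ring C) = C"
  "f \<otimes>\<^bsub>function_ring C\<^esub> h = (\<lambda>y. f y * h y)"
  "f \<oplus>\<^bsub>function_ring C\<^esub> h = (\<lambda>y. f y + h y)"
  "\<one>\<^bsub>function_ring C\<^esub> = (\<lambda>_. 1)"
  "\<zero>\<^bsub>function_ring C\<^esub> = (\<lambda>_. 0)"
  by (simp_all add: function_ring_def)

lemma function_algebraD:
  assumes "function_algebra C"
  shows "(\<lambda>_. c) \<in> C"
    and "f \<in> C \<Longrightarrow> h \<in> C \<Longrightarrow> (\<lambda>y. f y + h y) \<in> C"
    and "f \<in> C \<Longrightarrow> h \<in> C \<Longrightarrow> (\<lambda>y. f y * h y) \<in> C"
  using assms by (auto simp: function_algebra_def)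

lemma function_algebra_power:
  assumes "function_algebra C" "f \<in> C"
  shows "(\<lambda>y. f y ^ n) \<in> C"
  by (induction n) (use assms in \<open>auto simp: function_algebra_def\<close>)

lemma function_algebra_sum:
  assumes "function_algebra C" "\<And>i. i \<in> I \<Longrightarrow> f i \<in> C"
  shows "(\<lambda>y. \<Sum>i\<in>I. f i y) \<in> C"
  using assms(2)
  by (induction I rule: infinite_finite_induct) (use assms(1) in \<open>auto simp: function_algebra_def\<close>)

lemma function_algebra_prod:
  assumes "function_algebra C" "\<And>i. i \<in> I \<Longrightarrow> f i \<in> C"
  shows "(\<lambda>y. \<Prod>i\<in>I. f i y) \<in> C"
  using assms(2)
  by (induction I rule: infinite_finite_induct) (use assms(1) in \<open>auto simp: function_algebra_def\<close>)

lemma cring_function_ring: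
  assumes "function_algebra C"
  shows "cring (function_ring C)"
proof (rule cringI)
  have "\<exists>h\<in>C. \<forall>y. h y + f y = 0" if "f \<in> C" for f
    using function_algebraD(3)[OF assms function_algebraD(1)[OF assms, of "-1"] that]
    by (intro bexI[of _ "\<lambda>y. - 1 * f y"]) auto
  then show "abelian_group (function_ring C)"
    by (intro abelian_groupI) (auto simp: function_algebraD[OF assms] algebra_simps fun_eq_iff)
  show "Group.comm_monoid (function_ring C)"
    by (rule comm_monoidI) (auto simp: function_algebraD[OF assms] algebra_simps fun_eq_iff)
qed (auto simp: algebra_simps)

text \<open>Primality stated elementwise with pointwise operations, so that the chain argument can
  manipulate functions directly.\<close>

definition function_prime :: "('x \<Rightarrow> complex) set \<Rightarrow> ('x \<Rightarrow> complex) set \<Rightarrow> bool" where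
  "function_prime C Q \<longleftrightarrow> Q \<subseteq> C \<and>
     (\<forall>f\<in>Q. \<forall>h\<in>Q. (\<lambda>y. f y + h y) \<in> Q) \<and>
     (\<forall>f\<in>C. \<forall>h\<in>Q. (\<lambda>y. f y * h y) \<in> Q) \<and>
     (\<forall>f\<in>C. \<forall>h\<in>C. (\<lambda>y. f y * h y) \<in> Q \<longrightarrow> f \<in> Q \<or> h \<in> Q) \<and>
     (\<lambda>_. 1) \<notin> Q"

lemma primeideal_function_prime:
  assumes "primeideal Q (function_ring C)"
  shows "function_prime C Q"
proof -
  interpret primeideal Q "function_ring C" by fact
  show ?thesis
    unfolding function_prime_def
  proof (intro conjI ballI impI)
    show "Q \<subseteq> C" using a_subset by simp
    show "(\<lambda>y. f y + h y) \<in> Q" if "f \<in> Q" "h \<in> Q" for f h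
      using additive_subgroup.a_closed[OF additive_subgroup_axioms that] by simp
    show "(\<lambda>y. f y * h y) \<in> Q" if "f \<in> C" "h \<in> Q" for f h
      using I_l_closed[OF that(2), of f] that by simp
    show "f \<in> Q \<or> h \<in> Q" if "f \<in> C" "h \<in> C" "(\<lambda>y. f y * h y) \<in> Q" for f h
      using I_prime[of f h] that by simp
    show "(\<lambda>_. 1) \<notin> Q"
      using one_imp_carrier I_notcarr by auto
  qed
qed

lemma function_primeD:
  assumes "function_prime C Q"
  shows "f \<in> Q \<Longrightarrow> h \<in> Q \<Longrightarrow> (\<lambda>y. f y + h y) \<in> Q"
    and "f \<in> C \<Longrightarrow> h \<in> Q \<Longrightarrow> (\<lambda>y. f y * h y) \<in> Q"
    and "f \<in> C \<Longrightarrow> h \<in> C \<Longrightarrow> (\<lambda>y. f y * h y) \<in> Q \<Longrightarrow> f \<in> Q \<or> h \<in> Q"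
  using assms by (auto simp: function_prime_def)

text \<open>The monomials of least degree in the first variable dominate: divide by the prime
  element and reduce modulo the next prime of the chain.\<close>

lemma prime_chain_no_relation:
  fixes f :: "nat \<Rightarrow> 'x \<Rightarrow> complex" and c :: "(nat \<Rightarrow> nat) \<Rightarrow> complex"
  assumes C: "function_algebra C"
    and Q: "\<And>i. i \<le> n \<Longrightarrow> function_prime C (Q i)"
    and Q_mono: "\<And>i. i < n \<Longrightarrow> Q i \<subseteq> Q (Suc i)"
    and f: "\<And>i. i < n \<Longrightarrow> f i \<in> Q (Suc i) - Q i"
    and B: "finite B" "B \<noteq> {}" "B \<subseteq> extensional {..<n}"
    and c: "\<And>\<alpha>. \<alpha> \<in> B \<Longrightarrow> c \<alpha> \<noteq> 0"
    and rel: "(\<lambda>y. \<Sum>\<alpha>\<in>B. c \<alpha> * (\<Prod>i<n. f i y ^ \<alpha> i)) \<in> Q 0"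
  shows False
proof -
  have fC: "f i \<in> C" if "i < n" for i
    using f[OF that] Q[of "Suc i"] that by (auto simp: function_prime_def)
  \<comment> \<open>Invariant: the exponents left in \<open>B'\<close> agree below \<open>j\<close>,
    and the relation stripped of the factors \<open>f 0\<close>, ..., \<open>f (j - 1)\<close> lies
    in \<open>Q j\<close>.\<close>
  have "\<exists>B'\<subseteq>B. B' \<noteq> {} \<and> (\<forall>\<alpha>\<in>B'. \<forall>\<beta>\<in>B'. \<forall>i<j. \<alpha> i = \<beta> i) \<and>
      (\<lambda>y. \<Sum>\<alpha>\<in>B'. c \<alpha> * (\<Prod>i\<in>{j..<n}. f i y ^ \<alpha> i)) \<in> Q j" if "j \<le> n" for j
    using that
  proof (induction j)
    case 0
    then show ?case using rel B by (intro exI[of _ B]) (auto simp: atLeast0LessThan)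
  next
    case (Suc j)
    then have j: "j < n" by simp
    from Suc obtain B' where B': "B' \<subseteq> B" "B' \<noteq> {}" "\<forall>\<alpha>\<in>B'. \<forall>\<beta>\<in>B'. \<forall>i<j. \<alpha> i = \<beta> i"
      "(\<lambda>y. \<Sum>\<alpha>\<in>B'. c \<alpha> * (\<Prod>i\<in>{j..<n}. f i y ^ \<alpha> i)) \<in> Q j" by auto
    have finB': "finite B'" using B' B by (auto intro: finite_subset)
    \<comment> \<open>The terms of least degree \<open>a\<close> in \<open>f j\<close> are kept in
      \<open>B''\<close>. \<open>G\<close> is the relation divided by \<open>f j ^ a\<close>;
      \<open>G1\<close> collects the remaining terms, which still have a factor \<open>f j\<close>
      and therefore vanish modulo \<open>Q (Suc j)\<close>.\<close>
    define a where "a = Min ((\<lambda>\<alpha>. \<alpha> j) ` B')"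
    have a_le: "a \<le> \<alpha> j" if "\<alpha> \<in> B'" for \<alpha> using that finB' by (simp add: a_def)
    have "a \<in> (\<lambda>\<alpha>. \<alpha> j) ` B'" unfolding a_def using finB' B' by (intro Min_in) auto
    define B'' where "B'' = {\<alpha>\<in>B'. \<alpha> j = a}"
    define g where "g = (\<lambda>\<alpha> y. c \<alpha> * (\<Prod>i\<in>{Suc j..<n}. f i y ^ \<alpha> i))"
    define G where "G = (\<lambda>y. \<Sum>\<alpha>\<in>B'. f j y ^ (\<alpha> j - a) * g \<alpha> y)"
    define G1 where "G1 = (\<lambda>y. f j y * (\<Sum>\<alpha>\<in>B' - B''. f j y ^ (\<alpha> j - a - 1) * g \<alpha> y))"
    have gC: "g \<alpha> \<in> C" for \<alpha>
      unfolding g_def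
      by (intro function_algebraD[OF C] function_algebra_prod[OF C] function_algebra_power[OF C] fC) auto
    have GC: "G \<in> C" unfolding G_def
      by (intro function_algebra_sum[OF C] function_algebraD(3)[OF C] function_algebra_power[OF C] fC j gC)
    have eq: "(\<lambda>y. \<Sum>\<alpha>\<in>B'. c \<alpha> * (\<Prod>i\<in>{j..<n}. f i y ^ \<alpha> i)) = (\<lambda>y. f j y ^ a * G y)"
    proof
      fix y
      have "c \<alpha> * (\<Prod>i\<in>{j..<n}. f i y ^ \<alpha> i) = f j y ^ a * (f j y ^ (\<alpha> j - a) * g \<alpha> y)"
        if "\<alpha> \<in> B'" for \<alpha>
      proof -
        have "(\<Prod>i\<in>{j..<n}. f i y ^ \<alpha> i) = f j y ^ \<alpha> j * (\<Prod>i\<in>{Suc j..<n}. f i y ^ \<alpha> i)"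
          using j by (simp add: prod.atLeast_Suc_lessThan)
        moreover have "f j y ^ \<alpha> j = f j y ^ a * f j y ^ (\<alpha> j - a)"
          using a_le[OF that] by (simp flip: power_add)
        ultimately show ?thesis by (simp add: g_def)
      qed
      then show "(\<Sum>\<alpha>\<in>B'. c \<alpha> * (\<Prod>i\<in>{j..<n}. f i y ^ \<alpha> i)) = f j y ^ a * G y"
        by (simp add: G_def sum_distrib_left)
    qed
    have Qj: "function_prime C (Q j)" "function_prime C (Q (Suc j))" using Q j by auto
    \<comment> \<open>\<open>f j\<close> lies outside the prime \<open>Q j\<close>, hence so do its
      powers, and the factor \<open>f j ^ a\<close> can be cancelled.\<close>
    have pow: "(\<lambda>y. f j y ^ k) \<notin> Q j" for k
    proof (induction k)
      case 0
      then show ?case using Qj by (simp add: function_prime_def)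
    next
      case (Suc k)
      then show ?case
        using f[OF j] fC[OF j] function_algebra_power[OF C fC[OF j], of k] Qj(1)
        by (auto simp: function_prime_def)
    qed
    have "G \<in> Q j"
      using B'(4) pow[of a] GC function_algebra_power[OF C fC[OF j], of a] Qj(1)
      unfolding eq by (auto simp: function_prime_def)
    then have GQ: "G \<in> Q (Suc j)" using Q_mono[OF j] by auto
    have "(\<lambda>y. \<Sum>\<alpha>\<in>B' - B''. f j y ^ (\<alpha> j - a - 1) * g \<alpha> y) \<in> C" (is "?r \<in> C")
      by (intro function_algebra_sum[OF C] function_algebraD(3)[OF C] function_algebra_power[OF C] fC j gC)
    then have "(\<lambda>y. ?r y * f j y) \<in> Q (Suc j)"
      using Qj(2) f[OF j] by (auto simp: function_prime_def)
    then have G1Q: "G1 \<in> Q (Suc j)" by (simp add: G1_def mult.commute)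
    have "(\<lambda>y. -1 * G1 y) \<in> Q (Suc j)"
      by (rule function_primeD(2)[OF Qj(2) function_algebraD(1)[OF C] G1Q])
    then have "(\<lambda>y. G y + -1 * G1 y) \<in> Q (Suc j)"
      by (rule function_primeD(1)[OF Qj(2) GQ])
    moreover have "(\<lambda>y. G y + -1 * G1 y) = (\<lambda>y. \<Sum>\<alpha>\<in>B''. g \<alpha> y)"
    proof
      fix y
      have "G y = (\<Sum>\<alpha>\<in>B''. f j y ^ (\<alpha> j - a) * g \<alpha> y) + (\<Sum>\<alpha>\<in>B' - B''. f j y ^ (\<alpha> j - a) * g \<alpha> y)"
        unfolding G_def using finB' by (subst add.commute, intro sum.subset_diff) (auto simp: B''_def)
      also have "(\<Sum>\<alpha>\<in>B' - B''. f j y ^ (\<alpha> j - a) * g \<alpha> y) = G1 y"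
        unfolding G1_def sum_distrib_left
      proof (intro sum.cong refl)
        fix \<alpha> assume "\<alpha> \<in> B' - B''"
        then have "\<alpha> j - a = Suc (\<alpha> j - a - 1)" using a_le[of \<alpha>] by (auto simp: B''_def)
        then show "f j y ^ (\<alpha> j - a) * g \<alpha> y = f j y * (f j y ^ (\<alpha> j - a - 1) * g \<alpha> y)"
          by (metis mult.assoc power_Suc)
      qed
      also have "(\<Sum>\<alpha>\<in>B''. f j y ^ (\<alpha> j - a) * g \<alpha> y) = (\<Sum>\<alpha>\<in>B''. g \<alpha> y)"
        by (intro sum.cong) (auto simp: B''_def)
      finally show "G y + -1 * G1 y = (\<Sum>\<alpha>\<in>B''. g \<alpha> y)" by simp
    qed
    moreover have "B'' \<noteq> {}" using \<open>a \<in> _\<close> by (auto simp: B''_def)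
    moreover have "\<alpha> i = \<beta> i" if "\<alpha> \<in> B''" "\<beta> \<in> B''" "i < Suc j" for \<alpha> \<beta> i
      using that B'(3) by (cases "i = j") (auto simp: B''_def less_Suc_eq)
    moreover have "B'' \<subseteq> B" using B' by (auto simp: B''_def)
    ultimately show ?case by (intro exI[of _ B'']) (auto simp: g_def)
  qed
  from this[of n] obtain B' where B': "B' \<subseteq> B" "B' \<noteq> {}" "\<forall>\<alpha>\<in>B'. \<forall>\<beta>\<in>B'. \<forall>i<n. \<alpha> i = \<beta> i"
      "(\<lambda>y. \<Sum>\<alpha>\<in>B'. c \<alpha>) \<in> Q n" by auto
  then obtain \<alpha> where \<alpha>: "\<alpha> \<in> B'" by auto
  \<comment> \<open>At \<open>j = n\<close> all exponents agree, and extensionality leaves a single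
    one; its nonzero coefficient is then a unit lying in \<open>Q n\<close>.\<close>
  have "\<beta> = \<alpha>" if "\<beta> \<in> B'" for \<beta>
    using that \<alpha> B' B(3) by (intro extensionalityI[of _ "{..<n}"]) auto
  then have "B' = {\<alpha>}" using \<alpha> by blast
  then have "(\<lambda>y. c \<alpha>) \<in> Q n" using B'(4) by simp
  then have "(\<lambda>y. (1 / c \<alpha>) * c \<alpha>) \<in> Q n"
    by (rule function_primeD(2)[OF Q[of n, OF order_refl] function_algebraD(1)[OF C]])
  then show False using Q[of n] c[of \<alpha>] \<alpha> B' by (auto simp: function_prime_def)
qed

text \<open>A chain longer than \<open>d\<close> pulls back to primes of \<open>C\<close> containing
  \<open>I\<close>. Choosing an element in each successive difference gives \<open>f 0\<close>, ...,
  \<open>f d\<close>, whose relation modulo \<open>I\<close> contradicts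
  \<open>prime_chain_no_relation\<close>.\<close>

lemma krull_dim_Quot_le:
  fixes C I :: "('x \<Rightarrow> complex) set"
  assumes C: "function_algebra C" and I: "ideal I (function_ring C)"
    and rel: "\<And>f. (\<And>i. i \<le> d \<Longrightarrow> f i \<in> C) \<Longrightarrow> \<exists>B c. finite B \<and> B \<noteq> {} \<and> B \<subseteq> extensional {..d} \<and>
        (\<forall>\<alpha>\<in>B. c \<alpha> \<noteq> 0) \<and> (\<lambda>y. \<Sum>\<alpha>\<in>B. c \<alpha> * (\<Prod>i\<le>d. f i y ^ \<alpha> i)) \<in> I"
  shows "krull_dim (function_ring C Quot I) \<le> enat d"
proof -
  define A where "A = function_ring C"
  have cr: "cring A" unfolding A_def by (rule cring_function_ring[OF C])
  interpret I: ideal I A using I by (simp add: A_def)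
  have hom: "ring_hom_ring A (A Quot I) ((+>\<^bsub>A\<^esub>) I)"
    by (rule I.rcos_ring_hom_ring)
  have n_le: "n \<le> d" if chain: "\<forall>i\<le>n. primeideal (P i) (A Quot I)" "\<forall>i<n. P i \<subset> P (Suc i)"
    for n and P :: "nat \<Rightarrow> ('x \<Rightarrow> complex) set set"
  proof (rule ccontr)
    assume "\<not> n \<le> d"
    then have dn: "Suc d \<le> n" by simp
    define Q where "Q i = {f \<in> carrier A. I +>\<^bsub>A\<^esub> f \<in> P i}" for i
    have Q: "function_prime C (Q i)" if "i \<le> n" for i
      using ring_hom_ring.primeideal_vimage[OF hom cr, of "P i"] that chain(1)
        primeideal_function_prime[of "Q i" C]
      by (auto simp: Q_def A_def)
    have Q_mono: "Q i \<subseteq> Q (Suc i)" if "i < n" for i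
      using chain(2) that by (auto simp: Q_def)
    have "\<exists>f. f \<in> Q (Suc i) - Q i" if "i < n" for i
    proof -
      have "P i \<subset> P (Suc i)" using chain(2) that by simp
      then obtain p where p: "p \<in> P (Suc i)" "p \<notin> P i" by blast
      interpret Pi: primeideal "P (Suc i)" "A Quot I" using chain(1) that by auto
      have "p \<in> carrier (A Quot I)" using p(1) Pi.a_subset by auto
      then obtain f where "f \<in> carrier A" "p = I +>\<^bsub>A\<^esub> f"
        by (auto simp: FactRing_def A_RCOSETS_def')
      then show ?thesis using p by (auto simp: Q_def)
    qed
    then obtain f where f: "\<And>i. i < n \<Longrightarrow> f i \<in> Q (Suc i) - Q i" by metis
    then have "f i \<in> C" if "i \<le> d" for i
      using that dn by (auto simp: Q_def A_def)
    from rel[of f, OF this] obtain B c where B: "finite B" "B \<noteq> {}" "B \<subseteq> extensional {..d}"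
      "\<forall>\<alpha>\<in>B. c \<alpha> \<noteq> 0" "(\<lambda>y. \<Sum>\<alpha>\<in>B. c \<alpha> * (\<Prod>i\<le>d. f i y ^ \<alpha> i)) \<in> I" by auto
    \<comment> \<open>Elements of \<open>I\<close> have the zero coset, which every prime of the
      quotient contains; thus a relation modulo \<open>I\<close> becomes one modulo
      \<open>Q 0\<close>.\<close>
    have "I \<subseteq> Q 0"
    proof
      fix h assume h: "h \<in> I"
      then have hA: "h \<in> carrier A" using I.a_subset by auto
      have "I +>\<^bsub>A\<^esub> h = I" using h by (rule I.a_rcos_const)
      moreover have "I \<in> P 0"
      proof -
        interpret P0: primeideal "P 0" "A Quot I" using chain(1) by auto
        show ?thesis
          using additive_subgroup.zero_closed[OF P0.additive_subgroup_axioms] by (simp add: FactRing_def)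
      qed
      ultimately show "h \<in> Q 0" using hA by (simp add: Q_def)
    qed
    then have "(\<lambda>y. \<Sum>\<alpha>\<in>B. c \<alpha> * (\<Prod>i<Suc d. f i y ^ \<alpha> i)) \<in> Q 0"
      using B(5) by (auto simp: lessThan_Suc_atMost)
    then show False
      using B dn by (intro prime_chain_no_relation[OF C, of "Suc d" Q f B c] Q Q_mono f)
        (auto simp: lessThan_Suc_atMost)
  qed
  show ?thesis
    unfolding krull_dim_def
    by (rule Sup_least) (use n_le in \<open>auto simp: A_def\<close>)
qed

section \<open>Laurent polynomials\<close>

abbreviation supp :: "('a \<Rightarrow>\<^sub>0 complex) \<Rightarrow> 'a set" where
  "supp \<equiv> Poly_Mapping.keys"

abbreviation cf :: "('a \<Rightarrow>\<^sub>0 complex) \<Rightarrow> 'a \<Rightarrow> complex" where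
  "cf \<equiv> Poly_Mapping.lookup"

text \<open>The linear extension of \<open>w\<close> from exponents to Laurent polynomials. As
  \<open>w\<close> is arbitrary, the same operator evaluates at a point, when \<open>w\<close> is
  multiplicative, and applies a tangent vector, when \<open>w\<close> is a derivation.\<close>

definition pm_eval :: "('a::comm_monoid_add \<Rightarrow>\<^sub>0 complex) \<Rightarrow> ('a \<Rightarrow> complex) \<Rightarrow> complex" where
  "pm_eval p w = (\<Sum>m\<in>supp p. cf p m * w m)"

lemma pm_eval_superset:
  assumes "finite A" "supp p \<subseteq> A"
  shows "pm_eval p w = (\<Sum>m\<in>A. cf p m * w m)"
  unfolding pm_eval_def using assms by (intro sum.mono_neutral_left) (auto simp: in_keys_iff)

lemma pm_eval_0 [simp]: "pm_eval 0 w = 0"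
  by (simp add: pm_eval_def)

lemma pm_eval_single [simp]: "pm_eval (Poly_Mapping.single m c) w = c * w m"
  by (simp add: pm_eval_def)

lemma pm_eval_1 [simp]: "pm_eval 1 w = w 0"
  by (simp flip: single_one)

lemma pm_eval_add [simp]: "pm_eval (p + q) w = pm_eval p w + pm_eval q w"
proof -
  have "finite (supp p \<union> supp q)" by simp
  note * = pm_eval_superset[OF this]
  show ?thesis
    by (subst (1 2 3) *) (use keys_add[of p q] in \<open>auto simp: lookup_add algebra_simps sum.distrib\<close>)
qed

lemma pm_eval_sum: "pm_eval (\<Sum>i\<in>I. p i) w = (\<Sum>i\<in>I. pm_eval (p i) w)"
  by (induction I rule: infinite_finite_induct) auto

lemma poly_mapping_eq_sum_single: "p = (\<Sum>m\<in>supp p. Poly_Mapping.single m (cf p m))"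
  by (rule poly_mapping_eqI) (auto simp: lookup_sum lookup_single when_def in_keys_iff)

lemma pm_eval_mult:
  "pm_eval (p * q) w = (\<Sum>m\<in>supp p. \<Sum>m'\<in>supp q. cf p m * cf q m' * w (m + m'))"
proof -
  have "p * q = (\<Sum>m\<in>supp p. Poly_Mapping.single m (cf p m)) *
      (\<Sum>m'\<in>supp q. Poly_Mapping.single m' (cf q m'))"
    using poly_mapping_eq_sum_single[of p] poly_mapping_eq_sum_single[of q] by simp
  also have "\<dots> = (\<Sum>m\<in>supp p. \<Sum>m'\<in>supp q. Poly_Mapping.single (m + m') (cf p m * cf q m'))"
    by (simp add: sum_product mult_single)
  finally show ?thesis by (simp add: pm_eval_sum)
qed

lemma pm_eval_mult_hom:
  assumes "\<And>m m'. m \<in> supp p \<Longrightarrow> m' \<in> supp q \<Longrightarrow> w (m + m') = w m * w m'"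
  shows "pm_eval (p * q) w = pm_eval p w * pm_eval q w"
  unfolding pm_eval_mult unfolding pm_eval_def sum_product
  by (intro sum.cong refl) (use assms in auto)

text \<open>The Leibniz rule. In \<open>not_smooth\<close>, \<open>w\<close> is the fixed point and
  \<open>v\<close> a tangent vector there.\<close>

lemma pm_eval_mult_derivation:
  assumes "\<And>m m'. m \<in> supp p \<Longrightarrow> m' \<in> supp q \<Longrightarrow> v (m + m') = v m * w m' + w m * v m'"
  shows "pm_eval (p * q) v = pm_eval p v * pm_eval q w + pm_eval p w * pm_eval q v"
  unfolding pm_eval_mult unfolding pm_eval_def sum_product sum.distrib[symmetric]
  by (intro sum.cong refl) (use assms in \<open>auto simp: algebra_simps\<close>)

lemma keys_mult_subset:
  assumes "supp p \<subseteq> S" "supp q \<subseteq> S" "\<And>a b. a \<in> S \<Longrightarrow> b \<in> S \<Longrightarrow> a + b \<in> S"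
  shows "supp (p * q) \<subseteq> S"
  using keys_mult[of p q] assms by fastforce

lemma keys_add_subset:
  assumes "supp p \<subseteq> S" "supp q \<subseteq> S"
  shows "supp (p + q) \<subseteq> S"
  using keys_add[of p q] assms by fastforce

lemma keys_sum_subset:
  assumes "\<And>i. i \<in> I \<Longrightarrow> supp (p i) \<subseteq> S"
  shows "supp (\<Sum>i\<in>I. p i) \<subseteq> S"
  using assms by (induction I rule: infinite_finite_induct) (simp_all add: keys_add_subset)

text \<open>A point of the real one-parameter subgroup in direction \<open>l\<close>, at time
  \<open>s\<close>. Being defined on all exponents, it restricts to a point of every chart.\<close>

definition torus_point :: "'a::real_inner \<Rightarrow> real \<Rightarrow> 'a \<Rightarrow> complex" where
  "torus_point l s m = complex_of_real (exp (s * (l \<bullet> m)))"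

lemma torus_point_0 [simp]: "torus_point l s 0 = 1"
  by (simp add: torus_point_def)

lemma torus_point_add: "torus_point l s (m + m') = torus_point l s m * torus_point l s m'"
  by (simp add: torus_point_def inner_add_right distrib_left exp_add)

lemma torus_point_nonzero [simp]: "torus_point l s m \<noteq> 0"
  by (simp add: torus_point_def)

text \<open>With \<open>l\<close> injective on the support, a single exponent maximises the inner
  product with \<open>l\<close>, and its term dominates all others as \<open>s\<close>
  grows.\<close>

lemma eventually_pm_eval_torus_point_nonzero:
  fixes p :: "'a::real_inner \<Rightarrow>\<^sub>0 complex"
  assumes "p \<noteq> 0" "inj_on ((\<bullet>) l) (supp p)"
  shows "\<forall>\<^sub>F s in at_top. pm_eval p (torus_point l s) \<noteq> 0"
proof -
  have ne: "supp p \<noteq> {}" using assms(1) by simp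
  define M where "M = Max ((\<bullet>) l ` supp p)"
  have "M \<in> (\<bullet>) l ` supp p" unfolding M_def using ne by (intro Max_in) auto
  then obtain m0 where m0: "m0 \<in> supp p" "l \<bullet> m0 = M" by auto
  have less: "l \<bullet> m < M" if "m \<in> supp p" "m \<noteq> m0" for m
  proof -
    have "l \<bullet> m \<le> M" using that by (simp add: M_def)
    moreover have "l \<bullet> m \<noteq> M" using inj_onD[OF assms(2), of m m0] that m0 by auto
    ultimately show ?thesis by simp
  qed
  \<comment> \<open>The evaluation divided by the growth \<open>exp (s * M)\<close> of the leading
    term; it tends to the leading coefficient.\<close>
  define F where "F s = (\<Sum>m\<in>supp p. cf p m * complex_of_real (exp (s * (l \<bullet> m - M))))" for s
  have "((\<lambda>s. cf p m * complex_of_real (exp (s * (l \<bullet> m - M)))) \<longlongrightarrow>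
      (if m = m0 then cf p m0 else 0)) at_top" if "m \<in> supp p" for m
  proof (cases "m = m0")
    case True
    then show ?thesis using m0 by simp
  next
    case False
    have "filterlim (\<lambda>s::real. (l \<bullet> m - M) * s) at_bot at_top"
      using less[OF that False]
      by (intro filterlim_tendsto_neg_mult_at_bot[OF tendsto_const _ filterlim_ident]) auto
    then have "filterlim (\<lambda>s::real. s * (l \<bullet> m - M)) at_bot at_top"
      by (simp add: mult.commute)
    then have "((\<lambda>s. exp (s * (l \<bullet> m - M))) \<longlongrightarrow> 0) at_top"
      by (rule filterlim_compose[OF exp_at_bot])
    then have "((\<lambda>s. cf p m * complex_of_real (exp (s * (l \<bullet> m - M)))) \<longlongrightarrow>
        cf p m * complex_of_real 0) at_top"
      by (intro tendsto_intros)
    then show ?thesis using False by simp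
  qed
  then have "(F \<longlongrightarrow> (\<Sum>m\<in>supp p. if m = m0 then cf p m0 else 0)) at_top"
    unfolding F_def by (intro tendsto_sum)
  also have "(\<Sum>m\<in>supp p. if m = m0 then cf p m0 else 0) = cf p m0"
    using m0 by simp
  finally have "\<forall>\<^sub>F s in at_top. F s \<noteq> 0"
    by (rule tendsto_imp_eventually_ne) (use m0 in \<open>auto simp: in_keys_iff\<close>)
  then show ?thesis
  proof eventually_elim
    case (elim s)
    have "pm_eval p (torus_point l s) = complex_of_real (exp (s * M)) * F s"
      unfolding F_def pm_eval_def torus_point_def sum_distrib_left
      by (intro sum.cong refl) (simp add: algebra_simps flip: exp_add of_real_mult)
    then show ?case using elim by simp
  qed
qed

text \<open>The directions that identify two elements of \<open>A\<close> lie in finitely many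
  hyperplanes, which together form a null set.\<close>

lemma ex_inner_inj_on:
  fixes A :: "'a::euclidean_space set"
  assumes "finite A"
  shows "\<exists>l. inj_on ((\<bullet>) l) A"
proof -
  define D where "D = (\<lambda>(a, b). a - b) ` (A \<times> A) - {0}"
  have "negligible (\<Union>d\<in>D. {x. d \<bullet> x = 0})"
    using assms by (intro negligible_Union) (auto simp: D_def intro!: negligible_hyperplane)
  then obtain l where l: "l \<notin> (\<Union>d\<in>D. {x. d \<bullet> x = 0})"
    using non_negligible_UNIV by (metis UNIV_eq_I)
  have "inj_on ((\<bullet>) l) A"
  proof (rule inj_onI, rule ccontr)
    fix a b assume ab: "a \<in> A" "b \<in> A" "l \<bullet> a = l \<bullet> b" "a \<noteq> b"
    then have "a - b \<in> D" by (force simp: D_def)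
    then have "(a - b) \<bullet> l \<noteq> 0" using l by auto
    then show False using ab(3) by (simp add: inner_diff_left inner_commute[of l])
  qed
  then show ?thesis ..
qed

section \<open>Affine charts\<close>

lemma dual_lattice_0 [simp]: "0 \<in> dual_lattice \<Lambda>"
  by (simp add: dual_lattice_def)

lemma dual_lattice_add: "m \<in> dual_lattice \<Lambda> \<Longrightarrow> m' \<in> dual_lattice \<Lambda> \<Longrightarrow> m + m' \<in> dual_lattice \<Lambda>"
  by (simp add: dual_lattice_def inner_add_left)

lemma dual_lattice_minus: "m \<in> dual_lattice \<Lambda> \<Longrightarrow> - m \<in> dual_lattice \<Lambda>"
  by (simp add: dual_lattice_def)

lemma cone_semigroup_dual_lattice: "m \<in> cone_semigroup \<Lambda> \<sigma> \<Longrightarrow> m \<in> dual_lattice \<Lambda>"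
  by (simp add: cone_semigroup_def)

lemma cone_semigroup_0 [simp]: "0 \<in> cone_semigroup \<Lambda> \<sigma>"
  by (simp add: cone_semigroup_def)

lemma cone_semigroup_add:
  "m \<in> cone_semigroup \<Lambda> \<sigma> \<Longrightarrow> m' \<in> cone_semigroup \<Lambda> \<sigma> \<Longrightarrow> m + m' \<in> cone_semigroup \<Lambda> \<sigma>"
  by (simp add: cone_semigroup_def dual_lattice_add inner_add_left)

lemma cone_semigroup_scale:
  "m \<in> cone_semigroup \<Lambda> \<sigma> \<Longrightarrow> of_nat k *\<^sub>R m \<in> cone_semigroup \<Lambda> \<sigma>"
  by (induction k) (simp_all add: scaleR_left_distrib cone_semigroup_add)

lemma cone_semigroup_antimono: "\<tau> \<subseteq> \<sigma> \<Longrightarrow> cone_semigroup \<Lambda> \<sigma> \<subseteq> cone_semigroup \<Lambda> \<tau>"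
  by (auto simp: cone_semigroup_def)

lemma affine_points_add:
  assumes "\<gamma> \<in> affine_points \<Lambda> \<sigma>" "m \<in> cone_semigroup \<Lambda> \<sigma>" "m' \<in> cone_semigroup \<Lambda> \<sigma>"
  shows "\<gamma> (m + m') = \<gamma> m * \<gamma> m'"
  using assms by (auto simp: affine_points_def)

lemma affine_points_0: "\<gamma> \<in> affine_points \<Lambda> \<sigma> \<Longrightarrow> \<gamma> 0 = 1"
  by (auto simp: affine_points_def)

lemma affine_points_scale:
  assumes "\<gamma> \<in> affine_points \<Lambda> \<sigma>" "m \<in> cone_semigroup \<Lambda> \<sigma>"
  shows "\<gamma> (of_nat k *\<^sub>R m) = \<gamma> m ^ k"
proof (induction k)
  case (Suc k)
  then show ?case
    using affine_points_add[OF assms(1,2) cone_semigroup_scale[OF assms(2), of k]]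
    by (simp add: scaleR_left_distrib)
qed (simp add: affine_points_0[OF assms(1)])

lemma restrict_affine_points:
  assumes "\<And>m m'. m \<in> cone_semigroup \<Lambda> \<sigma> \<Longrightarrow> m' \<in> cone_semigroup \<Lambda> \<sigma> \<Longrightarrow> w (m + m') = w m * w m'"
    and "w 0 = 1"
  shows "restrict w (cone_semigroup \<Lambda> \<sigma>) \<in> affine_points \<Lambda> \<sigma>"
  using assms by (auto simp: affine_points_def cone_semigroup_add)

lemma pm_eval_cong:
  assumes "supp p \<subseteq> S" "\<And>m. m \<in> S \<Longrightarrow> w m = w' m"
  shows "pm_eval p w = pm_eval p w'"
  unfolding pm_eval_def using assms by (intro sum.cong) auto

lemma pm_eval_mult_affine:
  assumes "\<gamma> \<in> affine_points \<Lambda> \<sigma>" "supp p \<subseteq> cone_semigroup \<Lambda> \<sigma>" "supp q \<subseteq> cone_semigroup \<Lambda> \<sigma>"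
  shows "pm_eval (p * q) \<gamma> = pm_eval p \<gamma> * pm_eval q \<gamma>"
  by (rule pm_eval_mult_hom) (use assms affine_points_add in blast)

lemma coord_ring_eq: "coord_ring \<Lambda> \<sigma> = {pm_eval p | p. supp p \<subseteq> cone_semigroup \<Lambda> \<sigma>}"
proof (rule equalityI; rule subsetI)
  fix f assume "f \<in> coord_ring \<Lambda> \<sigma>"
  then obtain A c where A: "finite A" "A \<subseteq> cone_semigroup \<Lambda> \<sigma>" "f = (\<lambda>\<gamma>. \<Sum>m\<in>A. c m * \<gamma> m)"
    by (auto simp: coord_ring_def)
  define p where "p = (\<Sum>m\<in>A. Poly_Mapping.single m (c m))"
  have "supp p \<subseteq> cone_semigroup \<Lambda> \<sigma>"
    unfolding p_def using A by (intro keys_sum_subset) auto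
  moreover have "f = pm_eval p" by (auto simp: p_def pm_eval_sum A)
  ultimately show "f \<in> {pm_eval p | p. supp p \<subseteq> cone_semigroup \<Lambda> \<sigma>}" by auto
next
  fix f assume "f \<in> {pm_eval p | p. supp p \<subseteq> cone_semigroup \<Lambda> \<sigma>}"
  then obtain p where p: "supp p \<subseteq> cone_semigroup \<Lambda> \<sigma>" "f = pm_eval p" by auto
  show "f \<in> coord_ring \<Lambda> \<sigma>"
    unfolding coord_ring_def p(2) using p(1)
    by (intro CollectI exI[of _ "supp p"] exI[of _ "cf p"]) (auto simp: pm_eval_def)
qed

lemma openin_affine_zariski_basic:
  assumes "supp p \<subseteq> cone_semigroup \<Lambda> \<sigma>"
  shows "openin (affine_zariski \<Lambda> \<sigma>) {\<gamma> \<in> affine_points \<Lambda> \<sigma>. pm_eval p \<gamma> \<noteq> 0}"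
  unfolding affine_zariski_def coord_ring_eq
  using assms by (intro topology_generated_by_Basis) auto

lemma openin_affine_points: "openin (affine_zariski \<Lambda> \<sigma>) (affine_points \<Lambda> \<sigma>)"
proof -
  have "affine_points \<Lambda> \<sigma> = {\<gamma> \<in> affine_points \<Lambda> \<sigma>. pm_eval 1 \<gamma> \<noteq> 0}"
    by (auto simp: affine_points_0)
  then show ?thesis using openin_affine_zariski_basic[of 1 \<Lambda> \<sigma>] by simp
qed

text \<open>Multiplying polynomials turns the intersection of two principal open sets into a
  principal open set, so the generating family is a basis of the topology.\<close>

lemma openin_affine_zariskiD:
  assumes "openin (affine_zariski \<Lambda> \<sigma>) D" "\<gamma> \<in> D"
  obtains p where "supp p \<subseteq> cone_semigroup \<Lambda> \<sigma>" "pm_eval p \<gamma> \<noteq> 0"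
    "{\<delta> \<in> affine_points \<Lambda> \<sigma>. pm_eval p \<delta> \<noteq> 0} \<subseteq> D" "\<gamma> \<in> affine_points \<Lambda> \<sigma>"
proof -
  let ?U = "\<lambda>p. {\<delta> \<in> affine_points \<Lambda> \<sigma>. pm_eval p \<delta> \<noteq> 0}"
  define \<B> where "\<B> = {{\<gamma> \<in> affine_points \<Lambda> \<sigma>. p \<gamma> \<noteq> 0} | p. p \<in> coord_ring \<Lambda> \<sigma>}"
  have "generate_topology_on \<B> D"
    using assms(1) by (simp add: affine_zariski_def \<B>_def openin_topology_generated_by_iff)
  then have "\<forall>\<gamma>\<in>D. \<exists>p. supp p \<subseteq> cone_semigroup \<Lambda> \<sigma> \<and> \<gamma> \<in> ?U p \<and> ?U p \<subseteq> D"
  proof (induction rule: generate_topology_on.induct)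
    case Empty
    then show ?case by simp
  next
    case (Int a b)
    show ?case
    proof
      fix \<gamma> assume "\<gamma> \<in> a \<inter> b"
      then obtain p q where pq: "supp p \<subseteq> cone_semigroup \<Lambda> \<sigma>" "\<gamma> \<in> ?U p" "?U p \<subseteq> a"
        "supp q \<subseteq> cone_semigroup \<Lambda> \<sigma>" "\<gamma> \<in> ?U q" "?U q \<subseteq> b"
        using Int.IH by blast
      have "?U (p * q) = ?U p \<inter> ?U q" using pm_eval_mult_affine[OF _ pq(1,4)] by auto
      then show "\<exists>p. supp p \<subseteq> cone_semigroup \<Lambda> \<sigma> \<and> \<gamma> \<in> ?U p \<and> ?U p \<subseteq> a \<inter> b"
        using pq keys_mult_subset[OF pq(1,4)] cone_semigroup_add by (intro exI[of _ "p * q"]) blast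
    qed
  next
    case (UN K)
    then show ?case by (meson Union_iff Union_upper subset_trans)
  next
    case (Basis s)
    then obtain p where "supp p \<subseteq> cone_semigroup \<Lambda> \<sigma>" "s = ?U p"
      by (auto simp: \<B>_def coord_ring_eq)
    then show ?case by blast
  qed
  then show ?thesis using assms(2) that by blast
qed

lemma openin_affine_zariski_subset: "openin (affine_zariski \<Lambda> \<sigma>) D \<Longrightarrow> D \<subseteq> affine_points \<Lambda> \<sigma>"
  by (meson openin_affine_zariskiD subsetI)

lemma restrict_torus_point_affine:
  "restrict (torus_point l s) (cone_semigroup \<Lambda> \<sigma>) \<in> affine_points \<Lambda> \<sigma>"
  by (rule restrict_affine_points) (auto simp: torus_point_add)

text \<open>Nonempty open sets are Zariski dense: a principal open set inside \<open>D\<close> and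
  the nonvanishing set of a nonzero \<open>p\<close> share a torus point far out in a generic
  direction.\<close>

lemma pm_eval_eq_0_on_open:
  assumes "openin (affine_zariski \<Lambda> \<sigma>) D" "\<gamma> \<in> D" "supp p \<subseteq> cone_semigroup \<Lambda> \<sigma>"
    and "\<And>\<delta>. \<delta> \<in> D \<Longrightarrow> pm_eval p \<delta> = 0"
  shows "p = 0"
proof (rule ccontr)
  assume p: "p \<noteq> 0"
  obtain q where q: "supp q \<subseteq> cone_semigroup \<Lambda> \<sigma>" "pm_eval q \<gamma> \<noteq> 0"
    "{\<delta> \<in> affine_points \<Lambda> \<sigma>. pm_eval q \<delta> \<noteq> 0} \<subseteq> D"
    by (rule openin_affine_zariskiD[OF assms(1,2)])
  obtain l where l: "inj_on ((\<bullet>) l) (supp p \<union> supp q)"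
    using ex_inner_inj_on[of "supp p \<union> supp q"] by auto
  have "\<forall>\<^sub>F s in at_top. pm_eval p (torus_point l s) \<noteq> 0 \<and> pm_eval q (torus_point l s) \<noteq> 0"
    using p q(2) l
    by (intro eventually_conj eventually_pm_eval_torus_point_nonzero) (auto simp: inj_on_Un)
  then obtain s where s: "pm_eval p (torus_point l s) \<noteq> 0" "pm_eval q (torus_point l s) \<noteq> 0"
    using eventually_happens'[OF trivial_limit_at_top_linorder] by blast
  define t where "t = restrict (torus_point l s) (cone_semigroup \<Lambda> \<sigma>)"
  have "pm_eval p t = pm_eval p (torus_point l s)" "pm_eval q t = pm_eval q (torus_point l s)"
    using assms(3) q(1) by (auto intro!: pm_eval_cong simp: t_def)
  moreover have "t \<in> affine_points \<Lambda> \<sigma>" unfolding t_def by (rule restrict_torus_point_affine)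
  ultimately show False using s q(3) assms(4)[of t] by auto
qed

section \<open>Generators of the maximal ideal\<close>

lemma ideal_function_ringI:
  assumes C: "function_algebra C" and "I \<subseteq> C" "(\<lambda>_. 0) \<in> I"
    and add: "\<And>f h. f \<in> I \<Longrightarrow> h \<in> I \<Longrightarrow> (\<lambda>y. f y + h y) \<in> I"
    and mult: "\<And>f h. f \<in> C \<Longrightarrow> h \<in> I \<Longrightarrow> (\<lambda>y. f y * h y) \<in> I"
  shows "ideal I (function_ring C)"
proof -
  interpret cring "function_ring C" by (rule cring_function_ring[OF C])
  have "\<ominus>\<^bsub>function_ring C\<^esub> f \<in> I" if "f \<in> I" for f
  proof -
    have "(\<lambda>y. -1 * f y) \<in> I" by (rule mult[OF function_algebraD(1)[OF C] that])
    moreover have "\<ominus>\<^bsub>function_ring C\<^esub> f = (\<lambda>y. -1 * f y)"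
      using that calculation assms(2) by (intro minus_equality) auto
    ultimately show ?thesis by simp
  qed
  then have "subgroup I (add_monoid (function_ring C))"
    using assms by (intro add.subgroupI) (auto simp: a_inv_def)
  moreover have "(\<lambda>y. h y * f y) \<in> I" if "f \<in> C" "h \<in> I" for f h
    using mult[OF that] by (simp add: mult.commute)
  ultimately show ?thesis
    using mult by (intro idealI ring_axioms) auto
qed

lemma function_ring_rcos_eq_iff:
  assumes C: "function_algebra C" and I: "ideal I (function_ring C)" and fh: "f \<in> C" "h \<in> C"
  shows "I +>\<^bsub>function_ring C\<^esub> f = I +>\<^bsub>function_ring C\<^esub> h \<longleftrightarrow> (\<lambda>y. f y - h y) \<in> I"
proof -
  interpret cring "function_ring C" by (rule cring_function_ring[OF C])
  have "(\<lambda>y. -1 * h y) \<in> C" by (intro function_algebraD[OF C] fh)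
  then have "\<ominus>\<^bsub>function_ring C\<^esub> h = (\<lambda>y. -1 * h y)"
    using fh by (intro minus_equality) auto
  then have "f \<ominus>\<^bsub>function_ring C\<^esub> h = (\<lambda>y. f y - h y)"
    by (simp add: a_minus_def)
  then show ?thesis
    using quotient_eq_iff_same_a_r_cos[OF I, of f h] fh by simp
qed

text \<open>Since all of \<open>I\<close> vanishes at \<open>x\<close>, the image cannot contain 1;
  and it is maximal because a function with nonzero value at \<open>x\<close> is a unit modulo the
  functions vanishing at \<open>x\<close>.\<close>

lemma maximalideal_vanishing_Quot:
  assumes C: "function_algebra C" and I: "ideal I (function_ring C)" and I0: "\<And>f. f \<in> I \<Longrightarrow> f x = 0"
  shows "maximalideal ((\<lambda>f. I +>\<^bsub>function_ring C\<^esub> f) ` {f \<in> C. f x = 0}) (function_ring C Quot I)"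
    (is "maximalideal ?N ?R")
proof -
  interpret A: cring "function_ring C" by (rule cring_function_ring[OF C])
  interpret I: ideal I "function_ring C" by (rule I)
  interpret h: ring_hom_ring "function_ring C" ?R "\<lambda>f. I +>\<^bsub>function_ring C\<^esub> f"
    by (rule I.rcos_ring_hom_ring)
  have "ideal {f \<in> C. f x = 0} (function_ring C)"
    by (rule ideal_function_ringI[OF C]) (auto simp: function_algebraD[OF C])
  then have idN: "ideal ?N ?R" by (rule A.ring_ideal_imp_quot_ideal[OF I])
  have oneC: "(\<lambda>_. 1) \<in> C" by (rule function_algebraD(1)[OF C])
  show ?thesis
  proof (rule maximalidealI[OF idN])
    show "carrier ?R \<noteq> ?N"
    proof
      assume "carrier ?R = ?N"
      moreover have "I +>\<^bsub>function_ring C\<^esub> (\<lambda>_. 1) \<in> carrier ?R"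
        using h.hom_closed[of "\<lambda>_. 1"] oneC by simp
      ultimately obtain f where f: "f \<in> C" "f x = 0"
        "I +>\<^bsub>function_ring C\<^esub> (\<lambda>_. 1) = I +>\<^bsub>function_ring C\<^esub> f" by auto
      then have "(\<lambda>y. 1 - f y) \<in> I" using function_ring_rcos_eq_iff[OF C I oneC f(1)] by simp
      then show False using I0[of "\<lambda>y. 1 - f y"] f(2) by simp
    qed
  next
    fix J assume J: "ideal J ?R" "?N \<subseteq> J" "J \<subseteq> carrier ?R"
    interpret J': ideal "{r \<in> carrier (function_ring C). I +>\<^bsub>function_ring C\<^esub> r \<in> J}" "function_ring C"
      by (rule h.ideal_vimage[OF J(1)])
    show "J = ?N \<or> J = carrier ?R"
    proof (rule ccontr)
      assume "\<not> (J = ?N \<or> J = carrier ?R)"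
      then obtain g where g: "g \<in> J" "g \<notin> ?N" using J(2) by auto
      obtain f where f: "f \<in> C" "g = I +>\<^bsub>function_ring C\<^esub> f"
        using g(1) J(3) by (auto simp: FactRing_def A_RCOSETS_def')
      then have fx: "f x \<noteq> 0" using g(2) by auto
      \<comment> \<open>Subtracting from 1 the multiple of \<open>f\<close> with value 1 at
        \<open>x\<close> leaves a function that vanishes at \<open>x\<close>.\<close>
      have cC: "(\<lambda>y. -1 / f x * f y + 1) \<in> C"
        by (intro function_algebraD[OF C] f)
      then have "I +>\<^bsub>function_ring C\<^esub> (\<lambda>y. -1 / f x * f y + 1) \<in> J"
        using J(2) fx by auto
      moreover note cC
      moreover have "(\<lambda>y. 1 / f x * f y) \<in> {r \<in> carrier (function_ring C). I +>\<^bsub>function_ring C\<^esub> r \<in> J}"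
        using J'.I_l_closed[of f "\<lambda>_. 1 / f x"] f g(1) function_algebraD(1)[OF C] by simp
      ultimately have "(\<lambda>y. (-1 / f x * f y + 1) + 1 / f x * f y) \<in>
          {r \<in> carrier (function_ring C). I +>\<^bsub>function_ring C\<^esub> r \<in> J}"
        using additive_subgroup.a_closed[OF J'.additive_subgroup_axioms,
            of "\<lambda>y. -1 / f x * f y + 1" "\<lambda>y. 1 / f x * f y"] by simp
      then have one: "I +>\<^bsub>function_ring C\<^esub> (\<lambda>_. 1) \<in> J" by simp
      interpret J: ideal J ?R by (rule J(1))
      have "\<one>\<^bsub>?R\<^esub> \<in> J" using one h.hom_one by simp
      then have "J = carrier ?R" by (rule J.one_imp_carrier)
      then show False using \<open>\<not> (J = ?N \<or> J = carrier ?R)\<close> by simp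
    qed
  qed
qed

text \<open>Generators of the maximal ideal of the quotient are lifted to functions. Generation is
  expressed through all ideals \<open>J\<close> containing \<open>I\<close> and the lifts, because
  it will be refuted by exhibiting one such \<open>J\<close>.\<close>

lemma regular_local_ring_generators:
  assumes C: "function_algebra C" and I: "ideal I (function_ring C)" and I0: "\<And>f. f \<in> I \<Longrightarrow> f x = 0"
    and reg: "regular_local_ring (function_ring C Quot I)"
    and dim: "krull_dim (function_ring C Quot I) \<le> enat d"
  obtains G where "G \<subseteq> {f \<in> C. f x = 0}" "finite G" "card G \<le> d"
    "\<forall>J. ideal J (function_ring C) \<and> I \<subseteq> J \<and> G \<subseteq> J \<longrightarrow> {f \<in> C. f x = 0} \<subseteq> J"
proof -
  define N where "N = (\<lambda>f. I +>\<^bsub>function_ring C\<^esub> f) ` {f \<in> C. f x = 0}"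
  let ?R = "function_ring C Quot I"
  interpret A: cring "function_ring C" by (rule cring_function_ring[OF C])
  interpret R: noetherian_ring ?R using reg by (simp add: regular_local_ring_def)
  have N: "maximalideal N ?R" unfolding N_def by (rule maximalideal_vanishing_Quot[OF C I I0])
  then have "ideal N ?R" by (rule maximalideal.axioms)
  then obtain A where "A \<subseteq> carrier ?R" "finite A" "N = Idl\<^bsub>?R\<^esub> A"
    using R.finetely_gen[of N] by auto
  \<comment> \<open>The noetherian property provides a finite generating set, so the minimum in
    \<open>min_gens\<close> is attained.\<close>
  then have "\<exists>k. \<exists>A. A \<subseteq> carrier ?R \<and> finite A \<and> card A = k \<and> Idl\<^bsub>?R\<^esub> A = N" by auto
  from LeastI_ex[OF this] obtain B where B: "B \<subseteq> carrier ?R" "finite B" "card B = min_gens ?R N"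
    "Idl\<^bsub>?R\<^esub> B = N"
    unfolding min_gens_def by auto
  have "enat (card B) \<le> enat d" using reg N dim by (simp add: B regular_local_ring_def)
  then have card: "card B \<le> d" by simp
  have "B \<subseteq> N" using R.genideal_self[OF B(1)] B(4) by simp
  then have "\<forall>b\<in>B. \<exists>f. f \<in> C \<and> f x = 0 \<and> b = I +>\<^bsub>function_ring C\<^esub> f" by (auto simp: N_def)
  then obtain r where r: "\<And>b. b \<in> B \<Longrightarrow> r b \<in> C \<and> r b x = 0 \<and> b = I +>\<^bsub>function_ring C\<^esub> r b" by metis
  have gen: "{f \<in> C. f x = 0} \<subseteq> J"
    if J: "ideal J (function_ring C)" "I \<subseteq> J" "r ` B \<subseteq> J" for J
  proof -
    interpret J: ideal J "function_ring C" by (rule J(1))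
    have "B \<subseteq> (\<lambda>f. I +>\<^bsub>function_ring C\<^esub> f) ` J" using r J(3) by blast
    then have NJ: "N \<subseteq> (\<lambda>f. I +>\<^bsub>function_ring C\<^esub> f) ` J"
      using R.genideal_minimal[OF A.ring_ideal_imp_quot_ideal[OF I J(1)], of B] B(4) by simp
    show ?thesis
    proof
      fix f assume f: "f \<in> {f \<in> C. f x = 0}"
      then obtain h where h: "h \<in> J" "I +>\<^bsub>function_ring C\<^esub> f = I +>\<^bsub>function_ring C\<^esub> h"
        using NJ unfolding N_def by blast
      have hC: "h \<in> C" using h(1) J.a_subset by auto
      have "(\<lambda>y. f y - h y) \<in> J"
        using function_ring_rcos_eq_iff[OF C I, of f h] f h(2) hC J(2) by auto
      then show "f \<in> J"
        using additive_subgroup.a_closed[OF J.additive_subgroup_axioms h(1), of "\<lambda>y. f y - h y"] by simp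
    qed
  qed
  have rB: "r ` B \<subseteq> {f \<in> C. f x = 0}" "finite (r ` B)" using r B by auto
  have "card (r ` B) \<le> d" using card card_image_le[OF B(2), of r] by simp
  then show ?thesis using gen by (intro that[OF rB]) simp_all
qed

section \<open>A fixed point of a toric variety\<close>

text \<open>What the fan must satisfy at the chart of \<sigma>. \<open>dual_integral\<close> lets
  characters be counted in boxes; \<open>semigroup_generates\<close> makes every character a
  difference of elements of each semigroup, so that any chart determines a torus point;
  \<open>separation\<close> exhibits the overlap with the chart of \<sigma> as a principal open set;
  \<open>pointed\<close> makes the fixed point a homomorphism.\<close>

locale toric_fixed_point =
  fixes \<Lambda> :: "'a::euclidean_space set" and \<Sigma> :: "'a set set" and \<sigma> :: "'a set"
  assumes sigma: "\<sigma> \<in> \<Sigma>"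
    and dual_integral: "\<And>m b. m \<in> dual_lattice \<Lambda> \<Longrightarrow> b \<in> Basis \<Longrightarrow> m \<bullet> b \<in> \<int>"
    and semigroup_generates: "\<And>\<tau> m. \<tau> \<in> \<Sigma> \<Longrightarrow> m \<in> dual_lattice \<Lambda> \<Longrightarrow>
      \<exists>w \<in> cone_semigroup \<Lambda> \<tau>. m + w \<in> cone_semigroup \<Lambda> \<tau>"
    and separation: "\<And>\<tau>. \<tau> \<in> \<Sigma> \<Longrightarrow> \<exists>m \<in> cone_semigroup \<Lambda> \<tau>. - m \<in> cone_semigroup \<Lambda> (\<tau> \<inter> \<sigma>) \<and>
      (\<forall>h \<in> cone_semigroup \<Lambda> (\<tau> \<inter> \<sigma>). \<exists>k::nat. h + of_nat k *\<^sub>R m \<in> cone_semigroup \<Lambda> \<tau>)"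
    and pointed: "\<And>m m'. m \<in> cone_semigroup \<Lambda> \<sigma> \<Longrightarrow> m' \<in> cone_semigroup \<Lambda> \<sigma> \<Longrightarrow> m + m' = 0 \<Longrightarrow> m = 0"
begin

abbreviation S where "S \<equiv> cone_semigroup \<Lambda>"
abbreviation U where "U \<equiv> affine_points \<Lambda>"
abbreviation ch where "ch \<equiv> chart \<Lambda> \<Sigma>"
abbreviation X where "X \<equiv> toric_variety_of_fan \<Lambda> \<Sigma>"
abbreviation torus where "torus \<tau> l s \<equiv> restrict (torus_point l s) (S \<tau>)"

lemma openin_zariski: "openin (zariski X) W \<longleftrightarrow> fan_open \<Lambda> \<Sigma> W"
  by (simp add: toric_variety_of_fan_def istopology_fan_open)

lemma glue_refl: "\<tau> \<in> \<Sigma> \<Longrightarrow> \<gamma> \<in> U \<tau> \<Longrightarrow> ((\<tau>, \<gamma>), (\<tau>, \<gamma>)) \<in> glue \<Lambda> \<Sigma>"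
  unfolding glue_def by (auto simp: affine_points_def extensional_restrict intro!: bexI[of _ \<gamma>])

lemma chart_in_fan_points: "\<tau> \<in> \<Sigma> \<Longrightarrow> \<gamma> \<in> U \<tau> \<Longrightarrow> ch \<tau> \<gamma> \<in> fan_points \<Lambda> \<Sigma>"
  by (auto simp: fan_points_def chart_def intro!: quotientI)

lemma fan_pointsE:
  assumes "y \<in> fan_points \<Lambda> \<Sigma>"
  obtains \<tau> \<gamma> where "\<tau> \<in> \<Sigma>" "\<gamma> \<in> U \<tau>" "y = ch \<tau> \<gamma>"
  using assms unfolding fan_points_def chart_def by (elim quotientE) auto

lemma fan_open_fan_points: "fan_open \<Lambda> \<Sigma> (fan_points \<Lambda> \<Sigma>)"
proof -
  have "chart_preimage \<Lambda> \<Sigma> \<tau> (fan_points \<Lambda> \<Sigma>) = U \<tau>" if "\<tau> \<in> \<Sigma>" for \<tau>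
    using that by (auto simp: chart_preimage_def chart_in_fan_points)
  then show ?thesis by (simp add: fan_open_def openin_affine_points)
qed

lemma topspace_zariski: "topspace (zariski X) = fan_points \<Lambda> \<Sigma>"
proof
  show "topspace (zariski X) \<subseteq> fan_points \<Lambda> \<Sigma>"
    unfolding topspace_def openin_zariski fan_open_def by auto
  show "fan_points \<Lambda> \<Sigma> \<subseteq> topspace (zariski X)"
    using fan_open_fan_points openin_zariski openin_subset by blast
qed

lemma torus_in_U: "torus \<tau> l s \<in> U \<tau>"
  by (rule restrict_torus_point_affine)

text \<open>A torus point lies in all charts at once. A homomorphism on the semigroup of an
  intersection that agrees with it on the semigroup of \<tau> agrees everywhere, since each
  character is a difference of two elements there and torus values are nonzero.\<close>

lemma chart_torus:
  assumes "\<tau> \<in> \<Sigma>"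
  shows "ch \<tau> (torus \<tau> l s) = {(\<rho>, torus \<rho> l s) | \<rho>. \<rho> \<in> \<Sigma>}"
proof (rule equalityI; rule subsetI)
  fix z assume "z \<in> ch \<tau> (torus \<tau> l s)"
  then obtain \<rho> \<epsilon> \<eta> where z: "z = (\<rho>, \<epsilon>)" "\<rho> \<in> \<Sigma>" "\<eta> \<in> U (\<tau> \<inter> \<rho>)"
    "torus \<tau> l s = restrict \<eta> (S \<tau>)" "\<epsilon> = restrict \<eta> (S \<rho>)"
    by (auto simp: chart_def glue_def)
  have \<eta>: "\<eta> m = torus_point l s m" if m: "m \<in> S \<tau>" for m
    using fun_cong[OF z(4), of m] m by simp
  have "\<eta> m = torus_point l s m" if m: "m \<in> S (\<tau> \<inter> \<rho>)" for m
  proof -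
    obtain w where w: "w \<in> S \<tau>" "m + w \<in> S \<tau>"
      using semigroup_generates[OF assms cone_semigroup_dual_lattice[OF m]] by auto
    then have "w \<in> S (\<tau> \<inter> \<rho>)" using cone_semigroup_antimono[of "\<tau> \<inter> \<rho>" \<tau> \<Lambda>] by auto
    then have "\<eta> (m + w) = \<eta> m * \<eta> w" by (rule affine_points_add[OF z(3) m])
    then show ?thesis using \<eta>[OF w(1)] \<eta>[OF w(2)] by (simp add: torus_point_add)
  qed
  then have "\<epsilon> = torus \<rho> l s"
    unfolding z(5) using cone_semigroup_antimono[of "\<tau> \<inter> \<rho>" \<rho> \<Lambda>] by (intro restrict_ext) auto
  then show "z \<in> {(\<rho>, torus \<rho> l s) | \<rho>. \<rho> \<in> \<Sigma>}" using z by auto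
next
  fix z assume "z \<in> {(\<rho>, torus \<rho> l s) | \<rho>. \<rho> \<in> \<Sigma>}"
  then obtain \<rho> where \<rho>: "z = (\<rho>, torus \<rho> l s)" "\<rho> \<in> \<Sigma>" by auto
  have eq: "torus \<tau> l s = restrict (torus (\<tau> \<inter> \<rho>) l s) (S \<tau>)"
    "torus \<rho> l s = restrict (torus (\<tau> \<inter> \<rho>) l s) (S \<rho>)"
    using cone_semigroup_antimono[of "\<tau> \<inter> \<rho>" \<rho> \<Lambda>] cone_semigroup_antimono[of "\<tau> \<inter> \<rho>" \<tau> \<Lambda>]
    by (auto simp: restrict_def fun_eq_iff)
  have "((\<tau>, torus \<tau> l s), (\<rho>, torus \<rho> l s)) \<in> glue \<Lambda> \<Sigma>"
    unfolding glue_def using \<rho>(2) assms torus_in_U eq by blast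
  then show "z \<in> ch \<tau> (torus \<tau> l s)"
    using \<rho>(1) by (simp add: chart_def)
qed

text \<open>Names the data of a local presentation as a fraction, because later arguments work with
  the numerator and the denominator themselves.\<close>

definition frac_rep where
  "frac_rep f \<tau> \<gamma> p q D \<longleftrightarrow> supp p \<subseteq> S \<tau> \<and> supp q \<subseteq> S \<tau> \<and> openin (affine_zariski \<Lambda> \<tau>) D \<and> \<gamma> \<in> D \<and>
     (\<forall>\<delta>\<in>D. pm_eval q \<delta> \<noteq> 0 \<and> f (ch \<tau> \<delta>) = pm_eval p \<delta> / pm_eval q \<delta>)"

lemma regular_iff:
  "f \<in> regular X W \<longleftrightarrow> (\<forall>\<tau>\<in>\<Sigma>. \<forall>\<gamma> \<in> chart_preimage \<Lambda> \<Sigma> \<tau> W.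
     \<exists>p q D. frac_rep f \<tau> \<gamma> p q D \<and> D \<subseteq> chart_preimage \<Lambda> \<Sigma> \<tau> W)"
proof -
  have "(\<exists>p \<in> coord_ring \<Lambda> \<tau>. \<exists>q \<in> coord_ring \<Lambda> \<tau>. \<exists>D.
          openin (affine_zariski \<Lambda> \<tau>) D \<and> \<gamma> \<in> D \<and> D \<subseteq> V \<and>
          (\<forall>\<delta>\<in>D. q \<delta> \<noteq> 0 \<and> f (ch \<tau> \<delta>) = p \<delta> / q \<delta>)) \<longleftrightarrow>
      (\<exists>p q D. frac_rep f \<tau> \<gamma> p q D \<and> D \<subseteq> V)" (is "?L \<longleftrightarrow> ?R") for \<tau> \<gamma> V
  proof
    assume ?L
    then obtain p q D where *: "supp p \<subseteq> S \<tau>" "supp q \<subseteq> S \<tau>" "openin (affine_zariski \<Lambda> \<tau>) D" "\<gamma> \<in> D"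
      "D \<subseteq> V" "\<forall>\<delta>\<in>D. pm_eval q \<delta> \<noteq> 0 \<and> f (ch \<tau> \<delta>) = pm_eval p \<delta> / pm_eval q \<delta>"
      unfolding coord_ring_eq by auto
    then have "frac_rep f \<tau> \<gamma> p q D" by (simp add: frac_rep_def)
    then show ?R using *(5) by auto
  next
    assume ?R
    then obtain p q D where *: "frac_rep f \<tau> \<gamma> p q D" "D \<subseteq> V" by auto
    show ?L
      using * by (intro bexI[of _ "pm_eval p"] bexI[of _ "pm_eval q"] exI[of _ D])
        (auto simp: coord_ring_eq frac_rep_def)
  qed
  then show ?thesis by (simp add: toric_variety_of_fan_def)
qed

lemma frac_const:
  assumes "\<gamma> \<in> U \<tau>"
  shows "frac_rep (\<lambda>_. c) \<tau> \<gamma> (Poly_Mapping.single 0 c) 1 (U \<tau>)"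
  using assms by (auto simp: frac_rep_def openin_affine_points affine_points_0)

lemma frac_subset:
  assumes "frac_rep f \<tau> \<gamma> p q D" "openin (affine_zariski \<Lambda> \<tau>) D'" "\<gamma> \<in> D'" "D' \<subseteq> D"
  shows "frac_rep f \<tau> \<gamma> p q D'"
  using assms by (auto simp: frac_rep_def)

lemma frac_U:
  assumes "frac_rep f \<tau> \<gamma> p q D" "\<delta> \<in> D"
  shows "\<delta> \<in> U \<tau>"
  using assms openin_affine_zariski_subset unfolding frac_rep_def by blast

lemma supp_S:
  assumes "supp p \<subseteq> S \<tau>" "supp q \<subseteq> S \<tau>"
  shows "supp (p * q) \<subseteq> S \<tau>" "supp (p + q) \<subseteq> S \<tau>"
  using assms by (rule keys_mult_subset keys_add_subset; simp add: cone_semigroup_add)+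

lemma frac_add:
  assumes "frac_rep f \<tau> \<gamma> p q D" "frac_rep f' \<tau> \<gamma> p' q' D'"
  shows "frac_rep (\<lambda>y. f y + f' y) \<tau> \<gamma> (p * q' + p' * q) (q * q') (D \<inter> D')"
proof -
  have s: "supp p \<subseteq> S \<tau>" "supp q \<subseteq> S \<tau>" "supp p' \<subseteq> S \<tau>" "supp q' \<subseteq> S \<tau>"
    using assms by (auto simp: frac_rep_def)
  show ?thesis
    unfolding frac_rep_def
  proof (intro conjI ballI)
    fix \<delta> assume \<delta>: "\<delta> \<in> D \<inter> D'"
    then have "\<delta> \<in> U \<tau>" using frac_U[OF assms(1)] by simp
    note m = pm_eval_mult_affine[OF this]
    have "pm_eval q \<delta> \<noteq> 0" "pm_eval q' \<delta> \<noteq> 0" "f (ch \<tau> \<delta>) = pm_eval p \<delta> / pm_eval q \<delta>"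
      "f' (ch \<tau> \<delta>) = pm_eval p' \<delta> / pm_eval q' \<delta>"
      using assms \<delta> by (auto simp: frac_rep_def)
    then show "pm_eval (q * q') \<delta> \<noteq> 0"
      "f (ch \<tau> \<delta>) + f' (ch \<tau> \<delta>) = pm_eval (p * q' + p' * q) \<delta> / pm_eval (q * q') \<delta>"
      using s by (simp_all add: m add_frac_eq)
  qed (use assms s in \<open>simp_all add: frac_rep_def supp_S openin_Int\<close>)
qed

lemma frac_mult:
  assumes "frac_rep f \<tau> \<gamma> p q D" "frac_rep f' \<tau> \<gamma> p' q' D'"
  shows "frac_rep (\<lambda>y. f y * f' y) \<tau> \<gamma> (p * p') (q * q') (D \<inter> D')"
proof -
  have s: "supp p \<subseteq> S \<tau>" "supp q \<subseteq> S \<tau>" "supp p' \<subseteq> S \<tau>" "supp q' \<subseteq> S \<tau>"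
    using assms by (auto simp: frac_rep_def)
  show ?thesis
    unfolding frac_rep_def
  proof (intro conjI ballI)
    fix \<delta> assume \<delta>: "\<delta> \<in> D \<inter> D'"
    then have "\<delta> \<in> U \<tau>" using frac_U[OF assms(1)] by simp
    note m = pm_eval_mult_affine[OF this]
    have "pm_eval q \<delta> \<noteq> 0" "pm_eval q' \<delta> \<noteq> 0" "f (ch \<tau> \<delta>) = pm_eval p \<delta> / pm_eval q \<delta>"
      "f' (ch \<tau> \<delta>) = pm_eval p' \<delta> / pm_eval q' \<delta>"
      using assms \<delta> by (auto simp: frac_rep_def)
    then show "pm_eval (q * q') \<delta> \<noteq> 0"
      "f (ch \<tau> \<delta>) * f' (ch \<tau> \<delta>) = pm_eval (p * p') \<delta> / pm_eval (q * q') \<delta>"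
      using s by (simp_all add: m)
  qed (use assms s in \<open>simp_all add: frac_rep_def supp_S openin_Int\<close>)
qed

text \<open>The identity principle, expressing irreducibility of the variety. If \<open>f\<close>
  were nonzero at \<open>y\<close>, its numerator there would be a nonzero polynomial, and a torus
  point far out in a generic direction would lie near \<open>y\<close> with \<open>f\<close> nonzero
  and also in \<open>D\<close>.\<close>

lemma regular_eq_0:
  assumes "fan_open \<Lambda> \<Sigma> W" "f \<in> regular X W"
    and D: "openin (affine_zariski \<Lambda> \<sigma>) D" "\<delta> \<in> D"
    and f0: "\<And>\<delta>. \<delta> \<in> D \<Longrightarrow> f (ch \<sigma> \<delta>) = 0" and y: "y \<in> W"
  shows "f y = 0"
proof (rule ccontr)
  assume fy: "f y \<noteq> 0"
  obtain \<tau> \<gamma> where \<tau>: "\<tau> \<in> \<Sigma>" "\<gamma> \<in> U \<tau>" "y = ch \<tau> \<gamma>"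
    using y assms(1) fan_pointsE unfolding fan_open_def by blast
  then have "\<gamma> \<in> chart_preimage \<Lambda> \<Sigma> \<tau> W" using y by (simp add: chart_preimage_def)
  then obtain p q E where E: "frac_rep f \<tau> \<gamma> p q E"
    using assms(2) \<tau>(1) unfolding regular_iff by blast
  then have oE: "openin (affine_zariski \<Lambda> \<tau>) E" "\<gamma> \<in> E" by (simp_all add: frac_rep_def)
  obtain e where e: "supp e \<subseteq> S \<tau>" "pm_eval e \<gamma> \<noteq> 0" "{\<delta> \<in> U \<tau>. pm_eval e \<delta> \<noteq> 0} \<subseteq> E"
    by (rule openin_affine_zariskiD[OF oE])
  obtain b where b: "supp b \<subseteq> S \<sigma>" "pm_eval b \<delta> \<noteq> 0" "{\<delta> \<in> U \<sigma>. pm_eval b \<delta> \<noteq> 0} \<subseteq> D"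
    by (rule openin_affine_zariskiD[OF D])
  have p: "supp p \<subseteq> S \<tau>" "pm_eval p \<gamma> \<noteq> 0" using E fy \<tau>(3) by (auto simp: frac_rep_def)
  obtain l where l: "inj_on ((\<bullet>) l) (supp e \<union> supp b \<union> supp p)"
    using ex_inner_inj_on[of "supp e \<union> supp b \<union> supp p"] by auto
  have "\<forall>\<^sub>F s in at_top. pm_eval e (torus_point l s) \<noteq> 0 \<and> pm_eval b (torus_point l s) \<noteq> 0 \<and>
      pm_eval p (torus_point l s) \<noteq> 0"
    using p(2) e(2) b(2)
    by (intro eventually_conj eventually_pm_eval_torus_point_nonzero inj_on_subset[OF l]) auto
  then obtain s where s: "pm_eval e (torus_point l s) \<noteq> 0" "pm_eval b (torus_point l s) \<noteq> 0"
      "pm_eval p (torus_point l s) \<noteq> 0"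
    using eventually_happens'[OF trivial_limit_at_top_linorder] by blast
  have ev: "pm_eval r (torus \<rho> l s) = pm_eval r (torus_point l s)" if "supp r \<subseteq> S \<rho>" for r \<rho>
    using that by (intro pm_eval_cong) auto
  \<comment> \<open>One direction and one time serve both open sets; by \<open>chart_torus\<close>
    the two restrictions are the same point of the variety.\<close>
  have "torus \<tau> l s \<in> E" "torus \<sigma> l s \<in> D"
    using e b s torus_in_U ev by auto
  then have "f (ch \<tau> (torus \<tau> l s)) \<noteq> 0" "f (ch \<sigma> (torus \<sigma> l s)) = 0"
    using E f0 s(3) ev[OF p(1)] by (auto simp: frac_rep_def)
  then show False using chart_torus[OF \<tau>(1)] chart_torus[OF sigma] by simp
qed

text \<open>Sends every nonzero element to 0, which is multiplicative because the semigroup has no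
  nonzero units. Evaluation there reads off the constant coefficient.\<close>

definition vertex_hom where
  "vertex_hom = restrict (\<lambda>m. if m = 0 then 1 else 0 :: complex) (S \<sigma>)"

definition fixed_point where
  "fixed_point = ch \<sigma> vertex_hom"

lemma vertex_hom_in_U: "vertex_hom \<in> U \<sigma>"
  unfolding vertex_hom_def
proof (rule restrict_affine_points)
  fix m m' assume m: "m \<in> S \<sigma>" "m' \<in> S \<sigma>"
  then show "(if m + m' = 0 then 1 else 0 :: complex) = (if m = 0 then 1 else 0) * (if m' = 0 then 1 else 0)"
    using pointed[OF m] pointed[OF m(2,1)] by (auto simp: add.commute)
qed simp

lemma pm_eval_vertex_hom:
  assumes "supp p \<subseteq> S \<sigma>"
  shows "pm_eval p vertex_hom = cf p 0"
proof -
  have "pm_eval p vertex_hom = (\<Sum>m\<in>supp p. if m = 0 then cf p m else 0)"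
    unfolding pm_eval_def using assms by (intro sum.cong) (auto simp: vertex_hom_def)
  then show ?thesis by (simp add: in_keys_iff)
qed

definition C where
  "C = {f. \<exists>W. fan_open \<Lambda> \<Sigma> W \<and> fixed_point \<in> W \<and> f \<in> regular X W}"

definition I where
  "I = {f \<in> C. \<exists>W. fan_open \<Lambda> \<Sigma> W \<and> fixed_point \<in> W \<and> (\<forall>y\<in>W. f y = 0)}"

lemma local_ring_eq: "local_ring X fixed_point = function_ring C Quot I"
  by (simp add: local_ring_def functions_near_def function_ring_def C_def I_def openin_zariski)

lemma fixed_point_in: "fixed_point \<in> fan_points \<Lambda> \<Sigma>"
  unfolding fixed_point_def by (rule chart_in_fan_points[OF sigma vertex_hom_in_U])

lemma vertex_hom_in_preimage: "fixed_point \<in> W \<Longrightarrow> vertex_hom \<in> chart_preimage \<Lambda> \<Sigma> \<sigma> W"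
  using vertex_hom_in_U by (simp add: chart_preimage_def fixed_point_def)

lemma fan_open_Int: "fan_open \<Lambda> \<Sigma> W \<Longrightarrow> fan_open \<Lambda> \<Sigma> W' \<Longrightarrow> fan_open \<Lambda> \<Sigma> (W \<inter> W')"
  using istopology_fan_open unfolding istopology_def by blast

lemma regular_restrict:
  assumes "f \<in> regular X W" "fan_open \<Lambda> \<Sigma> W'" "W' \<subseteq> W"
  shows "f \<in> regular X W'"
  unfolding regular_iff
proof (intro ballI)
  fix \<tau> \<gamma> assume \<tau>: "\<tau> \<in> \<Sigma>" "\<gamma> \<in> chart_preimage \<Lambda> \<Sigma> \<tau> W'"
  then have "\<gamma> \<in> chart_preimage \<Lambda> \<Sigma> \<tau> W" using assms(3) by (auto simp: chart_preimage_def)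
  then obtain p q D where D: "frac_rep f \<tau> \<gamma> p q D" using assms(1) \<tau>(1) unfolding regular_iff by blast
  have "openin (affine_zariski \<Lambda> \<tau>) (D \<inter> chart_preimage \<Lambda> \<Sigma> \<tau> W')"
    using D assms(2) \<tau>(1) by (auto simp: frac_rep_def fan_open_def intro!: openin_Int)
  then have "frac_rep f \<tau> \<gamma> p q (D \<inter> chart_preimage \<Lambda> \<Sigma> \<tau> W')"
    using \<tau>(2) D by (intro frac_subset[OF D]) (auto simp: frac_rep_def)
  then show "\<exists>p q D. frac_rep f \<tau> \<gamma> p q D \<and> D \<subseteq> chart_preimage \<Lambda> \<Sigma> \<tau> W'"
    by (intro exI[of _ p] exI[of _ q] exI[of _ "D \<inter> chart_preimage \<Lambda> \<Sigma> \<tau> W'"]) simp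
qed

lemma function_algebra_C: "function_algebra C"
proof -
  have "(\<lambda>_. c) \<in> regular X (fan_points \<Lambda> \<Sigma>)" for c
    unfolding regular_iff
  proof (intro ballI)
    fix \<tau> \<gamma> assume "\<tau> \<in> \<Sigma>" "\<gamma> \<in> chart_preimage \<Lambda> \<Sigma> \<tau> (fan_points \<Lambda> \<Sigma>)"
    moreover from this have "U \<tau> \<subseteq> chart_preimage \<Lambda> \<Sigma> \<tau> (fan_points \<Lambda> \<Sigma>)" "\<gamma> \<in> U \<tau>"
      by (auto simp: chart_preimage_def chart_in_fan_points)
    ultimately show "\<exists>p q D. frac_rep (\<lambda>_. c) \<tau> \<gamma> p q D \<and> D \<subseteq> chart_preimage \<Lambda> \<Sigma> \<tau> (fan_points \<Lambda> \<Sigma>)"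
      using frac_const by blast
  qed
  then have "(\<lambda>_. c) \<in> C" for c
    using fan_open_fan_points fixed_point_in by (auto simp: C_def)
  moreover have "(\<lambda>y. f y + h y) \<in> C \<and> (\<lambda>y. f y * h y) \<in> C" if fh: "f \<in> C" "h \<in> C" for f h
  proof -
    obtain W W' where W: "fan_open \<Lambda> \<Sigma> W" "fixed_point \<in> W" "f \<in> regular X W"
      "fan_open \<Lambda> \<Sigma> W'" "fixed_point \<in> W'" "h \<in> regular X W'"
      using fh by (auto simp: C_def)
    have o: "fan_open \<Lambda> \<Sigma> (W \<inter> W')" using W fan_open_Int by blast
    have f: "f \<in> regular X (W \<inter> W')" and h: "h \<in> regular X (W \<inter> W')"
      using W o by (auto intro: regular_restrict)
    have "(\<lambda>y. f y + h y) \<in> regular X (W \<inter> W') \<and> (\<lambda>y. f y * h y) \<in> regular X (W \<inter> W')"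
      unfolding regular_iff
    proof (intro conjI ballI)
      fix \<tau> \<gamma> assume \<tau>: "\<tau> \<in> \<Sigma>" "\<gamma> \<in> chart_preimage \<Lambda> \<Sigma> \<tau> (W \<inter> W')"
      obtain p q D p' q' D' where D: "frac_rep f \<tau> \<gamma> p q D" "D \<subseteq> chart_preimage \<Lambda> \<Sigma> \<tau> (W \<inter> W')"
        "frac_rep h \<tau> \<gamma> p' q' D'"
        using f h \<tau> unfolding regular_iff by meson
      show "\<exists>p q D. frac_rep (\<lambda>y. f y + h y) \<tau> \<gamma> p q D \<and> D \<subseteq> chart_preimage \<Lambda> \<Sigma> \<tau> (W \<inter> W')"
        using frac_add[OF D(1,3)] D(2) by blast
      show "\<exists>p q D. frac_rep (\<lambda>y. f y * h y) \<tau> \<gamma> p q D \<and> D \<subseteq> chart_preimage \<Lambda> \<Sigma> \<tau> (W \<inter> W')"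
        using frac_mult[OF D(1,3)] D(2) by blast
    qed
    then show ?thesis using o W by (auto simp: C_def)
  qed
  ultimately show ?thesis by (simp add: function_algebra_def)
qed

lemma frac_at_fixed_point:
  assumes "f \<in> C"
  shows "\<exists>p q D. frac_rep f \<sigma> vertex_hom p q D"
proof -
  obtain W where W: "fixed_point \<in> W" "f \<in> regular X W" using assms by (auto simp: C_def)
  from regular_iff[THEN iffD1, rule_format, OF W(2) sigma vertex_hom_in_preimage[OF W(1)]]
  show ?thesis by auto
qed

lemma ideal_I: "ideal I (function_ring C)"
proof (rule ideal_function_ringI[OF function_algebra_C])
  show "I \<subseteq> C" by (auto simp: I_def)
  show "(\<lambda>_. 0) \<in> I"
    using fan_open_fan_points fixed_point_in function_algebraD(1)[OF function_algebra_C, of 0]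
    by (auto simp: I_def)
  show "(\<lambda>y. f y * h y) \<in> I" if "f \<in> C" "h \<in> I" for f h
    using that function_algebraD(3)[OF function_algebra_C] by (auto simp: I_def)
  show "(\<lambda>y. f y + h y) \<in> I" if fh: "f \<in> I" "h \<in> I" for f h
  proof -
    obtain W W' where W: "fan_open \<Lambda> \<Sigma> W" "fixed_point \<in> W" "\<forall>y\<in>W. f y = 0"
      "fan_open \<Lambda> \<Sigma> W'" "fixed_point \<in> W'" "\<forall>y\<in>W'. h y = 0"
      using fh by (auto simp: I_def)
    then have "fan_open \<Lambda> \<Sigma> (W \<inter> W') \<and> fixed_point \<in> W \<inter> W' \<and> (\<forall>y\<in>W \<inter> W'. f y + h y = 0)"
      using fan_open_Int by auto
    then show ?thesis
      using fh function_algebraD(2)[OF function_algebra_C] by (auto simp: I_def)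
  qed
qed

lemma I_at_fixed_point: "f \<in> I \<Longrightarrow> f fixed_point = 0"
  by (auto simp: I_def)

text \<open>By the identity principle, vanishing on any nonempty open subset of the chart suffices,
  whether or not it contains the fixed point.\<close>

lemma in_I:
  assumes "f \<in> C" "openin (affine_zariski \<Lambda> \<sigma>) D" "\<delta> \<in> D" "\<And>\<delta>. \<delta> \<in> D \<Longrightarrow> f (ch \<sigma> \<delta>) = 0"
  shows "f \<in> I"
proof -
  obtain W where W: "fan_open \<Lambda> \<Sigma> W" "fixed_point \<in> W" "f \<in> regular X W"
    using assms(1) by (auto simp: C_def)
  then have "\<forall>y\<in>W. f y = 0" using regular_eq_0[OF W(1,3) assms(2-4)] by blast
  then show ?thesis using W assms(1) by (auto simp: I_def)
qed

end

section \<open>Counting monomials in boxes\<close>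

definition lattice_box :: "nat \<Rightarrow> 'a::euclidean_space set" where
  "lattice_box k = {m. \<forall>b\<in>Basis. m \<bullet> b \<in> \<int> \<and> \<bar>m \<bullet> b\<bar> \<le> real k}"

lemma lattice_box_card:
  "finite (lattice_box k :: 'a::euclidean_space set)"
  "card (lattice_box k :: 'a set) \<le> (2 * k + 1) ^ DIM('a)"
proof -
  let ?P = "(Basis :: 'a set) \<rightarrow>\<^sub>E {- int k..int k}"
  let ?F = "\<lambda>g. \<Sum>b\<in>Basis. real_of_int (g b) *\<^sub>R b :: 'a"
  have sub: "lattice_box k \<subseteq> ?F ` ?P"
  proof
    fix m :: 'a assume m: "m \<in> lattice_box k"
    define g where "g = restrict (\<lambda>b. \<lfloor>m \<bullet> b\<rfloor>) Basis"
    have g: "real_of_int (g b) = m \<bullet> b" if "b \<in> Basis" for b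
      using m that by (auto simp: g_def lattice_box_def)
    have "g \<in> ?P"
    proof (rule PiE_I)
      fix b :: 'a assume b: "b \<in> Basis"
      have "\<bar>real_of_int (g b)\<bar> \<le> real k" using m b g[OF b] by (auto simp: lattice_box_def)
      then show "g b \<in> {- int k..int k}" by (auto simp: abs_le_iff)
    qed (simp add: g_def)
    moreover have "m = ?F g"
      using g by (simp add: euclidean_representation)
    ultimately show "m \<in> ?F ` ?P" by blast
  qed
  have fin: "finite ?P" by (intro finite_PiE) auto
  show "finite (lattice_box k :: 'a set)" using finite_subset[OF sub] fin by blast
  have "card (lattice_box k :: 'a set) \<le> card (?F ` ?P)"
    using fin sub by (intro card_mono) auto
  also have "\<dots> \<le> card ?P" by (rule card_image_le[OF fin])
  also have "card ?P = (2 * k + 1) ^ DIM('a)"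
    by (simp add: card_PiE nat_add_distrib nat_mult_distrib)
  finally show "card (lattice_box k :: 'a set) \<le> (2 * k + 1) ^ DIM('a)" .
qed

lemma lattice_box_0: "0 \<in> lattice_box k"
  by (simp add: lattice_box_def)

lemma lattice_box_add:
  assumes "m \<in> lattice_box k" "m' \<in> lattice_box k'"
  shows "m + m' \<in> lattice_box (k + k')"
  unfolding lattice_box_def
proof (intro CollectI ballI conjI)
  fix b :: 'a assume b: "b \<in> Basis"
  then show "(m + m') \<bullet> b \<in> \<int>" using assms by (auto simp: lattice_box_def inner_add_left)
  have "\<bar>m \<bullet> b\<bar> \<le> real k" "\<bar>m' \<bullet> b\<bar> \<le> real k'" using assms b by (auto simp: lattice_box_def)
  then show "\<bar>(m + m') \<bullet> b\<bar> \<le> real (k + k')" by (simp add: inner_add_left)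
qed

lemma supp_mult_lattice_box:
  assumes "supp p \<subseteq> lattice_box k" "supp q \<subseteq> lattice_box k'"
  shows "supp (p * q) \<subseteq> lattice_box (k + k')"
  using keys_mult[of p q] assms lattice_box_add by fastforce

lemma supp_power_lattice_box:
  assumes "supp p \<subseteq> lattice_box k"
  shows "supp (p ^ n) \<subseteq> lattice_box (n * k)"
proof (induction n)
  case (Suc n)
  then show ?case using supp_mult_lattice_box[OF assms Suc] by simp
qed (simp add: lattice_box_0)

lemma supp_prod_lattice_box:
  assumes "\<And>i. i \<in> A \<Longrightarrow> supp (p i) \<subseteq> lattice_box (k i)"
  shows "supp (\<Prod>i\<in>A. p i) \<subseteq> lattice_box (\<Sum>i\<in>A. k i)"
  using assms
  by (induction A rule: infinite_finite_induct) (simp_all add: lattice_box_0 supp_mult_lattice_box)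

lemma finite_subset_lattice_box:
  assumes "finite A" "\<And>m b. m \<in> A \<Longrightarrow> b \<in> Basis \<Longrightarrow> m \<bullet> b \<in> \<int>"
  obtains k where "A \<subseteq> lattice_box k"
proof -
  define M where "M = Max (insert 0 ((\<lambda>(m, b). \<bar>m \<bullet> b\<bar>) ` (A \<times> Basis)))"
  have "\<bar>m \<bullet> b\<bar> \<le> real (nat \<lceil>M\<rceil>)" if "m \<in> A" "b \<in> Basis" for m b
  proof -
    have "\<bar>m \<bullet> b\<bar> \<le> M" unfolding M_def using assms(1) that by (intro Max_ge) auto
    then show ?thesis by linarith
  qed
  then have "A \<subseteq> lattice_box (nat \<lceil>M\<rceil>)" using assms(2) by (auto simp: lattice_box_def)
  then show ?thesis by (rule that)
qed

text \<open>There are \<open>(N + 1) ^ Suc d\<close> products of \<open>d + 1\<close> elements with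
  exponents up to \<open>N\<close>, while a box of size \<open>c * N\<close> has at most
  \<open>(2 * (c * N) + 1) ^ d\<close> integral points. Growth of degree \<open>d + 1\<close> wins
  over degree \<open>d\<close>, and this \<open>N\<close> is large enough.\<close>

lemma exponent_count:
  fixes c d :: nat
  defines "N \<equiv> (2 * c + 1) ^ d"
  shows "(2 * (c * N) + 1) ^ d < (N + 1) ^ Suc d"
proof -
  have "2 * (c * N) + 1 \<le> (2 * c + 1) * (N + 1)" by (simp add: algebra_simps)
  then have "(2 * (c * N) + 1) ^ d \<le> ((2 * c + 1) * (N + 1)) ^ d" by (rule power_mono) simp
  also have "\<dots> = (2 * c + 1) ^ d * (N + 1) ^ d" by (rule power_mult_distrib)
  also have "\<dots> = N * (N + 1) ^ d" by (simp only: N_def)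
  also have "\<dots> < (N + 1) ^ Suc d" by simp
  finally show ?thesis .
qed

lemma supp_power_cone_semigroup:
  assumes "supp p \<subseteq> cone_semigroup \<Lambda> \<tau>"
  shows "supp (p ^ n) \<subseteq> cone_semigroup \<Lambda> \<tau>"
proof (induction n)
  case (Suc n)
  then show ?case using keys_mult_subset[OF assms Suc] by (simp add: cone_semigroup_add)
qed simp

lemma supp_prod_cone_semigroup:
  assumes "\<And>i. i \<in> A \<Longrightarrow> supp (p i) \<subseteq> cone_semigroup \<Lambda> \<tau>"
  shows "supp (\<Prod>i\<in>A. p i) \<subseteq> cone_semigroup \<Lambda> \<tau>"
  using assms
  by (induction A rule: infinite_finite_induct) (simp_all add: keys_mult_subset cone_semigroup_add)

lemma pm_eval_power_affine:
  assumes "\<gamma> \<in> affine_points \<Lambda> \<tau>" "supp p \<subseteq> cone_semigroup \<Lambda> \<tau>"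
  shows "pm_eval (p ^ n) \<gamma> = pm_eval p \<gamma> ^ n"
proof (induction n)
  case (Suc n)
  then show ?case
    using pm_eval_mult_affine[OF assms supp_power_cone_semigroup[OF assms(2), of n]] by simp
qed (simp add: affine_points_0[OF assms(1)])

lemma pm_eval_prod_affine:
  assumes "\<gamma> \<in> affine_points \<Lambda> \<tau>" "\<And>i. i \<in> A \<Longrightarrow> supp (p i) \<subseteq> cone_semigroup \<Lambda> \<tau>"
  shows "pm_eval (\<Prod>i\<in>A. p i) \<gamma> = (\<Prod>i\<in>A. pm_eval (p i) \<gamma>)"
  using assms(2)
proof (induction A rule: infinite_finite_induct)
  case (insert x F)
  then show ?case
    using pm_eval_mult_affine[OF assms(1), of "p x" "\<Prod>i\<in>F. p i"] supp_prod_cone_semigroup[of F p \<Lambda> \<tau>]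
    by simp
qed (simp_all add: affine_points_0[OF assms(1)])

section \<open>Krull dimension and characters at the fixed point\<close>

context toric_fixed_point
begin

text \<open>All products of the \<open>f i\<close> with exponents up to \<open>N\<close> are brought
  to one denominator. Their numerators outnumber the available monomials, so they are linearly
  dependent; the dependence holds on an open part of the chart, hence modulo
  \<open>I\<close>.\<close>

lemma algebraic_relation:
  fixes f :: "nat \<Rightarrow> ('a set \<times> ('a \<Rightarrow> complex)) set \<Rightarrow> complex"
  assumes f: "\<And>i. i \<le> DIM('a) \<Longrightarrow> f i \<in> C"
  shows "\<exists>B c. finite B \<and> B \<noteq> {} \<and> B \<subseteq> extensional {..DIM('a)} \<and>
        (\<forall>\<alpha>\<in>B. c \<alpha> \<noteq> 0) \<and> (\<lambda>y. \<Sum>\<alpha>\<in>B. c \<alpha> * (\<Prod>i\<le>DIM('a). f i y ^ \<alpha> i)) \<in> I"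
proof -
  define d where "d = DIM('a)"
  have "\<exists>p q D. frac_rep (f i) \<sigma> vertex_hom p q D" if "i \<le> d" for i
    using frac_at_fixed_point[of "f i"] f[of i] that by (auto simp: d_def)
  then obtain p q D where fr: "\<And>i. i \<le> d \<Longrightarrow> frac_rep (f i) \<sigma> vertex_hom (p i) (q i) (D i)" by metis
  define D' where "D' = (\<Inter>i\<le>d. D i)"
  have D': "openin (affine_zariski \<Lambda> \<sigma>) D'" "vertex_hom \<in> D'" "\<And>i. i \<le> d \<Longrightarrow> D' \<subseteq> D i"
    using fr unfolding D'_def by (auto simp: frac_rep_def intro!: openin_INT2)
  have pS: "supp (p i) \<subseteq> S \<sigma>" and qS: "supp (q i) \<subseteq> S \<sigma>" if "i \<le> d" for i
    using fr[OF that] by (simp_all add: frac_rep_def)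
  obtain k where k: "(\<Union>i\<le>d. supp (p i) \<union> supp (q i)) \<subseteq> lattice_box k"
  proof (rule finite_subset_lattice_box)
    show "finite (\<Union>i\<le>d. supp (p i) \<union> supp (q i))" by simp
    show "m \<bullet> b \<in> \<int>" if "m \<in> (\<Union>i\<le>d. supp (p i) \<union> supp (q i))" "b \<in> Basis" for m b
      using that pS qS by (intro dual_integral) (auto dest!: subsetD intro: cone_semigroup_dual_lattice)
  qed
  \<comment> \<open>Each \<open>G \<alpha>\<close> below is a product over \<open>d + 1\<close>
    indices of \<open>N\<close> factors supported in the box of size \<open>k\<close>, hence is
    supported in the box of size \<open>c * N\<close>.\<close>
  define c where "c = Suc d * k"
  define N where "N = (2 * c + 1) ^ d"
  define E where "E = {..d} \<rightarrow>\<^sub>E {..N}"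
  \<comment> \<open>The numerator of the product of the \<open>f i ^ \<alpha> i\<close> over the
    common denominator, the product of all \<open>q i ^ N\<close>.\<close>
  define G where "G \<alpha> = (\<Prod>i\<le>d. p i ^ \<alpha> i * q i ^ (N - \<alpha> i))" for \<alpha>
  have finE: "finite E" unfolding E_def by (intro finite_PiE) auto
  have supp_G: "supp (G \<alpha>) \<subseteq> lattice_box (c * N)" if "\<alpha> \<in> E" for \<alpha>
  proof -
    have "supp (G \<alpha>) \<subseteq> lattice_box (\<Sum>i\<le>d. \<alpha> i * k + (N - \<alpha> i) * k)"
      unfolding G_def
    proof (rule supp_prod_lattice_box)
      fix i assume "i \<in> {..d}"
      then have "supp (p i) \<subseteq> lattice_box k" "supp (q i) \<subseteq> lattice_box k" using k by auto
      then show "supp (p i ^ \<alpha> i * q i ^ (N - \<alpha> i)) \<subseteq> lattice_box (\<alpha> i * k + (N - \<alpha> i) * k)"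
        by (intro supp_mult_lattice_box supp_power_lattice_box)
    qed
    also have "(\<Sum>i\<le>d. \<alpha> i * k + (N - \<alpha> i) * k) = (\<Sum>i\<le>d. N * k)"
    proof (intro sum.cong refl)
      fix i assume "i \<in> {..d}"
      then have "\<alpha> i \<le> N" using that by (auto simp: E_def PiE_iff)
      then show "\<alpha> i * k + (N - \<alpha> i) * k = N * k" by (simp flip: add_mult_distrib)
    qed
    also have "\<dots> = c * N" by (simp add: c_def algebra_simps)
    finally show ?thesis .
  qed
  have "card (lattice_box (c * N) :: 'a set) \<le> (2 * (c * N) + 1) ^ d"
    unfolding d_def by (rule lattice_box_card)
  also have "\<dots> < (N + 1) ^ Suc d" unfolding N_def by (rule exponent_count)
  also have "\<dots> = card E" by (simp add: E_def card_PiE)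
  finally have "card (lattice_box (c * N) :: 'a set) < card E" .
  from homogeneous_system_nontrivial_solution[OF lattice_box_card(1) finE this, of "\<lambda>m \<alpha>. cf (G \<alpha>) m"]
  obtain x where x: "\<exists>\<alpha>\<in>E. x \<alpha> \<noteq> 0" "\<And>m. m \<in> lattice_box (c * N) \<Longrightarrow> (\<Sum>\<alpha>\<in>E. cf (G \<alpha>) m * x \<alpha>) = 0"
    by auto
  \<comment> \<open>Zero coefficients are dropped, as \<open>prime_chain_no_relation\<close> asks
    for nonzero ones.\<close>
  define B where "B = {\<alpha>\<in>E. x \<alpha> \<noteq> 0}"
  let ?F = "\<lambda>y. \<Sum>\<alpha>\<in>B. x \<alpha> * (\<Prod>i\<le>d. f i y ^ \<alpha> i)"
  have "?F \<in> C"
  proof (intro function_algebra_sum[OF function_algebra_C] function_algebraD(1,3)[OF function_algebra_C]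
      function_algebra_prod[OF function_algebra_C] function_algebra_power[OF function_algebra_C])
    show "f i \<in> C" if "i \<in> {..d}" for i using f[of i] that by (simp add: d_def)
  qed
  moreover have "?F (ch \<sigma> \<delta>) = 0" if \<delta>: "\<delta> \<in> D'" for \<delta>
  proof -
    have \<delta>U: "\<delta> \<in> U \<sigma>" using D'(1) \<delta> openin_affine_zariski_subset by blast
    have fi: "f i (ch \<sigma> \<delta>) = pm_eval (p i) \<delta> / pm_eval (q i) \<delta>" "pm_eval (q i) \<delta> \<noteq> 0" if "i \<le> d" for i
      using fr[OF that] D'(3)[OF that] \<delta> by (auto simp: frac_rep_def)
    define Q where "Q = (\<Prod>i\<le>d. pm_eval (q i) \<delta> ^ N)"
    have Q: "Q \<noteq> 0" using fi(2) by (simp add: Q_def)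
    have monomial: "(\<Prod>i\<le>d. f i (ch \<sigma> \<delta>) ^ \<alpha> i) * Q = pm_eval (G \<alpha>) \<delta>" if "\<alpha> \<in> E" for \<alpha>
    proof -
      have "pm_eval (G \<alpha>) \<delta> = (\<Prod>i\<le>d. pm_eval (p i ^ \<alpha> i * q i ^ (N - \<alpha> i)) \<delta>)"
        unfolding G_def using pS qS
        by (intro pm_eval_prod_affine[OF \<delta>U] keys_mult_subset supp_power_cone_semigroup cone_semigroup_add) auto
      also have "\<dots> = (\<Prod>i\<le>d. f i (ch \<sigma> \<delta>) ^ \<alpha> i * pm_eval (q i) \<delta> ^ N)"
      proof (intro prod.cong refl)
        fix i assume "i \<in> {..d}"
        then have i: "i \<le> d" by simp
        then have "\<alpha> i \<le> N" using that by (auto simp: E_def PiE_iff)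
        then have "pm_eval (q i) \<delta> ^ N = pm_eval (q i) \<delta> ^ \<alpha> i * pm_eval (q i) \<delta> ^ (N - \<alpha> i)"
          by (simp flip: power_add)
        moreover have "pm_eval (p i ^ \<alpha> i * q i ^ (N - \<alpha> i)) \<delta> =
            pm_eval (p i) \<delta> ^ \<alpha> i * pm_eval (q i) \<delta> ^ (N - \<alpha> i)"
          by (simp add: pm_eval_mult_affine[OF \<delta>U] supp_power_cone_semigroup pS[OF i] qS[OF i]
              pm_eval_power_affine[OF \<delta>U])
        ultimately show "pm_eval (p i ^ \<alpha> i * q i ^ (N - \<alpha> i)) \<delta> = f i (ch \<sigma> \<delta>) ^ \<alpha> i * pm_eval (q i) \<delta> ^ N"
          using fi[OF i] by (simp add: power_divide)
      qed
      finally show ?thesis by (simp add: Q_def prod.distrib)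
    qed
    have "?F (ch \<sigma> \<delta>) * Q = (\<Sum>\<alpha>\<in>E. x \<alpha> * (\<Prod>i\<le>d. f i (ch \<sigma> \<delta>) ^ \<alpha> i)) * Q"
      using finE by (intro arg_cong[of _ _ "\<lambda>z. z * Q"] sum.mono_neutral_left) (auto simp: B_def)
    also have "\<dots> = (\<Sum>\<alpha>\<in>E. x \<alpha> * pm_eval (G \<alpha>) \<delta>)"
      unfolding sum_distrib_right by (intro sum.cong refl) (simp add: mult.assoc monomial)
    also have "\<dots> = (\<Sum>\<alpha>\<in>E. x \<alpha> * (\<Sum>m\<in>lattice_box (c * N). cf (G \<alpha>) m * \<delta> m))"
      by (intro sum.cong refl) (simp add: pm_eval_superset[OF lattice_box_card(1) supp_G])
    also have "\<dots> = (\<Sum>\<alpha>\<in>E. \<Sum>m\<in>lattice_box (c * N). cf (G \<alpha>) m * x \<alpha> * \<delta> m)"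
      by (simp add: sum_distrib_left mult_ac)
    also have "\<dots> = (\<Sum>m\<in>lattice_box (c * N). \<Sum>\<alpha>\<in>E. cf (G \<alpha>) m * x \<alpha> * \<delta> m)"
      by (rule sum.swap)
    also have "\<dots> = (\<Sum>m\<in>lattice_box (c * N). (\<Sum>\<alpha>\<in>E. cf (G \<alpha>) m * x \<alpha>) * \<delta> m)"
      by (simp add: sum_distrib_right)
    also have "\<dots> = 0" using x(2) by simp
    finally show ?thesis using Q by simp
  qed
  ultimately have "?F \<in> I" using in_I[OF _ D'(1,2)] by blast
  moreover have "finite B" "B \<noteq> {}" "\<forall>\<alpha>\<in>B. x \<alpha> \<noteq> 0"
    using finE x(1) by (auto simp: B_def)
  moreover have "B \<subseteq> extensional {..d}" by (auto simp: B_def E_def PiE_iff)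
  ultimately show ?thesis unfolding d_def by blast
qed

lemma krull_dim_local_ring: "krull_dim (local_ring X fixed_point) \<le> enat DIM('a)"
  unfolding local_ring_eq
  by (rule krull_dim_Quot_le[OF function_algebra_C ideal_I algebraic_relation])

text \<open>The image of the chart of \<open>\<sigma>\<close>, without presupposing that gluing is transitive.\<close>

definition chart_nbhd where
  "chart_nbhd = {y \<in> fan_points \<Lambda> \<Sigma>. \<exists>\<gamma>. (\<sigma>, \<gamma>) \<in> y}"

text \<open>Evaluates a representative in the chart of \<sigma>. Outside \<open>chart_nbhd\<close>
  there is none and the value is arbitrary, as is allowed for sections over
  \<open>chart_nbhd\<close>.\<close>

definition character where
  "character h y = (SOME \<gamma>. (\<sigma>, \<gamma>) \<in> y) h" for h :: 'a and y :: "'a toric_point"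

text \<open>Inverting the separating character \<open>m\<close> on the chart of \<tau> gives its
  overlap with the chart of \<sigma>. The last clause writes a character \<open>h\<close> of
  \<sigma> as a quotient of two characters of \<tau>, the form that regularity asks for.\<close>

lemma chart_nbhd_separation:
  assumes "\<tau> \<in> \<Sigma>"
  obtains m where "m \<in> S \<tau>" "chart_preimage \<Lambda> \<Sigma> \<tau> chart_nbhd = {\<delta> \<in> U \<tau>. \<delta> m \<noteq> 0}"
    "\<forall>h \<in> S \<sigma>. \<exists>k::nat. h + of_nat k *\<^sub>R m \<in> S \<tau> \<and>
      (\<forall>\<delta> \<gamma>. (\<sigma>, \<gamma>) \<in> ch \<tau> \<delta> \<longrightarrow> \<gamma> h * \<delta> (of_nat k *\<^sub>R m) = \<delta> (h + of_nat k *\<^sub>R m))"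
proof -
  obtain m where m: "m \<in> S \<tau>" "- m \<in> S (\<tau> \<inter> \<sigma>)"
    "\<And>h. h \<in> S (\<tau> \<inter> \<sigma>) \<Longrightarrow> \<exists>k::nat. h + of_nat k *\<^sub>R m \<in> S \<tau>"
    using separation[OF assms] by blast
  have S\<tau>: "S \<tau> \<subseteq> S (\<tau> \<inter> \<sigma>)" and S\<sigma>: "S \<sigma> \<subseteq> S (\<tau> \<inter> \<sigma>)"
    by (auto intro!: cone_semigroup_antimono)
  have m': "m \<in> S (\<tau> \<inter> \<sigma>)" using m(1) S\<tau> by auto
  show ?thesis
  proof
    show "m \<in> S \<tau>" by (rule m)
    show "chart_preimage \<Lambda> \<Sigma> \<tau> chart_nbhd = {\<delta> \<in> U \<tau>. \<delta> m \<noteq> 0}"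
    proof (rule equalityI; rule subsetI)
      fix \<delta> assume "\<delta> \<in> chart_preimage \<Lambda> \<Sigma> \<tau> chart_nbhd"
      then obtain \<gamma> \<eta> where \<eta>: "\<delta> \<in> U \<tau>" "\<eta> \<in> U (\<tau> \<inter> \<sigma>)" "\<delta> = restrict \<eta> (S \<tau>)"
        by (auto simp: chart_preimage_def chart_nbhd_def chart_def glue_def)
      \<comment> \<open>Both \<open>m\<close> and \<open>- m\<close> belong to the semigroup of the
        intersection, so the value at \<open>m\<close> is invertible.\<close>
      have "\<eta> (m + - m) = \<eta> m * \<eta> (- m)" by (rule affine_points_add[OF \<eta>(2) m' m(2)])
      then have "\<eta> m \<noteq> 0" using affine_points_0[OF \<eta>(2)] by auto
      then show "\<delta> \<in> {\<delta> \<in> U \<tau>. \<delta> m \<noteq> 0}" using \<eta> m(1) by simp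
    next
      fix \<delta> assume "\<delta> \<in> {\<delta> \<in> U \<tau>. \<delta> m \<noteq> 0}"
      then have \<delta>: "\<delta> \<in> U \<tau>" "\<delta> m \<noteq> 0" by auto
      obtain k :: "'a \<Rightarrow> nat" where k: "\<And>h. h \<in> S (\<tau> \<inter> \<sigma>) \<Longrightarrow> h + of_nat (k h) *\<^sub>R m \<in> S \<tau>"
        using m(3) by metis
      \<comment> \<open>The extension of \<delta> to the semigroup of the intersection; the next
        fact shows that the quotient does not depend on the multiple of \<open>m\<close> that is
        added.\<close>
      define e where "e h = \<delta> (h + of_nat (k h) *\<^sub>R m) / \<delta> m ^ k h" for h
      have e: "e h * \<delta> m ^ n = \<delta> (h + of_nat n *\<^sub>R m)"
        if "h \<in> S (\<tau> \<inter> \<sigma>)" "h + of_nat n *\<^sub>R m \<in> S \<tau>" for h n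
      proof -
        have "\<delta> (h + of_nat (k h) *\<^sub>R m) * \<delta> m ^ n = \<delta> (h + of_nat (k h) *\<^sub>R m + of_nat n *\<^sub>R m)"
          using affine_points_add[OF \<delta>(1) k[OF that(1)] cone_semigroup_scale[OF m(1)]]
          by (simp add: affine_points_scale[OF \<delta>(1) m(1)])
        also have "h + of_nat (k h) *\<^sub>R m + of_nat n *\<^sub>R m = h + of_nat n *\<^sub>R m + of_nat (k h) *\<^sub>R m"
          by simp
        also have "\<delta> \<dots> = \<delta> (h + of_nat n *\<^sub>R m) * \<delta> m ^ k h"
          using affine_points_add[OF \<delta>(1) that(2) cone_semigroup_scale[OF m(1)]]
          by (simp add: affine_points_scale[OF \<delta>(1) m(1)])
        finally show ?thesis using \<delta>(2) by (simp add: e_def field_simps)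
      qed
      define \<eta> where "\<eta> = restrict e (S (\<tau> \<inter> \<sigma>))"
      have \<eta>U: "\<eta> \<in> U (\<tau> \<inter> \<sigma>)"
        unfolding \<eta>_def
      proof (rule restrict_affine_points)
        have "e 0 * \<delta> m ^ 0 = \<delta> (0 + of_nat 0 *\<^sub>R m)" by (rule e) auto
        then show "e 0 = 1" using affine_points_0[OF \<delta>(1)] by simp
        fix a b assume ab: "a \<in> S (\<tau> \<inter> \<sigma>)" "b \<in> S (\<tau> \<inter> \<sigma>)"
        have ab_eq: "a + b + of_nat (k a + k b) *\<^sub>R m = (a + of_nat (k a) *\<^sub>R m) + (b + of_nat (k b) *\<^sub>R m)"
          by (simp add: scaleR_left_distrib)
        have "e (a + b) * \<delta> m ^ (k a + k b) = \<delta> (a + b + of_nat (k a + k b) *\<^sub>R m)"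
          unfolding ab_eq
          by (subst ab_eq[symmetric], rule e)
            (use ab k in \<open>auto simp: cone_semigroup_add ab_eq simp del: of_nat_add\<close>)
        also have "\<dots> = \<delta> (a + of_nat (k a) *\<^sub>R m) * \<delta> (b + of_nat (k b) *\<^sub>R m)"
          unfolding ab_eq by (rule affine_points_add[OF \<delta>(1) k[OF ab(1)] k[OF ab(2)]])
        also have "\<dots> = (e a * e b) * \<delta> m ^ (k a + k b)"
          by (simp only: e[OF ab(1) k[OF ab(1)], symmetric] e[OF ab(2) k[OF ab(2)], symmetric]
              power_add mult_ac)
        finally show "e (a + b) = e a * e b" using \<delta>(2) by simp
      qed
      have "\<delta> = restrict \<eta> (S \<tau>)"
      proof
        fix h
        show "\<delta> h = restrict \<eta> (S \<tau>) h"
        proof (cases "h \<in> S \<tau>")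
          case True
          then have "h \<in> S (\<tau> \<inter> \<sigma>)" using S\<tau> by auto
          then show ?thesis using e[of h 0] True by (simp add: \<eta>_def)
        next
          case False
          then show ?thesis using \<delta>(1) by (auto simp: affine_points_def extensional_def)
        qed
      qed
      moreover have "restrict \<eta> (S \<sigma>) \<in> U \<sigma>"
        using \<eta>U S\<sigma> affine_points_0[OF \<eta>U]
        by (intro restrict_affine_points affine_points_add[OF \<eta>U]) auto
      ultimately have "((\<tau>, \<delta>), (\<sigma>, restrict \<eta> (S \<sigma>))) \<in> glue \<Lambda> \<Sigma>"
        using \<eta>U \<delta>(1) assms sigma by (auto simp: glue_def)
      then show "\<delta> \<in> chart_preimage \<Lambda> \<Sigma> \<tau> chart_nbhd"
        using \<delta>(1) chart_in_fan_points[OF assms \<delta>(1)]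
        by (auto simp: chart_preimage_def chart_nbhd_def chart_def)
    qed
  next
    show "\<forall>h \<in> S \<sigma>. \<exists>k::nat. h + of_nat k *\<^sub>R m \<in> S \<tau> \<and>
      (\<forall>\<delta> \<gamma>. (\<sigma>, \<gamma>) \<in> ch \<tau> \<delta> \<longrightarrow> \<gamma> h * \<delta> (of_nat k *\<^sub>R m) = \<delta> (h + of_nat k *\<^sub>R m))"
    proof
      fix h assume h: "h \<in> S \<sigma>"
      then have h': "h \<in> S (\<tau> \<inter> \<sigma>)" using S\<sigma> by auto
      then obtain k :: nat where k: "h + of_nat k *\<^sub>R m \<in> S \<tau>" using m(3) by auto
      have "\<gamma> h * \<delta> (of_nat k *\<^sub>R m) = \<delta> (h + of_nat k *\<^sub>R m)" if "(\<sigma>, \<gamma>) \<in> ch \<tau> \<delta>" for \<gamma> \<delta>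
      proof -
        obtain \<eta> where \<eta>: "\<eta> \<in> U (\<tau> \<inter> \<sigma>)" "\<delta> = restrict \<eta> (S \<tau>)" "\<gamma> = restrict \<eta> (S \<sigma>)"
          using \<open>(\<sigma>, \<gamma>) \<in> ch \<tau> \<delta>\<close> by (auto simp: chart_def glue_def)
        have "\<eta> (h + of_nat k *\<^sub>R m) = \<eta> h * \<eta> (of_nat k *\<^sub>R m)"
          by (rule affine_points_add[OF \<eta>(1) h' cone_semigroup_scale[OF m']])
        then show ?thesis using h k cone_semigroup_scale[OF m(1), of k] by (simp add: \<eta>(2,3))
      qed
      then show "\<exists>k::nat. h + of_nat k *\<^sub>R m \<in> S \<tau> \<and>
        (\<forall>\<delta> \<gamma>. (\<sigma>, \<gamma>) \<in> ch \<tau> \<delta> \<longrightarrow> \<gamma> h * \<delta> (of_nat k *\<^sub>R m) = \<delta> (h + of_nat k *\<^sub>R m))"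
        using k by blast
    qed
  qed
qed

lemma fan_open_chart_nbhd: "fan_open \<Lambda> \<Sigma> chart_nbhd"
  unfolding fan_open_def
proof (intro conjI ballI)
  show "chart_nbhd \<subseteq> fan_points \<Lambda> \<Sigma>" by (auto simp: chart_nbhd_def)
  fix \<tau> assume "\<tau> \<in> \<Sigma>"
  then obtain m where m: "m \<in> S \<tau>" "chart_preimage \<Lambda> \<Sigma> \<tau> chart_nbhd = {\<delta> \<in> U \<tau>. \<delta> m \<noteq> 0}"
    by (rule chart_nbhd_separation)
  have "openin (affine_zariski \<Lambda> \<tau>) {\<delta> \<in> U \<tau>. pm_eval (Poly_Mapping.single m 1) \<delta> \<noteq> 0}"
    using m(1) by (intro openin_affine_zariski_basic) auto
  then show "openin (affine_zariski \<Lambda> \<tau>) (chart_preimage \<Lambda> \<Sigma> \<tau> chart_nbhd)" by (simp add: m(2))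
qed

lemma fixed_point_chart_nbhd: "fixed_point \<in> chart_nbhd"
  using fixed_point_in glue_refl[OF sigma vertex_hom_in_U]
  by (auto simp: chart_nbhd_def fixed_point_def chart_def)

lemma character_chart:
  assumes "\<gamma> \<in> U \<sigma>" "h \<in> S \<sigma>"
  shows "character h (ch \<sigma> \<gamma>) = \<gamma> h"
proof -
  have mem: "(\<sigma>, \<gamma>) \<in> ch \<sigma> \<gamma>"
    using glue_refl[OF sigma assms(1)] by (simp add: chart_def)
  have "\<gamma>' h = \<gamma> h" if "(\<sigma>, \<gamma>') \<in> ch \<sigma> \<gamma>" for \<gamma>'
    using that by (auto simp: chart_def glue_def)
  then show ?thesis unfolding character_def using someI[of "\<lambda>\<gamma>'. (\<sigma>, \<gamma>') \<in> ch \<sigma> \<gamma>", OF mem] by blast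
qed

text \<open>On each chart \<tau> the character is the quotient of the character
  \<open>h + k m\<close> by \<open>k m\<close> for some \<open>k\<close>, and this denominator
  vanishes nowhere on the overlap.\<close>

lemma character_in_C:
  assumes h: "h \<in> S \<sigma>"
  shows "character h \<in> C"
proof -
  have "character h \<in> regular X chart_nbhd"
    unfolding regular_iff
  proof (intro ballI)
    fix \<tau> \<gamma> assume \<tau>: "\<tau> \<in> \<Sigma>" "\<gamma> \<in> chart_preimage \<Lambda> \<Sigma> \<tau> chart_nbhd"
    let ?D = "chart_preimage \<Lambda> \<Sigma> \<tau> chart_nbhd"
    obtain m where m: "m \<in> S \<tau>" "?D = {\<delta> \<in> U \<tau>. \<delta> m \<noteq> 0}"
      "\<forall>h \<in> S \<sigma>. \<exists>k::nat. h + of_nat k *\<^sub>R m \<in> S \<tau> \<and>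
        (\<forall>\<delta> \<gamma>. (\<sigma>, \<gamma>) \<in> ch \<tau> \<delta> \<longrightarrow> \<gamma> h * \<delta> (of_nat k *\<^sub>R m) = \<delta> (h + of_nat k *\<^sub>R m))"
      by (rule chart_nbhd_separation[OF \<tau>(1)])
    obtain k :: nat where k: "h + of_nat k *\<^sub>R m \<in> S \<tau>"
      "\<And>\<delta> \<gamma>. (\<sigma>, \<gamma>) \<in> ch \<tau> \<delta> \<Longrightarrow> \<gamma> h * \<delta> (of_nat k *\<^sub>R m) = \<delta> (h + of_nat k *\<^sub>R m)"
      using m(3) h by blast
    have "frac_rep (character h) \<tau> \<gamma> (Poly_Mapping.single (h + of_nat k *\<^sub>R m) 1)
        (Poly_Mapping.single (of_nat k *\<^sub>R m) 1) ?D"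
      unfolding frac_rep_def
    proof (intro conjI ballI)
      fix \<delta> assume \<delta>: "\<delta> \<in> ?D"
      then have \<delta>': "\<delta> \<in> U \<tau>" "\<delta> m \<noteq> 0" using m(2) by auto
      then have nz: "\<delta> (of_nat k *\<^sub>R m) \<noteq> 0" by (simp add: affine_points_scale[OF _ m(1)])
      then show "pm_eval (Poly_Mapping.single (of_nat k *\<^sub>R m) 1) \<delta> \<noteq> 0" by simp
      have "\<exists>\<gamma>. (\<sigma>, \<gamma>) \<in> ch \<tau> \<delta>" using \<delta> by (simp add: chart_preimage_def chart_nbhd_def)
      then have "(\<sigma>, SOME \<gamma>. (\<sigma>, \<gamma>) \<in> ch \<tau> \<delta>) \<in> ch \<tau> \<delta>" by (rule someI_ex)
      then have "character h (ch \<tau> \<delta>) * \<delta> (of_nat k *\<^sub>R m) = \<delta> (h + of_nat k *\<^sub>R m)"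
        unfolding character_def by (rule k(2))
      then show "character h (ch \<tau> \<delta>) = pm_eval (Poly_Mapping.single (h + of_nat k *\<^sub>R m) 1) \<delta> /
          pm_eval (Poly_Mapping.single (of_nat k *\<^sub>R m) 1) \<delta>"
        using nz by (simp add: field_simps)
    qed (use k(1) cone_semigroup_scale[OF m(1), of k] \<tau> fan_open_chart_nbhd in \<open>auto simp: fan_open_def\<close>)
    then show "\<exists>p q D. frac_rep (character h) \<tau> \<gamma> p q D \<and> D \<subseteq> ?D" by blast
  qed
  then show ?thesis using fan_open_chart_nbhd fixed_point_chart_nbhd by (auto simp: C_def)
qed

text \<open>Every irreducible element of the semigroup gives a tangent vector at the fixed point,
  namely the coefficient of the corresponding character.\<close>

theorem not_smooth:
  assumes H: "H \<subseteq> S \<sigma>" "finite H" "DIM('a) < card H" "0 \<notin> H"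
    and irr: "\<And>a b. a \<in> S \<sigma> \<Longrightarrow> b \<in> S \<sigma> \<Longrightarrow> a + b \<in> H \<Longrightarrow> a = 0 \<or> b = 0"
  shows "\<not> smooth_variety X"
proof
  assume "smooth_variety X"
  then have reg: "regular_local_ring (function_ring C Quot I)"
    using fixed_point_in by (simp add: smooth_variety_def topspace_zariski flip: local_ring_eq)
  obtain G where G: "G \<subseteq> {f \<in> C. f fixed_point = 0}" "finite G" "card G \<le> DIM('a)"
    "\<forall>J. ideal J (function_ring C) \<and> I \<subseteq> J \<and> G \<subseteq> J \<longrightarrow> {f \<in> C. f fixed_point = 0} \<subseteq> J"
    by (rule regular_local_ring_generators[OF function_algebra_C ideal_I I_at_fixed_point reg
        krull_dim_local_ring[unfolded local_ring_eq]])
  have "\<exists>p q D. frac_rep f \<sigma> vertex_hom p q D" if "f \<in> G" for f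
    using frac_at_fixed_point[of f] G(1) that by blast
  then obtain P Q D where fr: "\<And>f. f \<in> G \<Longrightarrow> frac_rep f \<sigma> vertex_hom (P f) (Q f) (D f)" by metis
  \<comment> \<open>The unknowns are the components of a tangent vector along the elements of
    \<open>H\<close>, and the equations say that it annihilates the numerators of the generators.
    There are fewer equations than unknowns.\<close>
  have "card G < card H" using G(3) H(3) by simp
  from homogeneous_system_nontrivial_solution[OF G(2) H(2) this, of "\<lambda>f h. cf (P f) h"]
  obtain x where x: "\<exists>h\<in>H. x h \<noteq> 0" "\<And>f. f \<in> G \<Longrightarrow> (\<Sum>h\<in>H. cf (P f) h * x h) = 0" by auto
  define v where "v m = (if m \<in> H then x m else 0)" for m
  have v_eval: "pm_eval p v = (\<Sum>h\<in>H. cf p h * x h)" for p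
  proof -
    have "pm_eval p v = (\<Sum>m\<in>supp p \<union> H. cf p m * v m)"
      using H(2) by (intro pm_eval_superset) auto
    also have "\<dots> = (\<Sum>h\<in>H. cf p h * v h)"
      using H(2) by (intro sum.mono_neutral_right) (auto simp: v_def)
    finally show ?thesis by (simp add: v_def)
  qed
  have v0: "v 0 = 0" using H(4) by (simp add: v_def)
  \<comment> \<open>\<open>v\<close> is a derivation at the fixed point: by irreducibility the sum
    of two nonzero elements of the semigroup is never in \<open>H\<close>, so both sides vanish on
    it.\<close>
  have v_mult: "pm_eval (p * q) v = pm_eval p v * cf q 0 + cf p 0 * pm_eval q v"
    if pq: "supp p \<subseteq> S \<sigma>" "supp q \<subseteq> S \<sigma>" for p q
  proof -
    have "pm_eval (p * q) v = pm_eval p v * pm_eval q vertex_hom + pm_eval p vertex_hom * pm_eval q v"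
    proof (rule pm_eval_mult_derivation)
      fix m m' assume "m \<in> supp p" "m' \<in> supp q"
      then have m: "m \<in> S \<sigma>" "m' \<in> S \<sigma>" using pq by auto
      show "v (m + m') = v m * vertex_hom m' + vertex_hom m * v m'"
      proof (cases "m = 0 \<or> m' = 0")
        case True
        then show ?thesis using m v0 by (auto simp: vertex_hom_def)
      next
        case False
        then have "m + m' \<notin> H" using irr[OF m] by blast
        then show ?thesis using False m by (simp add: vertex_hom_def v_def)
      qed
    qed
    then show ?thesis using pq by (simp add: pm_eval_vertex_hom)
  qed
  have cf_mult: "cf (p * q) 0 = cf p 0 * cf q 0" if pq: "supp p \<subseteq> S \<sigma>" "supp q \<subseteq> S \<sigma>" for p q
    using pm_eval_mult_affine[OF vertex_hom_in_U pq] supp_S(1)[OF pq] pq by (simp add: pm_eval_vertex_hom)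
  \<comment> \<open>The part of the maximal ideal killed by the tangent vector. Asking for just one
    suitable presentation spares a proof that the tangent vector is well defined on germs; only a
    presentation of one character is examined at the end.\<close>
  define J where "J = {f \<in> C. \<exists>p q D. frac_rep f \<sigma> vertex_hom p q D \<and> cf p 0 = 0 \<and> pm_eval p v = 0}"
  have frS: "supp p \<subseteq> S \<sigma>" "supp q \<subseteq> S \<sigma>" if "frac_rep f \<sigma> vertex_hom p q D" for f p q D
    using that by (simp_all add: frac_rep_def)
  have idJ: "ideal J (function_ring C)"
  proof (rule ideal_function_ringI[OF function_algebra_C])
    show "J \<subseteq> C" by (auto simp: J_def)
    have "frac_rep (\<lambda>_. 0) \<sigma> vertex_hom 0 1 (U \<sigma>)"
      using frac_const[OF vertex_hom_in_U, of 0] by simp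
    then show "(\<lambda>_. 0) \<in> J"
      using function_algebraD(1)[OF function_algebra_C, of 0] by (fastforce simp: J_def)
    show "(\<lambda>y. f y + h y) \<in> J" if fh: "f \<in> J" "h \<in> J" for f h
    proof -
      obtain p q D p' q' D' where *: "frac_rep f \<sigma> vertex_hom p q D" "cf p 0 = 0" "pm_eval p v = 0"
        "frac_rep h \<sigma> vertex_hom p' q' D'" "cf p' 0 = 0" "pm_eval p' v = 0"
        using fh by (auto simp: J_def)
      note s = frS[OF *(1)] frS[OF *(4)]
      have "cf (p * q' + p' * q) 0 = 0" "pm_eval (p * q' + p' * q) v = 0"
        using * s by (simp_all add: lookup_add cf_mult v_mult)
      then show ?thesis
        using frac_add[OF *(1,4)] fh function_algebraD(2)[OF function_algebra_C, of f h]
        unfolding J_def by blast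
    qed
    show "(\<lambda>y. f y * h y) \<in> J" if fh: "f \<in> C" "h \<in> J" for f h
    proof -
      obtain p' q' D' where *: "frac_rep h \<sigma> vertex_hom p' q' D'" "cf p' 0 = 0" "pm_eval p' v = 0"
        using fh by (auto simp: J_def)
      obtain p q D where f: "frac_rep f \<sigma> vertex_hom p q D"
        using frac_at_fixed_point[OF fh(1)] by blast
      note s = frS[OF *(1)] frS[OF f]
      have "cf (p * p') 0 = 0" "pm_eval (p * p') v = 0"
        using * s by (simp_all add: cf_mult v_mult)
      then show ?thesis
        using frac_mult[OF f *(1)] fh function_algebraD(3)[OF function_algebra_C, of f h]
        unfolding J_def by blast
    qed
  qed
  have frI: "frac_rep f \<sigma> vertex_hom 0 1 (chart_preimage \<Lambda> \<Sigma> \<sigma> W)"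
    if "fan_open \<Lambda> \<Sigma> W" "fixed_point \<in> W" "\<forall>y\<in>W. f y = 0" for f W
    using that sigma vertex_hom_in_preimage[of W]
    by (auto simp: frac_rep_def fan_open_def chart_preimage_def affine_points_0)
  have "I \<subseteq> J"
  proof
    fix f assume "f \<in> I"
    then obtain W where f: "f \<in> C" and W: "fan_open \<Lambda> \<Sigma> W" "fixed_point \<in> W" "\<forall>y\<in>W. f y = 0"
      by (auto simp: I_def)
    show "f \<in> J"
      unfolding J_def using f frI[OF W]
      by (intro CollectI conjI exI[of _ 0] exI[of _ 1] exI[of _ "chart_preimage \<Lambda> \<Sigma> \<sigma> W"]) auto
  qed
  moreover have "G \<subseteq> J"
  proof
    fix f assume f: "f \<in> G"
    have "f fixed_point = 0" using G(1) f by auto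
    then have "cf (P f) 0 = 0"
      using fr[OF f] by (auto simp: frac_rep_def fixed_point_def pm_eval_vertex_hom)
    then show "f \<in> J" using fr[OF f] x(2)[OF f] G(1) f by (auto simp: J_def v_eval)
  qed
  ultimately have sub: "{f \<in> C. f fixed_point = 0} \<subseteq> J" using G(4) idJ by blast
  obtain h where h: "h \<in> H" "x h \<noteq> 0" using x(1) by auto
  have hS: "h \<in> S \<sigma>" and h0: "h \<noteq> 0" using h H(1,4) by auto
  have "character h fixed_point = 0"
    using character_chart[OF vertex_hom_in_U hS] hS h0 by (simp add: fixed_point_def vertex_hom_def)
  then have "character h \<in> J" using sub character_in_C[OF hS] by auto
  then obtain p q D where p: "frac_rep (character h) \<sigma> vertex_hom p q D" "cf p 0 = 0" "pm_eval p v = 0"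
    by (auto simp: J_def)
  note s = frS[OF p(1)]
  let ?h = "Poly_Mapping.single h (1::complex)"
  have sh: "supp ?h \<subseteq> S \<sigma>" using hS by simp
  \<comment> \<open>The fraction \<open>p / q\<close> agrees with the character on an open set,
    where only the zero polynomial vanishes identically; hence \<open>p\<close> is the character
    times \<open>q\<close>.\<close>
  have "p - ?h * q = 0"
  proof (rule pm_eval_eq_0_on_open)
    show "openin (affine_zariski \<Lambda> \<sigma>) D" "vertex_hom \<in> D" using p(1) by (auto simp: frac_rep_def)
    have minus: "p - ?h * q = p + Poly_Mapping.single 0 (-1) * (?h * q)"
      by (simp add: single_uminus)
    have sc: "supp (Poly_Mapping.single 0 (-1::complex)) \<subseteq> S \<sigma>" by simp
    show "supp (p - ?h * q) \<subseteq> S \<sigma>"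
      unfolding minus by (intro supp_S s sh sc)
    fix \<delta> assume \<delta>: "\<delta> \<in> D"
    then have U: "\<delta> \<in> U \<sigma>" by (rule frac_U[OF p(1)])
    have "pm_eval p \<delta> = \<delta> h * pm_eval q \<delta>"
      using p(1) \<delta> character_chart[OF U hS] by (auto simp: frac_rep_def divide_eq_eq)
    then show "pm_eval (p - ?h * q) \<delta> = 0"
      unfolding minus
      by (simp add: pm_eval_mult_affine[OF U sc supp_S(1)[OF sh s(2)]] pm_eval_mult_affine[OF U sh s(2)]
          affine_points_0[OF U])
  qed
  then have "pm_eval (?h * q) v = 0" using p(3) by simp
  \<comment> \<open>The Leibniz rule leaves only this product, as a nonzero character has constant
    coefficient 0. The factor \<open>cf q 0\<close> is the value of the denominator at the fixed
    point, hence nonzero.\<close>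
  then have "x h * cf q 0 = 0" using h h0 sh s by (simp add: v_mult v_def lookup_single)
  moreover have "cf q 0 \<noteq> 0"
    using p(1) s by (auto simp: frac_rep_def pm_eval_vertex_hom)
  ultimately show False using h(2) by simp
qed

end

section \<open>Normal fans of rational polyhedra\<close>

text \<open>The component of \<open>u\<close> orthogonal to \<open>a\<close> is a direction within
  the hyperplane, on which \<open>u\<close> is constant, so this component is zero.\<close>

lemma hyperplane_subset_parallel:
  fixes a u :: "'a::real_inner"
  assumes "a \<noteq> 0" "{x. a \<bullet> x = b} \<subseteq> {x. u \<bullet> x = c}"
  shows "\<exists>k. u = k *\<^sub>R a"
proof -
  define z where "z = (b / (a \<bullet> a)) *\<^sub>R a"
  have z: "a \<bullet> z = b" using assms(1) by (simp add: z_def)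
  define y where "y = u - ((u \<bullet> a) / (a \<bullet> a)) *\<^sub>R a"
  have ay: "a \<bullet> y = 0" using assms(1) by (simp add: y_def inner_diff_right inner_commute)
  then have "a \<bullet> (z + y) = b" using z by (simp add: inner_add_right)
  then have "u \<bullet> (z + y) = c" "u \<bullet> z = c" using assms(2) z by auto
  then have "u \<bullet> y = 0" by (simp add: inner_add_right)
  then have "y \<bullet> y = 0" using ay by (simp add: y_def inner_diff_left inner_commute)
  then have "u = ((u \<bullet> a) / (a \<bullet> a)) *\<^sub>R a" by (simp add: y_def)
  then show ?thesis ..
qed

text \<open>If a sum of elements of the cone lies in the face, so do the summands; hence only
  generators inside the face contribute to its elements.\<close>

lemma face_of_convex_cone_hull:
  assumes "\<tau> face_of (convex_cone hull G)"
  shows "\<tau> \<subseteq> convex_cone hull (G \<inter> \<tau>)"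
proof -
  let ?K = "convex_cone hull G" and ?L = "convex_cone hull (G \<inter> \<tau>)"
  have conic: "conic \<tau>" using face_of_conic[OF conic_convex_cone_hull assms] .
  have sub: "\<tau> \<subseteq> ?K" using assms by (rule face_of_imp_subset)
  \<comment> \<open>The claim as an implication, so that the elements satisfying it form a convex
    cone that contains \<open>G\<close>.\<close>
  define T where "T = {u \<in> ?K. u \<in> \<tau> \<longrightarrow> u \<in> ?L}"
  have "convex_cone T"
    unfolding convex_cone_iff
  proof (intro conjI ballI allI impI)
    show "0 \<in> T" by (simp add: T_def convex_cone_hull_contains_0)
    fix x y assume xy: "x \<in> T" "y \<in> T"
    show "x + y \<in> T"
    proof -
      have K: "x \<in> ?K" "y \<in> ?K" using xy by (auto simp: T_def)
      have "x \<in> \<tau> \<and> y \<in> \<tau>" if s: "x + y \<in> \<tau>"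
      proof (cases "x = y")
        case True
        then have "2 *\<^sub>R x \<in> \<tau>" using s by (simp add: scaleR_2)
        then show ?thesis using conicD[OF conic, of "2 *\<^sub>R x" "1/2"] True by simp
      next
        case False
        \<comment> \<open>Doubling the summands puts their sum strictly inside a segment, where the
          face property applies.\<close>
        have "x + y = midpoint (2 *\<^sub>R x) (2 *\<^sub>R y)"
          by (simp add: midpoint_def scaleR_right_distrib)
        then have "x + y \<in> open_segment (2 *\<^sub>R x) (2 *\<^sub>R y)"
          using False by simp
        then have "2 *\<^sub>R x \<in> \<tau> \<and> 2 *\<^sub>R y \<in> \<tau>"
          using K s by (intro face_ofD[OF assms]) (auto intro: convex_cone_hull_mul)
        then show ?thesis
          using conicD[OF conic, of "2 *\<^sub>R x" "1/2"] conicD[OF conic, of "2 *\<^sub>R y" "1/2"] by simp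
      qed
      then show ?thesis using xy K by (auto simp: T_def convex_cone_hull_add)
    qed
  next
    fix x and c :: real assume x: "x \<in> T" and c: "0 \<le> c"
    show "c *\<^sub>R x \<in> T"
    proof (cases "c = 0")
      case True
      then show ?thesis by (simp add: T_def convex_cone_hull_contains_0)
    next
      case False
      have "x \<in> \<tau>" if "c *\<^sub>R x \<in> \<tau>"
        using conicD[OF conic that, of "1 / c"] c False by simp
      then show ?thesis using x c by (auto simp: T_def convex_cone_hull_mul)
    qed
  qed
  moreover have "G \<subseteq> T" by (auto simp: T_def hull_inc)
  ultimately have "?K \<subseteq> T" by (intro hull_minimal)
  then show ?thesis using sub by (auto simp: T_def)
qed

lemma Ints_inner:
  fixes x y :: "'a::euclidean_space"
  assumes "\<And>b. b \<in> Basis \<Longrightarrow> x \<bullet> b \<in> \<int>" "\<And>b. b \<in> Basis \<Longrightarrow> y \<bullet> b \<in> \<int>"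
  shows "x \<bullet> y \<in> \<int>"
  unfolding euclidean_inner[of x y] using assms by (intro Ints_sum Ints_mult) auto

text \<open>Dirichlet's theorem in all coordinates at once. It provides an integral vector near a
  multiple of a vertex, in place of a proof that the vertex is rational.\<close>

lemma simultaneous_approximation:
  fixes v :: "'a::euclidean_space"
  assumes "\<epsilon> > 0"
  obtains q :: int and w :: 'a where "q > 0" "\<forall>e\<in>Basis. w \<bullet> e \<in> \<int>"
    "\<forall>e\<in>Basis. \<bar>(w - of_int q *\<^sub>R v) \<bullet> e\<bar> < \<epsilon>"
proof -
  obtain N :: nat where N: "N > 0" "1 / real N < \<epsilon>"
    using assms nat_approx_posE by (metis of_nat_0_less_iff zero_less_Suc)
  obtain f where f: "bij_betw f {0..<DIM('a)} (Basis :: 'a set)"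
    using ex_bij_betw_nat_finite[OF finite_Basis] by auto
  obtain q p where qp: "0 < q" "\<And>i. i < DIM('a) \<Longrightarrow> \<bar>of_int q * (v \<bullet> f i) - of_int (p i)\<bar> < 1 / real N"
    using Dirichlet_approx_simult[OF N(1), where n = "DIM('a)" and \<theta> = "\<lambda>i. v \<bullet> f i"] by metis
  define g where "g = inv_into {0..<DIM('a)} f"
  define w where "w = (\<Sum>e\<in>Basis. real_of_int (p (g e)) *\<^sub>R e)"
  have g: "g e < DIM('a)" "f (g e) = e" if "e \<in> Basis" for e
    using that f bij_betw_inv_into_right[OF f that] inv_into_into[of e f "{0..<DIM('a)}"]
    by (auto simp: g_def bij_betw_def)
  have w: "w \<bullet> e = of_int (p (g e))" if "e \<in> Basis" for e
    using that by (simp add: w_def)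
  show ?thesis
  proof (rule that[OF qp(1)])
    show "\<forall>e\<in>Basis. w \<bullet> e \<in> \<int>" using w by simp
    show "\<forall>e\<in>Basis. \<bar>(w - of_int q *\<^sub>R v) \<bullet> e\<bar> < \<epsilon>"
    proof
      fix e :: 'a assume e: "e \<in> Basis"
      show "\<bar>(w - of_int q *\<^sub>R v) \<bullet> e\<bar> < \<epsilon>"
        using qp(2)[OF g(1)[OF e]] w[OF e] g(2)[OF e] N(2)
        by (simp add: inner_diff_left abs_minus_commute)
    qed
  qed
qed

text \<open>Integrality makes a positive bound at least 1 and turns approximations with error below
  1 into exact statements. Nonnegative bounds put the origin into \<open>P\<close>; the strict
  interior point makes \<open>P\<close> full-dimensional, so that facets span hyperplanes.\<close>

locale integral_polyhedron =
  fixes H :: "('a::euclidean_space \<times> real) set" and P :: "'a set"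
  assumes finite_H: "finite H"
    and normal_nonzero: "\<And>a b. (a, b) \<in> H \<Longrightarrow> a \<noteq> 0"
    and normal_integral: "\<And>a b e. (a, b) \<in> H \<Longrightarrow> e \<in> Basis \<Longrightarrow> a \<bullet> e \<in> \<int>"
    and bound_integral: "\<And>a b. (a, b) \<in> H \<Longrightarrow> b \<in> \<int>"
    and bound_nonneg: "\<And>a b. (a, b) \<in> H \<Longrightarrow> 0 \<le> b"
    and P_eq: "P = {x. \<forall>(a, b)\<in>H. a \<bullet> x \<le> b}"
    and interior_point: "\<exists>p. \<forall>(a, b)\<in>H. a \<bullet> p < b"
begin

lemma zero_in_P: "0 \<in> P"
  using bound_nonneg by (auto simp: P_eq)

lemma ball_in_P:
  obtains p r where "r > 0" "ball p r \<subseteq> P" "\<forall>(a, b)\<in>H. a \<bullet> p < b"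
proof -
  obtain p where p: "\<forall>(a, b)\<in>H. a \<bullet> p < b" using interior_point by auto
  have "open (\<Inter>h\<in>H. {x. fst h \<bullet> x < snd h})"
    using finite_H by (intro open_INT) (auto intro: open_halfspace_lt)
  moreover have "p \<in> (\<Inter>h\<in>H. {x. fst h \<bullet> x < snd h})" using p by auto
  ultimately obtain r where r: "r > 0" "ball p r \<subseteq> (\<Inter>h\<in>H. {x. fst h \<bullet> x < snd h})"
    by (rule openE)
  moreover have "(\<Inter>h\<in>H. {x. fst h \<bullet> x < snd h}) \<subseteq> P"
    unfolding P_eq by (fastforce intro: less_imp_le)
  ultimately have "ball p r \<subseteq> P" by simp
  then show ?thesis using p by (rule that[OF r(1)])
qed

lemma affine_hull_P: "affine hull P = UNIV"
proof -
  obtain p r where "r > 0" "ball p r \<subseteq> P" by (rule ball_in_P)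
  then have "p \<in> interior P" by (meson interior_maximal centre_in_ball open_ball subsetD)
  then show ?thesis by (intro affine_hull_nonempty_interior) auto
qed

text \<open>In an inclusion-minimal family of half-spaces with intersection \<open>P\<close>, the
  boundary hyperplanes cut out precisely the facets. Minimality is taken over half-spaces as sets,
  and one pair of \<open>H\<close> is then chosen for each, so that pairs describing the same
  half-space cause no duplicates.\<close>

lemma irredundant_subfamily:
  "\<exists>K\<subseteq>H. (\<forall>x. x \<in> P \<longleftrightarrow> (\<forall>(a, b)\<in>K. a \<bullet> x \<le> b)) \<and>
     (\<forall>F. F facet_of P \<longleftrightarrow> (\<exists>(a, b)\<in>K. F = P \<inter> {x. a \<bullet> x = b}))"
proof -
  define hs where "hs = (\<lambda>(a :: 'a, b). {x. a \<bullet> x \<le> b})"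
  have "{\<F>. \<F> \<subseteq> hs ` H \<and> \<Inter>\<F> = P} \<noteq> {}"
    by (auto simp: P_eq hs_def intro!: exI[of _ "hs ` H"])
  moreover have "finite {\<F>. \<F> \<subseteq> hs ` H \<and> \<Inter>\<F> = P}"
  proof (rule finite_subset)
    show "{\<F>. \<F> \<subseteq> hs ` H \<and> \<Inter>\<F> = P} \<subseteq> Pow (hs ` H)" by blast
    show "finite (Pow (hs ` H))" using finite_H by simp
  qed
  ultimately have "\<exists>\<F>\<in>{\<F>. \<F> \<subseteq> hs ` H \<and> \<Inter>\<F> = P}.
      \<forall>\<F>'\<in>{\<F>. \<F> \<subseteq> hs ` H \<and> \<Inter>\<F> = P}. \<F>' \<subseteq> \<F> \<longrightarrow> \<F> = \<F>'"
    by (rule finite_has_minimal[rotated])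
  then obtain \<F> where F0: "\<F> \<in> {\<F>. \<F> \<subseteq> hs ` H \<and> \<Inter>\<F> = P}"
    and F1: "\<forall>\<F>'\<in>{\<F>. \<F> \<subseteq> hs ` H \<and> \<Inter>\<F> = P}. \<F>' \<subseteq> \<F> \<longrightarrow> \<F> = \<F>'"
    by (rule bexE)
  have F: "\<F> \<subseteq> hs ` H" "\<Inter>\<F> = P" using F0 by simp_all
  have min: "\<F> = \<F>'" if "\<F>' \<subseteq> hs ` H" "\<Inter>\<F>' = P" "\<F>' \<subseteq> \<F>" for \<F>'
    using F1 that by simp
  have finF: "finite \<F>" using F(1) finite_H by (rule finite_subset[OF _ finite_imageI])
  have "\<forall>h\<in>\<F>. \<exists>n. n \<in> H \<and> h = hs n" using F(1) by blast
  then obtain n where n: "\<And>h. h \<in> \<F> \<Longrightarrow> n h \<in> H \<and> h = hs (n h)" by metis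
  have facet: "F facet_of P \<longleftrightarrow> (\<exists>h. h \<in> \<F> \<and> F = P \<inter> {x. fst (n h) \<bullet> x = snd (n h)})" for F
  proof (rule facet_of_polyhedron_explicit[OF finF])
    show "P = affine hull P \<inter> \<Inter>\<F>" using F(2) affine_hull_P by simp
    show "fst (n h) \<noteq> 0 \<and> h = {x. fst (n h) \<bullet> x \<le> snd (n h)}" if "h \<in> \<F>" for h
      using n[OF that] normal_nonzero[of "fst (n h)" "snd (n h)"] by (auto simp: hs_def split_beta)
    show "P \<subset> affine hull P \<inter> \<Inter>\<F>'" if "\<F>' \<subset> \<F>" for \<F>'
    proof -
      have "\<Inter>\<F>' \<noteq> P" using min[of \<F>'] that F(1) by blast
      moreover have "P \<subseteq> \<Inter>\<F>'" using that F(2) by auto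
      ultimately show ?thesis using affine_hull_P by auto
    qed
  qed
  have "x \<in> P \<longleftrightarrow> (\<forall>(a, b)\<in>n ` \<F>. a \<bullet> x \<le> b)" for x
  proof -
    have "x \<in> P \<longleftrightarrow> (\<forall>h\<in>\<F>. x \<in> h)" unfolding F(2)[symmetric] by simp
    also have "\<dots> \<longleftrightarrow> (\<forall>h\<in>\<F>. x \<in> hs (n h))" using n by (intro ball_cong refl) auto
    finally show ?thesis by (simp add: hs_def split_beta)
  qed
  moreover have "n ` \<F> \<subseteq> H" using n by auto
  moreover have "F facet_of P \<longleftrightarrow> (\<exists>(a, b)\<in>n ` \<F>. F = P \<inter> {x. a \<bullet> x = b})" for F
    unfolding facet by (auto simp: split_beta)
  ultimately show ?thesis by (intro exI[of _ "n ` \<F>"]) simp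
qed

definition K where
  "K = (SOME K. K \<subseteq> H \<and> (\<forall>x. x \<in> P \<longleftrightarrow> (\<forall>(a, b)\<in>K. a \<bullet> x \<le> b)) \<and>
     (\<forall>F. F facet_of P \<longleftrightarrow> (\<exists>(a, b)\<in>K. F = P \<inter> {x. a \<bullet> x = b})))"

lemma K: "K \<subseteq> H" "x \<in> P \<longleftrightarrow> (\<forall>(a, b)\<in>K. a \<bullet> x \<le> b)"
    "F facet_of P \<longleftrightarrow> (\<exists>(a, b)\<in>K. F = P \<inter> {x. a \<bullet> x = b})"
proof -
  have *: "K \<subseteq> H \<and> (\<forall>x. x \<in> P \<longleftrightarrow> (\<forall>(a, b)\<in>K. a \<bullet> x \<le> b)) \<and>
     (\<forall>F. F facet_of P \<longleftrightarrow> (\<exists>(a, b)\<in>K. F = P \<inter> {x. a \<bullet> x = b}))"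
    unfolding K_def by (rule someI_ex[OF irredundant_subfamily])
  show "K \<subseteq> H" by (rule *[THEN conjunct1])
  show "x \<in> P \<longleftrightarrow> (\<forall>(a, b)\<in>K. a \<bullet> x \<le> b)"
    by (rule *[THEN conjunct2, THEN conjunct1, THEN spec])
  show "F facet_of P \<longleftrightarrow> (\<exists>(a, b)\<in>K. F = P \<inter> {x. a \<bullet> x = b})"
    by (rule *[THEN conjunct2, THEN conjunct2, THEN spec])
qed

lemma finite_K: "finite K"
  using K(1) finite_H by (rule finite_subset)

abbreviation normals where
  "normals v \<equiv> {u. \<exists>F. F facet_of P \<and> v \<in> F \<and> inward_normal P F u}"

text \<open>Both \<open>u\<close> and \<open>a\<close> are orthogonal to the hyperplane spanned by
  the facet, hence proportional; the interior point fixes the sign. The last clause, that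
  \<open>u\<close> is a normal at every other point of the facet, will be applied to the
  origin.\<close>

lemma normals_K:
  assumes "u \<in> normals v"
  obtains a b k where "(a, b) \<in> K" "k > 0" "u = - k *\<^sub>R a" "a \<bullet> v = b"
    "\<forall>y\<in>P. a \<bullet> y = b \<longrightarrow> u \<in> normals y"
proof -
  obtain F where F: "F facet_of P" "v \<in> F" "inward_normal P F u" using assms by auto
  obtain c where u: "u \<noteq> 0" and c: "\<And>x. x \<in> P \<Longrightarrow> c \<le> u \<bullet> x" "F = {x \<in> P. u \<bullet> x = c}"
    using F(3) by (auto simp: inward_normal_def)
  obtain a b where ab: "(a, b) \<in> K" "F = P \<inter> {x. a \<bullet> x = b}" using F(1) K(3)[of F] by auto
  have a0: "a \<noteq> 0" and abH: "(a, b) \<in> H" using ab(1) K(1) normal_nonzero by auto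
  have "aff_dim P = DIM('a)"
    using aff_dim_affine_hull[of P] affine_hull_P by simp
  then have "aff_dim F = DIM('a) - 1" using F(1) by (simp add: facet_of_def)
  then obtain a' b' where a': "a' \<noteq> 0" "affine hull F = {x. a' \<bullet> x = b'}"
    using aff_dim_eq_hyperplane[of F] by auto
  have hull: "affine hull F \<subseteq> {x. w \<bullet> x = e}" if "F \<subseteq> {x. w \<bullet> x = e}" for w e
    using that by (intro hull_minimal affine_hyperplane)
  obtain k1 where k1: "u = k1 *\<^sub>R a'"
    using hyperplane_subset_parallel[OF a'(1), of b' u c] hull[of u c] a'(2) c(2) by auto
  obtain k2 where k2: "a = k2 *\<^sub>R a'"
    using hyperplane_subset_parallel[OF a'(1), of b' a b] hull[of a b] a'(2) ab(2) by auto
  have "k2 \<noteq> 0" using k2 a0 by auto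
  then have ua: "u = (k1 / k2) *\<^sub>R a" using k1 k2 by simp
  have v: "u \<bullet> v = c" "a \<bullet> v = b" using F(2) c(2) ab(2) by auto
  obtain p r where p: "r > 0" "ball p r \<subseteq> P" "\<forall>(a, b)\<in>H. a \<bullet> p < b" by (rule ball_in_P)
  then have "p \<in> P" by auto
  then have "c \<le> u \<bullet> p" by (rule c(1))
  then have "(k1 / k2) * (a \<bullet> v) \<le> (k1 / k2) * (a \<bullet> p)" using v(1) unfolding ua by simp
  moreover have "(k1 / k2) * (a \<bullet> p) < (k1 / k2) * (a \<bullet> v)" if "k1 / k2 > 0"
    using p(3) abH v(2) that by (intro mult_strict_left_mono) auto
  ultimately have "\<not> k1 / k2 > 0" by linarith
  moreover have "k1 / k2 \<noteq> 0" using u ua by auto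
  ultimately have "k1 / k2 < 0" by linarith
  then show ?thesis
    using F(1,3) ab v(2) ua by (intro that[of a b "- (k1 / k2)"]) auto
qed

lemma K_normals:
  assumes "(a, b) \<in> K" "v \<in> P" "a \<bullet> v = b"
  shows "- a \<in> normals v"
proof -
  have "P \<inter> {x. a \<bullet> x = b} facet_of P" using assms(1) K(3) by auto
  moreover have "inward_normal P (P \<inter> {x. a \<bullet> x = b}) (- a)"
  proof -
    have "a \<noteq> 0" using assms(1) K(1) normal_nonzero by blast
    moreover have "a \<bullet> x \<le> b" if "x \<in> P" for x
      using that assms(1) K(2) by auto
    ultimately show ?thesis by (auto simp: inward_normal_def intro!: exI[of _ "- b"])
  qed
  ultimately show ?thesis using assms(2,3) by blast
qed

text \<open>Each generating normal attains its minimum over \<open>P\<close> at \<open>v\<close>,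
  and this passes to conic combinations.\<close>

lemma vertex_cone_minimizes:
  assumes "u \<in> vertex_cone P v" "x \<in> P"
  shows "0 \<le> (x - v) \<bullet> u"
proof -
  have "normals v \<subseteq> {u. (x - v) \<bullet> u \<ge> 0}"
    using assms(2) by (auto simp: inward_normal_def inner_diff_right inner_commute[of _ "x - v"] inner_commute)
  then have "convex_cone hull (normals v) \<subseteq> {u. (x - v) \<bullet> u \<ge> 0}"
    by (intro hull_minimal convex_cone_halfspace_ge)
  then show ?thesis using assms(1) by (auto simp: vertex_cone_def)
qed

text \<open>The dual of the cone at the origin consists of the directions leading from the origin
  into \<open>P\<close>: inequalities that are not tight there have bound at least 1 and do not
  hinder a short step.\<close>

lemma vertex_cone_0_dual_iff:
  "(\<forall>u \<in> vertex_cone P 0. 0 \<le> m \<bullet> u) \<longleftrightarrow> (\<exists>\<epsilon>>0. \<epsilon> *\<^sub>R m \<in> P)"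
proof
  assume m: "\<forall>u \<in> vertex_cone P 0. 0 \<le> m \<bullet> u"
  \<comment> \<open>Exceeds every \<open>a \<bullet> m\<close>, so \<open>m / s\<close> satisfies
    the inequalities with bound at least 1.\<close>
  define s where "s = 1 + (\<Sum>(a, b)\<in>K. \<bar>a \<bullet> m\<bar>)"
  have s: "s > 0" unfolding s_def by (intro add_pos_nonneg sum_nonneg) auto
  have "a \<bullet> ((1 / s) *\<^sub>R m) \<le> b" if ab: "(a, b) \<in> K" for a b
  proof (cases "b = 0")
    case True
    then have "- a \<in> normals 0" using K_normals[OF ab zero_in_P] by simp
    then have "- a \<in> vertex_cone P 0" by (simp add: vertex_cone_def hull_inc)
    then have "0 \<le> m \<bullet> - a" using m by blast
    then show ?thesis using True s by (simp add: inner_commute divide_le_0_iff)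
  next
    case False
    have "b \<in> \<int>" "0 \<le> b" using ab K(1) bound_integral bound_nonneg by blast+
    then have b: "1 \<le> b" using False by (auto elim!: Ints_cases)
    have "\<bar>a \<bullet> m\<bar> \<le> (\<Sum>(a, b)\<in>K. \<bar>a \<bullet> m\<bar>)"
      using member_le_sum[OF ab, of "\<lambda>(a, b). \<bar>a \<bullet> m\<bar>"] finite_K by auto
    then have "a \<bullet> m \<le> s" unfolding s_def by linarith
    then have "a \<bullet> ((1 / s) *\<^sub>R m) \<le> 1" using s by simp
    then show ?thesis using b by linarith
  qed
  then have "(1 / s) *\<^sub>R m \<in> P" using K(2) by auto
  then show "\<exists>\<epsilon>>0. \<epsilon> *\<^sub>R m \<in> P" using s by (intro exI[of _ "1 / s"]) auto
next
  assume "\<exists>\<epsilon>>0. \<epsilon> *\<^sub>R m \<in> P"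
  then obtain \<epsilon> where \<epsilon>: "\<epsilon> > 0" "\<epsilon> *\<^sub>R m \<in> P" by auto
  then show "\<forall>u \<in> vertex_cone P 0. 0 \<le> m \<bullet> u"
    using vertex_cone_minimizes[OF _ \<epsilon>(2), of _ 0] by (auto simp: zero_le_mult_iff)
qed

text \<open>Rounding a large multiple of the direction from \<open>v\<close> to an interior point
  yields an integral vector deep inside the dual cone, where adding \<open>m\<close> does no harm.
  The factor 2 will make it a character.\<close>

lemma vertex_cone_dual_generates:
  fixes m :: 'a
  assumes "v \<in> P"
  obtains w where "\<forall>e\<in>Basis. w \<bullet> e \<in> \<int>"
    "\<forall>u \<in> vertex_cone P v. 0 \<le> (2 *\<^sub>R w) \<bullet> u \<and> 0 \<le> (m + 2 *\<^sub>R w) \<bullet> u"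
proof -
  obtain p r where p: "r > 0" "ball p r \<subseteq> P" by (rule ball_in_P)
  \<comment> \<open>\<open>n\<close> is so large that the rounding error, of norm at most the
    dimension, and \<open>m\<close>, divided by \<open>n\<close>, stay together within the ball
    around \<open>p\<close>.\<close>
  obtain n :: nat where n: "(real DIM('a) + norm m) / r < real n" using reals_Archimedean2 by blast
  have n0: "real n > 0" using n p(1) by (smt (verit) divide_nonneg_pos norm_ge_zero of_nat_0_le_iff)
  have nr: "real DIM('a) + norm m < real n * r" using n p(1) by (simp add: field_simps)
  define w where "w = (\<Sum>e\<in>Basis. real_of_int \<lfloor>real n * ((p - v) \<bullet> e)\<rfloor> *\<^sub>R e)"
  have we: "w \<bullet> e = real_of_int \<lfloor>real n * ((p - v) \<bullet> e)\<rfloor>" if "e \<in> Basis" for e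
    using that by (simp add: w_def)
  define z where "z = w - real n *\<^sub>R (p - v)"
  have "norm z \<le> (\<Sum>e\<in>Basis. \<bar>z \<bullet> e\<bar>)" by (rule norm_le_l1)
  also have "\<dots> \<le> (\<Sum>e\<in>(Basis :: 'a set). 1)"
  proof (rule sum_mono)
    fix e :: 'a assume "e \<in> Basis"
    then show "\<bar>z \<bullet> e\<bar> \<le> 1" unfolding z_def inner_diff_left we[OF \<open>e \<in> Basis\<close>]
      by (simp add: inner_diff_left) linarith
  qed
  finally have z: "norm z \<le> real DIM('a)" by simp
  have pos: "0 \<le> (2 *\<^sub>R w + y) \<bullet> u" if u: "u \<in> vertex_cone P v" and y: "norm y \<le> norm m" for u y
  proof -
    \<comment> \<open>\<open>t\<close> is chosen so that \<open>2 n\<close> times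
      \<open>p + t - v\<close> equals \<open>2 w + y\<close>.\<close>
    define t where "t = (1 / real n) *\<^sub>R (z + (1/2) *\<^sub>R y)"
    have "norm (z + (1/2) *\<^sub>R y) \<le> norm z + norm ((1/2) *\<^sub>R y)" by (rule norm_triangle_ineq)
    also have "norm z + norm ((1/2) *\<^sub>R y) \<le> real DIM('a) + norm m"
    proof -
      have "norm ((1/2) *\<^sub>R y) \<le> norm y" by simp
      then show ?thesis using z y by linarith
    qed
    also have "\<dots> < real n * r" by (rule nr)
    finally have "norm (z + (1/2) *\<^sub>R y) / real n < r"
      using n0 by (simp add: pos_divide_less_eq mult.commute)
    then have "norm t < r" using n0 by (simp only: t_def norm_scaleR) simp
    then have "p + t \<in> P" using p(2) by (auto simp: dist_norm)
    then have "0 \<le> (p + t - v) \<bullet> u" by (rule vertex_cone_minimizes[OF u])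
    then have "0 \<le> (2 * real n) * ((p + t - v) \<bullet> u)" using n0 by simp
    also have "\<dots> = ((2 * real n) *\<^sub>R (p + t - v)) \<bullet> u" by simp
    also have "(2 * real n) *\<^sub>R (p + t - v) = 2 *\<^sub>R w + y"
      using n0 by (simp add: t_def z_def algebra_simps)
    finally show ?thesis .
  qed
  show ?thesis
  proof (rule that[of w])
    show "\<forall>e\<in>Basis. w \<bullet> e \<in> \<int>" using we by simp
    show "\<forall>u \<in> vertex_cone P v. 0 \<le> (2 *\<^sub>R w) \<bullet> u \<and> 0 \<le> (m + 2 *\<^sub>R w) \<bullet> u"
      using pos[of _ 0] pos[of _ m] by (simp add: add.commute)
  qed
qed

text \<open>A lattice vector approximating a large multiple of \<open>v\<close> well enough lies on the same
  facet hyperplanes, hence separates the cone of \<open>v\<close> from that of \<open>0\<close>.\<close>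

lemma vertex_cone_separation:
  assumes v: "v \<in> P" and \<tau>: "\<tau> face_of vertex_cone P v"
  obtains w where "\<forall>e\<in>Basis. w \<bullet> e \<in> \<int>"
    "\<forall>u \<in> \<tau>. 0 \<le> (2 *\<^sub>R w) \<bullet> u" "\<forall>u \<in> \<tau> \<inter> vertex_cone P 0. 0 \<le> (- (2 *\<^sub>R w)) \<bullet> u"
    "\<forall>h. (\<forall>u \<in> \<tau> \<inter> vertex_cone P 0. 0 \<le> h \<bullet> u) \<longrightarrow> (\<exists>k::nat. \<forall>u\<in>\<tau>. 0 \<le> (h + of_nat k *\<^sub>R 2 *\<^sub>R w) \<bullet> u)"
proof -
  \<comment> \<open>Exceeds the sum of the absolute coordinates of every normal, so that errors
    below \<open>1 / s\<close> in the coordinates change each \<open>a \<bullet> w\<close> by less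
    than 1.\<close>
  define s where "s = 1 + (\<Sum>(a, b)\<in>K. \<Sum>e\<in>Basis. \<bar>a \<bullet> e\<bar>)"
  have s: "s > 0" unfolding s_def by (intro add_pos_nonneg sum_nonneg) (auto intro!: sum_nonneg)
  then have "1 / s > 0" by simp
  then obtain q w where q: "q > 0" "\<forall>e\<in>Basis. w \<bullet> e \<in> \<int>"
    "\<forall>e\<in>Basis. \<bar>(w - of_int q *\<^sub>R v) \<bullet> e\<bar> < 1 / s"
    by (rule simultaneous_approximation)
  have aint: "a \<bullet> w \<in> \<int>" "b \<in> \<int>" if ab: "(a, b) \<in> K" for a b
  proof -
    have abH: "(a, b) \<in> H" using ab K(1) by blast
    show "a \<bullet> w \<in> \<int>"
      by (rule Ints_inner) (use normal_integral[OF abH] q(2) in simp_all)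
    show "b \<in> \<int>" by (rule bound_integral[OF abH])
  qed
  have approx: "\<bar>a \<bullet> w - of_int q * (a \<bullet> v)\<bar> < 1" if ab: "(a, b) \<in> K" for a b
  proof -
    have "\<bar>a \<bullet> (w - of_int q *\<^sub>R v)\<bar> \<le> (\<Sum>e\<in>Basis. \<bar>(a \<bullet> e) * ((w - of_int q *\<^sub>R v) \<bullet> e)\<bar>)"
      by (subst euclidean_inner) (rule sum_abs)
    also have "\<dots> \<le> (\<Sum>e\<in>Basis. \<bar>a \<bullet> e\<bar> * (1 / s))"
    proof (rule sum_mono)
      fix e :: 'a assume "e \<in> Basis"
      then have "\<bar>(w - of_int q *\<^sub>R v) \<bullet> e\<bar> \<le> 1 / s" using q(3) by (simp add: less_imp_le)
      then show "\<bar>(a \<bullet> e) * ((w - of_int q *\<^sub>R v) \<bullet> e)\<bar> \<le> \<bar>a \<bullet> e\<bar> * (1 / s)"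
        unfolding abs_mult by (rule mult_left_mono) simp
    qed
    also have "\<dots> = (\<Sum>e\<in>Basis. \<bar>a \<bullet> e\<bar>) / s" by (simp add: sum_divide_distrib)
    also have "\<dots> < 1"
    proof -
      have "(\<Sum>e\<in>Basis. \<bar>a \<bullet> e\<bar>) \<le> (\<Sum>(a, b)\<in>K. \<Sum>e\<in>Basis. \<bar>a \<bullet> e\<bar>)"
        using member_le_sum[OF ab, of "\<lambda>(a, b). \<Sum>e\<in>Basis. \<bar>a \<bullet> e\<bar>"] finite_K
        by (auto simp: sum_nonneg)
      then show ?thesis using s by (simp add: s_def)
    qed
    finally show ?thesis by (simp add: inner_diff_right)
  qed
  \<comment> \<open>For an inequality that is tight at \<open>v\<close>, the difference is an
    integer of absolute value below 1, hence 0.\<close>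
  have eq: "a \<bullet> w = of_int q * b" if ab: "(a, b) \<in> K" "a \<bullet> v = b" for a b
  proof -
    have "a \<bullet> w - of_int q * b \<in> \<int>" using aint[OF ab(1)] by auto
    then show ?thesis using Ints_nonzero_abs_less1 approx[OF ab(1)] ab(2) by fastforce
  qed
  \<comment> \<open>For every inequality the difference is an integer less than 1, hence at most
    0.\<close>
  have le: "a \<bullet> w \<le> of_int q * b" if ab: "(a, b) \<in> K" for a b
  proof -
    have "a \<bullet> v \<le> b" using v ab K(2) by auto
    then have "of_int q * (a \<bullet> v) \<le> of_int q * b" using q(1) by (intro mult_left_mono) auto
    then have "a \<bullet> w - of_int q * b < 1" using approx[OF ab] by linarith
    moreover have "a \<bullet> w - of_int q * b \<in> \<int>" using aint[OF ab] by auto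
    ultimately obtain z where z: "a \<bullet> w - of_int q * b = of_int z" "of_int z < (1 :: real)"
      by (auto elim: Ints_cases)
    then have "of_int z \<le> (0 :: real)" by simp
    then show ?thesis using z(1) by linarith
  qed
  have b_nonneg: "0 \<le> b" "b = 0 \<or> 1 \<le> b" if ab: "(a, b) \<in> K" for a b
  proof -
    have abH: "(a, b) \<in> H" using ab K(1) by blast
    show "0 \<le> b" by (rule bound_nonneg[OF abH])
    show "b = 0 \<or> 1 \<le> b"
      using bound_integral[OF abH] bound_nonneg[OF abH] by (auto elim!: Ints_cases)
  qed
  have \<tau>sub: "\<tau> \<subseteq> vertex_cone P v" by (rule face_of_imp_subset[OF \<tau>])
  have "normals v \<subseteq> {u. (- w) \<bullet> u \<ge> 0}"
  proof
    fix u assume "u \<in> normals v"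
    then obtain a b k where ab: "(a, b) \<in> K" "k > 0" "u = - k *\<^sub>R a" "a \<bullet> v = b"
      by (rule normals_K)
    have "0 \<le> k * (of_int q * b)" using ab(2) q(1) b_nonneg[OF ab(1)] by simp
    then show "u \<in> {u. (- w) \<bullet> u \<ge> 0}" using eq[OF ab(1,4)] by (simp add: ab(3) inner_commute)
  qed
  then have "convex_cone hull (normals v) \<subseteq> {u. (- w) \<bullet> u \<ge> 0}"
    by (intro hull_minimal convex_cone_halfspace_ge)
  then have 1: "\<forall>u \<in> vertex_cone P v. 0 \<le> (- w) \<bullet> u" by (auto simp: vertex_cone_def)
  have "normals 0 \<subseteq> {u. w \<bullet> u \<ge> 0}"
  proof
    fix u assume "u \<in> normals 0"
    then obtain a b k where ab: "(a, b) \<in> K" "k > 0" "u = - k *\<^sub>R a" "a \<bullet> 0 = b"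
      by (rule normals_K)
    have "a \<bullet> w \<le> 0" using le[OF ab(1)] ab(4) by simp
    then have "k * (a \<bullet> w) \<le> 0" using ab(2) by (simp add: mult_le_0_iff)
    then show "u \<in> {u. w \<bullet> u \<ge> 0}" by (simp add: ab(3) inner_commute)
  qed
  then have "convex_cone hull (normals 0) \<subseteq> {u. w \<bullet> u \<ge> 0}"
    by (intro hull_minimal convex_cone_halfspace_ge)
  then have 2: "\<forall>u \<in> vertex_cone P 0. 0 \<le> w \<bullet> u" by (auto simp: vertex_cone_def)
  have 3: "\<exists>k::nat. \<forall>u\<in>\<tau>. 0 \<le> (h + of_nat k *\<^sub>R 2 *\<^sub>R (- w)) \<bullet> u"
    if h: "\<forall>u \<in> \<tau> \<inter> vertex_cone P 0. 0 \<le> h \<bullet> u" for h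
  proof -
    \<comment> \<open>Enough multiples to outweigh \<open>h\<close> on generators with bound at
      least 1. A generator with bound 0 is a normal at the origin too, where \<open>h\<close> is
      nonnegative by assumption.\<close>
    define k where "k = nat \<lceil>\<Sum>(a, b)\<in>K. \<bar>a \<bullet> h\<bar>\<rceil>"
    have "normals v \<inter> \<tau> \<subseteq> {u. (h + of_nat k *\<^sub>R 2 *\<^sub>R (- w)) \<bullet> u \<ge> 0}"
    proof
      fix u assume u: "u \<in> normals v \<inter> \<tau>"
      obtain a b c where ab: "(a, b) \<in> K" "c > 0" "u = - c *\<^sub>R a" "a \<bullet> v = b"
        "\<forall>y\<in>P. a \<bullet> y = b \<longrightarrow> u \<in> normals y"
        using normals_K[OF IntD1[OF u]] .
      have wu: "0 \<le> (- w) \<bullet> u" using 1 u \<tau>sub by blast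
      have "0 \<le> (h + of_nat k *\<^sub>R 2 *\<^sub>R (- w)) \<bullet> u"
      proof (cases "b = 0")
        case True
        then have "u \<in> normals 0" using ab(5) zero_in_P by simp
        then have "u \<in> vertex_cone P 0" unfolding vertex_cone_def by (rule hull_inc)
        then have "0 \<le> h \<bullet> u" using h u by blast
        moreover have "0 \<le> real k * (2 * ((- w) \<bullet> u))"
          using wu by (intro mult_nonneg_nonneg) auto
        ultimately show ?thesis by (simp only: inner_add_left inner_scaleR_left)
      next
        case False
        then have b: "1 \<le> b" using b_nonneg[OF ab(1)] by auto
        have "\<bar>a \<bullet> h\<bar> \<le> (\<Sum>(a, b)\<in>K. \<bar>a \<bullet> h\<bar>)"
          using member_le_sum[OF ab(1), of "\<lambda>(a, b). \<bar>a \<bullet> h\<bar>"] finite_K by auto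
        then have ah: "a \<bullet> h \<le> real k" unfolding k_def by linarith
        have "1 * 1 \<le> of_int q * b" using b q(1) by (intro mult_mono) auto
        then have "real k * 1 \<le> real k * (2 * (of_int q * b))" by (intro mult_left_mono) auto
        then have "0 \<le> c * (real k * (2 * (of_int q * b)) - a \<bullet> h)" using ah ab(2) by simp
        also have "\<dots> = (h + of_nat k *\<^sub>R 2 *\<^sub>R (- w)) \<bullet> u"
          using eq[OF ab(1,4)] by (simp add: ab(3) inner_add_left inner_commute algebra_simps)
        finally show ?thesis .
      qed
      then show "u \<in> {u. (h + of_nat k *\<^sub>R 2 *\<^sub>R (- w)) \<bullet> u \<ge> 0}" by simp
    qed
    then have "convex_cone hull (normals v \<inter> \<tau>) \<subseteq> {u. (h + of_nat k *\<^sub>R 2 *\<^sub>R (- w)) \<bullet> u \<ge> 0}"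
      by (intro hull_minimal convex_cone_halfspace_ge)
    then show ?thesis
      using face_of_convex_cone_hull[OF \<tau>[unfolded vertex_cone_def]] by blast
  qed
  \<comment> \<open>\<open>w\<close> is nonpositive on the cone of \<open>v\<close> and nonnegative
    on that of the origin, so its negative is the required vector.\<close>
  show ?thesis
  proof (rule that[of "- w"])
    show "\<forall>e\<in>Basis. - w \<bullet> e \<in> \<int>" using q(2) by simp
    show "\<forall>u\<in>\<tau>. 0 \<le> (2 *\<^sub>R - w) \<bullet> u" using 1 \<tau>sub by auto
    show "\<forall>u\<in>\<tau> \<inter> vertex_cone P 0. 0 \<le> - (2 *\<^sub>R - w) \<bullet> u" using 2 by simp
    show "\<forall>h. (\<forall>u \<in> \<tau> \<inter> vertex_cone P 0. 0 \<le> h \<bullet> u) \<longrightarrow>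
      (\<exists>k::nat. \<forall>u\<in>\<tau>. 0 \<le> (h + of_nat k *\<^sub>R 2 *\<^sub>R (- w)) \<bullet> u)" using 3 by blast
  qed
qed

text \<open>Doubling, by the hypothesis \<open>even\<close>, turns the integral vectors of the
  preceding lemmas into characters; that the origin is extreme makes the semigroup pointed.\<close>

lemma toric_fixed_point_0:
  assumes extreme: "0 extreme_point_of P"
    and dual_integral: "\<And>m e. m \<in> dual_lattice \<Lambda> \<Longrightarrow> e \<in> Basis \<Longrightarrow> m \<bullet> e \<in> \<int>"
    and even: "\<And>m. (\<And>e. e \<in> Basis \<Longrightarrow> m \<bullet> e \<in> \<int>) \<Longrightarrow> 2 *\<^sub>R m \<in> dual_lattice \<Lambda>"
  shows "toric_fixed_point \<Lambda> (normal_fan P) (vertex_cone P 0)"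
proof
  have "convex (vertex_cone P 0)" "vertex_cone P 0 \<noteq> {}"
    by (simp_all add: vertex_cone_def convex_convex_cone_hull convex_cone_hull_nonempty)
  then show "vertex_cone P 0 \<in> normal_fan P"
    using extreme by (auto simp: normal_fan_def intro: face_of_refl)
  show "m \<bullet> e \<in> \<int>" if "m \<in> dual_lattice \<Lambda>" "e \<in> Basis" for m e
    using that by (rule dual_integral)
  show "\<exists>w \<in> cone_semigroup \<Lambda> \<tau>. m + w \<in> cone_semigroup \<Lambda> \<tau>"
    if \<tau>: "\<tau> \<in> normal_fan P" and m: "m \<in> dual_lattice \<Lambda>" for \<tau> m
  proof -
    obtain v where v: "v \<in> P" "\<tau> face_of vertex_cone P v"
      using \<tau> by (auto simp: normal_fan_def extreme_point_of_def)
    note sub = face_of_imp_subset[OF v(2)]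
    obtain w where w: "\<forall>e\<in>Basis. w \<bullet> e \<in> \<int>"
      "\<forall>u \<in> vertex_cone P v. 0 \<le> (2 *\<^sub>R w) \<bullet> u \<and> 0 \<le> (m + 2 *\<^sub>R w) \<bullet> u"
      by (rule vertex_cone_dual_generates[OF v(1), where m = m])
    have "2 *\<^sub>R w \<in> dual_lattice \<Lambda>" using w(1) by (intro even) simp
    then show ?thesis
      using w(2) sub m dual_lattice_add[OF m] unfolding cone_semigroup_def
      by (intro bexI[of _ "2 *\<^sub>R w"]) auto
  qed
  show "\<exists>m \<in> cone_semigroup \<Lambda> \<tau>. - m \<in> cone_semigroup \<Lambda> (\<tau> \<inter> vertex_cone P 0) \<and>
      (\<forall>h \<in> cone_semigroup \<Lambda> (\<tau> \<inter> vertex_cone P 0). \<exists>k::nat. h + of_nat k *\<^sub>R m \<in> cone_semigroup \<Lambda> \<tau>)"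
    if \<tau>: "\<tau> \<in> normal_fan P" for \<tau>
  proof -
    obtain v where v: "v \<in> P" "\<tau> face_of vertex_cone P v"
      using \<tau> by (auto simp: normal_fan_def extreme_point_of_def)
    obtain w where w: "\<forall>e\<in>Basis. w \<bullet> e \<in> \<int>"
      "\<forall>u \<in> \<tau>. 0 \<le> (2 *\<^sub>R w) \<bullet> u" "\<forall>u \<in> \<tau> \<inter> vertex_cone P 0. 0 \<le> (- (2 *\<^sub>R w)) \<bullet> u"
      "\<forall>h. (\<forall>u \<in> \<tau> \<inter> vertex_cone P 0. 0 \<le> h \<bullet> u) \<longrightarrow>
        (\<exists>k::nat. \<forall>u\<in>\<tau>. 0 \<le> (h + of_nat k *\<^sub>R 2 *\<^sub>R w) \<bullet> u)"
      by (rule vertex_cone_separation[OF v])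
    define m where "m = 2 *\<^sub>R w"
    have md: "m \<in> dual_lattice \<Lambda>" unfolding m_def using w(1) by (intro even) simp
    then have m: "m \<in> cone_semigroup \<Lambda> \<tau>" "- m \<in> cone_semigroup \<Lambda> (\<tau> \<inter> vertex_cone P 0)"
      using w(2,3) dual_lattice_minus[OF md] by (simp_all add: cone_semigroup_def m_def)
    have "\<exists>k::nat. h + of_nat k *\<^sub>R m \<in> cone_semigroup \<Lambda> \<tau>"
      if h: "h \<in> cone_semigroup \<Lambda> (\<tau> \<inter> vertex_cone P 0)" for h
    proof -
      obtain k :: nat where "\<forall>u\<in>\<tau>. 0 \<le> (h + of_nat k *\<^sub>R m) \<bullet> u"
        using w(4) h unfolding cone_semigroup_def m_def by blast
      moreover have "h + of_nat k *\<^sub>R m \<in> dual_lattice \<Lambda>"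
        using h cone_semigroup_scale[OF m(1), of k] by (auto simp: cone_semigroup_def intro: dual_lattice_add)
      ultimately show ?thesis by (auto simp: cone_semigroup_def)
    qed
    then show ?thesis using m by blast
  qed
  show "m = 0" if m: "m \<in> cone_semigroup \<Lambda> (vertex_cone P 0)" "m' \<in> cone_semigroup \<Lambda> (vertex_cone P 0)"
    and sum: "m + m' = 0" for m m'
  proof (rule ccontr)
    assume m0: "m \<noteq> 0"
    obtain \<epsilon> \<epsilon>' where \<epsilon>: "\<epsilon> > 0" "\<epsilon> *\<^sub>R m \<in> P" "\<epsilon>' > 0" "\<epsilon>' *\<^sub>R m' \<in> P"
      using m vertex_cone_0_dual_iff unfolding cone_semigroup_def by blast
    have m': "m' = - m" using sum by (simp add: eq_neg_iff_add_eq_0 add.commute)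
    \<comment> \<open>A nonzero \<open>m\<close> together with its negative would put the origin
      strictly inside a segment of \<open>P\<close>; the weight balances the two lengths.\<close>
    have "0 \<in> open_segment (\<epsilon> *\<^sub>R m) (\<epsilon>' *\<^sub>R m')"
      unfolding in_segment
    proof (intro conjI exI[of _ "\<epsilon> / (\<epsilon> + \<epsilon>')"])
      have "\<epsilon> *\<^sub>R m - \<epsilon>' *\<^sub>R m' = (\<epsilon> + \<epsilon>') *\<^sub>R m" by (simp add: m' algebra_simps)
      then show "\<epsilon> *\<^sub>R m \<noteq> \<epsilon>' *\<^sub>R m'" using m0 \<epsilon> by auto
      have "(1 - \<epsilon> / (\<epsilon> + \<epsilon>')) * \<epsilon> - (\<epsilon> / (\<epsilon> + \<epsilon>')) * \<epsilon>' = 0" using \<epsilon> by (simp add: field_simps)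
      then show "0 = (1 - \<epsilon> / (\<epsilon> + \<epsilon>')) *\<^sub>R \<epsilon> *\<^sub>R m + (\<epsilon> / (\<epsilon> + \<epsilon>')) *\<^sub>R \<epsilon>' *\<^sub>R m'"
        by (simp add: m' flip: scaleR_left_diff_distrib)
    qed (use \<epsilon> in auto)
    then show False using extreme \<epsilon> by (auto simp: extreme_point_of_def)
  qed
qed

end

section \<open>The multi-theta graph\<close>

lemma dual_lattice_group_closure:
  "m \<in> dual_lattice (group_closure A) \<longleftrightarrow> (\<forall>l\<in>A. m \<bullet> l \<in> \<int>)"
proof
  assume "m \<in> dual_lattice (group_closure A)"
  then show "\<forall>l\<in>A. m \<bullet> l \<in> \<int>"
    by (auto simp: dual_lattice_def intro: group_closure.base)
next
  assume A: "\<forall>l\<in>A. m \<bullet> l \<in> \<int>"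
  have "m \<bullet> l \<in> \<int>" if "l \<in> group_closure A" for l
    using that by induction (use A in \<open>auto simp: inner_diff_right\<close>)
  then show "m \<in> dual_lattice (group_closure A)" by (simp add: dual_lattice_def)
qed

definition triangle_ineqs :: "real \<Rightarrow> real \<Rightarrow> real \<Rightarrow> bool" where
  "triangle_ineqs a b c \<longleftrightarrow> a \<le> b + c \<and> b \<le> a + c \<and> c \<le> a + b"

text \<open>\<open>edges_at\<close> lists the three edges at a vertex in every order. Two adjacent
  transpositions generate all permutations, so a condition stable under them can be checked in one
  order.\<close>

lemma all_orderings_iff:
  assumes "distinct [p, q, r]"
    and "\<And>a b c. Q a b c \<Longrightarrow> Q b a c" "\<And>a b c. Q a b c \<Longrightarrow> Q a c b"
  shows "(\<forall>e1 e2 e3. distinct [e1, e2, e3] \<and> {p, q, r} = {e1, e2, e3} \<longrightarrow> Q e1 e2 e3) \<longleftrightarrow> Q p q r"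
proof
  assume Q: "Q p q r"
  note qpr = assms(2)[OF Q] and prq = assms(3)[OF Q]
  note qrp = assms(3)[OF qpr] and rpq = assms(2)[OF prq]
  note rqp = assms(3)[OF rpq]
  show "\<forall>e1 e2 e3. distinct [e1, e2, e3] \<and> {p, q, r} = {e1, e2, e3} \<longrightarrow> Q e1 e2 e3"
  proof (intro allI impI)
    fix e1 e2 e3 assume e: "distinct [e1, e2, e3] \<and> {p, q, r} = {e1, e2, e3}"
    then have "e1 = p \<or> e1 = q \<or> e1 = r" "e2 = p \<or> e2 = q \<or> e2 = r" "e3 = p \<or> e3 = q \<or> e3 = r"
      by blast+
    moreover have "e1 \<noteq> e2" "e1 \<noteq> e3" "e2 \<noteq> e3" using e by auto
    ultimately show "Q e1 e2 e3" using Q qpr prq qrp rpq rqp by (elim disjE) simp_all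
  qed
next
  assume "\<forall>e1 e2 e3. distinct [e1, e2, e3] \<and> {p, q, r} = {e1, e2, e3} \<longrightarrow> Q e1 e2 e3"
  from this[rule_format, of p q r] show "Q p q r" using assms(1) by simp
qed

locale multi_theta_numbering =
  fixes g :: nat and num :: "theta_edge \<Rightarrow> 'n::finite"
  assumes g: "g \<ge> 3"
    and num: "bij_betw num (edges (multi_theta g)) (UNIV :: 'n set)"
begin

abbreviation G where "G \<equiv> multi_theta g"
abbreviation P where "P \<equiv> graph_polytope num G"
abbreviation \<Lambda> where "\<Lambda> \<equiv> graph_lattice num G"

text \<open>The two sides of the oval as paths; both start with the top arc and end with the bottom
  arc.\<close>

definition rail :: "bool \<Rightarrow> nat \<Rightarrow> theta_edge" where
  "rail s k = (if k = 0 then TopArc else if k = g - 1 then BottomArc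
     else if s then RailA k else RailB k)"

definition vertex :: "bool \<Rightarrow> nat \<Rightarrow> theta_vertex" where
  "vertex s k = (if s then VA k else VB k)"

lemma verts_G: "verts G = (\<Union>s. vertex s ` {1..g - 1})"
proof -
  have "vertex True = VA" "vertex False = VB" by (simp_all add: vertex_def fun_eq_iff)
  then show ?thesis by (simp add: multi_theta_def UNIV_bool Un_commute)
qed

lemma in_edges_iff:
  "Rung k \<in> edges G \<longleftrightarrow> 1 \<le> k \<and> k \<le> g - 1"
  "RailA k \<in> edges G \<longleftrightarrow> 1 \<le> k \<and> k \<le> g - 2"
  "RailB k \<in> edges G \<longleftrightarrow> 1 \<le> k \<and> k \<le> g - 2"
  "TopArc \<in> edges G" "BottomArc \<in> edges G"
  by (auto simp: multi_theta_def)

lemma edges_G: "edges G = Rung ` {1..g - 1} \<union> (\<Union>s. rail s ` {0..g - 1})"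
proof
  show "edges G \<subseteq> Rung ` {1..g - 1} \<union> (\<Union>s. rail s ` {0..g - 1})"
  proof
    fix e assume e: "e \<in> edges G"
    have rail: "rail s k \<in> Rung ` {1..g - 1} \<union> (\<Union>s. rail s ` {0..g - 1})" if "k \<le> g - 1" for s k
      using that by (intro UnI2 UN_I[of s] imageI) simp_all
    show "e \<in> Rung ` {1..g - 1} \<union> (\<Union>s. rail s ` {0..g - 1})"
    proof (cases e)
      case (Rung k)
      then show ?thesis using e by (auto simp: multi_theta_def)
    next
      case (RailA k)
      then have "e = rail True k" "k \<le> g - 1" using e by (auto simp: multi_theta_def rail_def)
      then show ?thesis using rail by simp
    next
      case (RailB k)
      then have "e = rail False k" "k \<le> g - 1" using e by (auto simp: multi_theta_def rail_def)
      then show ?thesis using rail by simp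
    next
      case TopArc
      then have "e = rail True 0" by (simp add: rail_def)
      then show ?thesis using rail[of 0 True] by simp
    next
      case BottomArc
      then have "e = rail True (g - 1)" using g by (simp add: rail_def)
      then show ?thesis using rail[of "g - 1" True] by simp
    qed
  qed
  show "Rung ` {1..g - 1} \<union> (\<Union>s. rail s ` {0..g - 1}) \<subseteq> edges G"
  proof -
    have "rail s k \<in> edges G" if "k \<le> g - 1" for s k
      using that by (auto simp: multi_theta_def rail_def)
    then show ?thesis by (auto simp: in_edges_iff)
  qed
qed

lemma ends_G: "ends G = theta_ends g"
  by (simp add: multi_theta_def)

lemma incident_edges:
  assumes "1 \<le> k" "k \<le> g - 1"
  shows "{e \<in> edges G. vertex s k \<in> ends G e} = {rail s (k - 1), Rung k, rail s k}"
    "distinct [rail s (k - 1), Rung k, rail s k]"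
proof -
  show "{e \<in> edges G. vertex s k \<in> ends G e} = {rail s (k - 1), Rung k, rail s k}"
  proof -
    have "e \<in> edges G \<and> vertex s k \<in> ends G e \<longleftrightarrow> e = rail s (k - 1) \<or> e = Rung k \<or> e = rail s k" for e
    proof -
      \<comment> \<open>The first, inner and last vertices differ in which of their path edges is an
        arc; \<open>g \<ge> 3\<close> keeps the first and the last apart.\<close>
      consider "k = 1" "k < g - 1" | "1 < k" "k < g - 1" | "k = g - 1" "1 < k" using assms g by force
      then show ?thesis
      proof cases
        case 1
        then have "rail s (k - 1) = TopArc" "rail s k = (if s then RailA 1 else RailB 1)"
          by (simp_all add: rail_def)
        then show ?thesis using 1 by (cases e; cases s) (auto simp: in_edges_iff ends_G vertex_def)
      next
        case 2
        then have "rail s (k - 1) = (if s then RailA (k - 1) else RailB (k - 1))"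
          "rail s k = (if s then RailA k else RailB k)"
          by (auto simp: rail_def)
        then show ?thesis using 2 by (cases e; cases s) (auto simp: in_edges_iff ends_G vertex_def)
      next
        case 3
        then have "rail s (k - 1) = (if s then RailA (k - 1) else RailB (k - 1))" "rail s k = BottomArc"
          by (auto simp: rail_def)
        then show ?thesis using 3 by (cases e; cases s) (auto simp: in_edges_iff ends_G vertex_def)
      qed
    qed
    then show ?thesis by blast
  qed
  have "k - 1 \<noteq> k" "k - 1 \<noteq> g - 1" "k \<noteq> 0" using assms g by auto
  then show "distinct [rail s (k - 1), Rung k, rail s k]"
    by (simp add: rail_def)
qed

lemma edges_at_iff:
  assumes "1 \<le> k" "k \<le> g - 1"
  shows "edges_at G (vertex s k) e1 e2 e3 \<longleftrightarrow>
    distinct [e1, e2, e3] \<and> {rail s (k - 1), Rung k, rail s k} = {e1, e2, e3}"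
  unfolding edges_at_def incident_edges(1)[OF assms] ..

lemma all_edges_at_iff:
  assumes "\<And>a b c. Q a b c \<Longrightarrow> Q b a c" "\<And>a b c. Q a b c \<Longrightarrow> Q a c b"
  shows "(\<forall>v\<in>verts G. \<forall>e1 e2 e3. edges_at G v e1 e2 e3 \<longrightarrow> Q e1 e2 e3) \<longleftrightarrow>
    (\<forall>s. \<forall>k\<in>{1..g - 1}. Q (rail s (k - 1)) (Rung k) (rail s k))"
proof -
  have "(\<forall>v\<in>verts G. \<forall>e1 e2 e3. edges_at G v e1 e2 e3 \<longrightarrow> Q e1 e2 e3) \<longleftrightarrow>
      (\<forall>s. \<forall>k\<in>{1..g - 1}. \<forall>e1 e2 e3. edges_at G (vertex s k) e1 e2 e3 \<longrightarrow> Q e1 e2 e3)"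
  proof (intro iffI allI ballI impI)
    fix s k e1 e2 e3
    assume Q: "\<forall>v\<in>verts G. \<forall>e1 e2 e3. edges_at G v e1 e2 e3 \<longrightarrow> Q e1 e2 e3"
      and "k \<in> {1..g - 1}" and e: "edges_at G (vertex s k) e1 e2 e3"
    then have "vertex s k \<in> verts G" unfolding verts_G by (intro UN_I[of s] imageI) simp_all
    then show "Q e1 e2 e3" using Q e by blast
  next
    fix v e1 e2 e3
    assume Q: "\<forall>s. \<forall>k\<in>{1..g - 1}. \<forall>e1 e2 e3. edges_at G (vertex s k) e1 e2 e3 \<longrightarrow> Q e1 e2 e3"
      and v: "v \<in> verts G" and e: "edges_at G v e1 e2 e3"
    obtain s k where "v = vertex s k" "k \<in> {1..g - 1}" using v by (auto simp: verts_G)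
    then show "Q e1 e2 e3" using Q e by blast
  qed
  also have "\<dots> \<longleftrightarrow> (\<forall>s. \<forall>k\<in>{1..g - 1}. Q (rail s (k - 1)) (Rung k) (rail s k))"
  proof (intro all_cong1 ball_cong refl)
    fix s k assume "k \<in> {1..g - 1}"
    then have k: "1 \<le> k" "k \<le> g - 1" by auto
    show "(\<forall>e1 e2 e3. edges_at G (vertex s k) e1 e2 e3 \<longrightarrow> Q e1 e2 e3) \<longleftrightarrow>
        Q (rail s (k - 1)) (Rung k) (rail s k)"
      unfolding edges_at_iff[OF k] by (rule all_orderings_iff[OF incident_edges(2)[OF k] assms])
  qed
  finally show ?thesis .
qed

section \<open>Coordinates of the polytope and of the character lattice\<close>

abbreviation co :: "real ^ 'n \<Rightarrow> theta_edge \<Rightarrow> real" where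
  "co x e \<equiv> x $ num e"

lemma P_iff: "x \<in> P \<longleftrightarrow> (\<forall>s. \<forall>k\<in>{1..g - 1}.
    co x (rail s (k - 1)) + co x (Rung k) + co x (rail s k) \<le> 2 \<and>
    triangle_ineqs (co x (rail s (k - 1))) (co x (Rung k)) (co x (rail s k)))"
proof -
  let ?Q = "\<lambda>e1 e2 e3. co x e1 + co x e2 + co x e3 \<le> 2 \<and> triangle_ineqs (co x e1) (co x e2) (co x e3)"
  have "x \<in> P \<longleftrightarrow> (\<forall>v\<in>verts G. \<forall>e1 e2 e3. edges_at G v e1 e2 e3 \<longrightarrow> ?Q e1 e2 e3)"
    unfolding graph_polytope_def mem_Collect_eq
    by (intro ball_cong refl all_cong1 imp_cong) (auto simp: triangle_ineqs_def)
  also have "\<dots> \<longleftrightarrow> (\<forall>s. \<forall>k\<in>{1..g - 1}. ?Q (rail s (k - 1)) (Rung k) (rail s k))"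
    by (rule all_edges_at_iff) (auto simp: triangle_ineqs_def)
  finally show ?thesis .
qed

lemma dual_iff: "m \<in> dual_lattice \<Lambda> \<longleftrightarrow> (\<forall>i. m $ i \<in> \<int>) \<and> (\<forall>s. \<forall>k\<in>{1..g - 1}.
    (co m (rail s (k - 1)) + co m (Rung k) + co m (rail s k)) / 2 \<in> \<int>)"
proof -
  let ?Q = "\<lambda>e1 e2 e3. (co m e1 + co m e2 + co m e3) / 2 \<in> \<int>"
  have "m \<in> dual_lattice \<Lambda> \<longleftrightarrow> (\<forall>e\<in>edges G. co m e \<in> \<int>) \<and>
      (\<forall>v\<in>verts G. \<forall>e1 e2 e3. edges_at G v e1 e2 e3 \<longrightarrow> ?Q e1 e2 e3)"
  proof -
    have "(\<forall>l\<in>{axis (num e) 1 | e. e \<in> edges G}. m \<bullet> l \<in> \<int>) \<longleftrightarrow> (\<forall>e\<in>edges G. co m e \<in> \<int>)"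
      by (auto simp: inner_axis)
    moreover have "(\<forall>l\<in>{(1/2) *\<^sub>R (axis (num e1) 1 + axis (num e2) 1 + axis (num e3) 1) | v e1 e2 e3.
         v \<in> verts G \<and> edges_at G v e1 e2 e3}. m \<bullet> l \<in> \<int>) \<longleftrightarrow>
      (\<forall>v\<in>verts G. \<forall>e1 e2 e3. edges_at G v e1 e2 e3 \<longrightarrow>
         m \<bullet> ((1/2) *\<^sub>R (axis (num e1) 1 + axis (num e2) 1 + axis (num e3) 1)) \<in> \<int>)"
      by blast
    moreover have "m \<bullet> ((1/2) *\<^sub>R (axis (num e1) 1 + axis (num e2) 1 + axis (num e3) 1)) =
        (co m e1 + co m e2 + co m e3) / 2" for e1 e2 e3
      by (simp add: inner_axis inner_add_right)
    ultimately show ?thesis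
      unfolding graph_lattice_def dual_lattice_group_closure ball_Un by simp
  qed
  also have "(\<forall>v\<in>verts G. \<forall>e1 e2 e3. edges_at G v e1 e2 e3 \<longrightarrow> ?Q e1 e2 e3) \<longleftrightarrow>
      (\<forall>s. \<forall>k\<in>{1..g - 1}. ?Q (rail s (k - 1)) (Rung k) (rail s k))"
    by (rule all_edges_at_iff) (simp_all add: add_ac)
  also have "(\<forall>e\<in>edges G. co m e \<in> \<int>) \<longleftrightarrow> (\<forall>i. m $ i \<in> \<int>)"
    using num unfolding bij_betw_def by (metis UNIV_I image_iff)
  finally show ?thesis .
qed

lemma vector_eqI:
  assumes "\<And>k. k \<in> {1..g - 1} \<Longrightarrow> co x (Rung k) = co y (Rung k)"
    and "\<And>s k. k \<le> g - 1 \<Longrightarrow> co x (rail s k) = co y (rail s k)"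
  shows "x = y"
proof -
  have "co x e = co y e" if "e \<in> edges G" for e
    using that assms unfolding edges_G by auto
  then show ?thesis
    using num unfolding bij_betw_def vec_eq_iff by (metis UNIV_I image_iff)
qed

definition emb :: "(theta_edge \<Rightarrow> int) \<Rightarrow> real ^ 'n" where
  "emb y = (\<chi> i. real_of_int (y (inv_into (edges G) num i)))"

lemma co_emb:
  assumes "e \<in> edges G"
  shows "co (emb y) e = real_of_int (y e)"
  using num assms by (simp add: emb_def bij_betw_def inv_into_f_f)

lemma rung_in: "k \<in> {1..g - 1} \<Longrightarrow> Rung k \<in> edges G"
  by (simp add: in_edges_iff)

lemma rail_in: "k \<le> g - 1 \<Longrightarrow> rail s k \<in> edges G"
  by (auto simp: rail_def in_edges_iff)

definition half_planes :: "((real ^ 'n) \<times> real) set" where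
  "half_planes = (\<Union>s. \<Union>k\<in>{1..g - 1}.
     let p = axis (num (rail s (k - 1))) 1; q = axis (num (Rung k)) 1; r = axis (num (rail s k)) 1
     in {(p + q + r, 2), (p - q - r, 0), (q - p - r, 0), (r - p - q, 0)})"

lemma num_distinct:
  assumes "k \<in> {1..g - 1}"
  shows "num (rail s (k - 1)) \<noteq> num (Rung k)" "num (rail s (k - 1)) \<noteq> num (rail s k)"
    "num (Rung k) \<noteq> num (rail s k)"
proof -
  have inj: "inj_on num (edges G)" using num by (simp add: bij_betw_def)
  have "k - 1 \<le> g - 1" "k \<le> g - 1" using assms by auto
  note e = rung_in[OF assms] rail_in[OF this(1), of s] rail_in[OF this(2), of s]
  show "num (rail s (k - 1)) \<noteq> num (Rung k)" "num (rail s (k - 1)) \<noteq> num (rail s k)"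
    "num (Rung k) \<noteq> num (rail s k)"
    using incident_edges(2)[of k s] assms inj_on_eq_iff[OF inj] e by auto
qed

lemma integral_polyhedron_P: "integral_polyhedron half_planes P"
proof
  show "finite half_planes" by (simp add: half_planes_def Let_def)
  show "a \<noteq> 0" if "(a, b) \<in> half_planes" for a b
  proof -
    obtain s k where k: "k \<in> {1..g - 1}" and ab: "(a, b) \<in>
      (let p = axis (num (rail s (k - 1))) 1; q = axis (num (Rung k)) 1; r = axis (num (rail s k)) 1
       in {(p + q + r, 2), (p - q - r, 0), (q - p - r, 0), (r - p - q, 0)})"
      using \<open>(a, b) \<in> half_planes\<close> unfolding half_planes_def by blast
    \<comment> \<open>The three edges have distinct numbers, so the coordinate at the rung is 1 or
      -1 in all four normals.\<close>
    then have "a $ num (Rung k) \<noteq> 0" using num_distinct[OF k, of s]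
      by (auto simp: Let_def axis_def)
    then show ?thesis by auto
  qed
  show "a \<bullet> e \<in> \<int>" if ab: "(a, b) \<in> half_planes" and e: "e \<in> Basis" for a b e
  proof -
    obtain i where "e = axis i 1" using e by (auto simp: Basis_vec_def)
    then have "a \<bullet> e = a $ i" by (simp add: inner_axis)
    then show ?thesis using ab by (auto simp: half_planes_def Let_def axis_def)
  qed
  show "b \<in> \<int>" "0 \<le> b" if "(a, b) \<in> half_planes" for a b
    using that by (auto simp: half_planes_def Let_def)
  show "P = {x. \<forall>(a, b)\<in>half_planes. a \<bullet> x \<le> b}"
  proof -
    have "x \<in> P \<longleftrightarrow> (\<forall>(a, b)\<in>half_planes. a \<bullet> x \<le> b)" for x
      unfolding P_iff half_planes_def
      by (simp add: Let_def inner_add_left inner_diff_left inner_axis' triangle_ineqs_def)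
        (auto simp: algebra_simps)
    then show ?thesis by blast
  qed
  \<comment> \<open>With all coordinates 1/2 every vertex sum is 3/2, below 2, and the triangle
    inequalities are strict.\<close>
  show "\<exists>p. \<forall>(a, b)\<in>half_planes. a \<bullet> p < b"
    by (intro exI[of _ "\<chi> i. 1/2"])
      (auto simp: half_planes_def Let_def inner_add_left inner_diff_left inner_axis')
qed

lemma triangle_nonneg: "triangle_ineqs a b c \<Longrightarrow> 0 \<le> a \<and> 0 \<le> b \<and> 0 \<le> c"
  by (auto simp: triangle_ineqs_def)

lemma coordinates_nonneg:
  assumes "\<And>s k. k \<in> {1..g - 1} \<Longrightarrow> triangle_ineqs (co x (rail s (k - 1))) (co x (Rung k)) (co x (rail s k))"
  shows "k \<in> {1..g - 1} \<Longrightarrow> 0 \<le> co x (Rung k)" "k \<le> g - 1 \<Longrightarrow> 0 \<le> co x (rail s k)"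
proof -
  show "k \<in> {1..g - 1} \<Longrightarrow> 0 \<le> co x (Rung k)" using assms triangle_nonneg by blast
  \<comment> \<open>There is no vertex of index 0, so path edge 0 is read off at vertex 1, as the
    edge preceding it.\<close>
  show "0 \<le> co x (rail s k)" if "k \<le> g - 1"
  proof (cases "k = 0")
    case True
    then show ?thesis using triangle_nonneg[OF assms[of 1 s]] g by simp
  next
    case False
    then show ?thesis using triangle_nonneg[OF assms[of k s]] that by simp
  qed
qed

text \<open>The triangle inequalities make all coordinates in \<open>P\<close> nonnegative, so a
  strict convex combination can be zero only if both points are.\<close>

lemma zero_extreme: "0 extreme_point_of P"
  unfolding extreme_point_of_def
proof (intro conjI ballI notI)
  show "0 \<in> P" by (simp add: P_iff triangle_ineqs_def)
  fix a b assume ab: "a \<in> P" "b \<in> P" "0 \<in> open_segment a b"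
  then obtain u where u: "0 < u" "u < 1" "a \<noteq> b" "0 = (1 - u) *\<^sub>R a + u *\<^sub>R b"
    by (auto simp: in_segment)
  have zero: "x = 0 \<and> y = 0" if "0 \<le> x" "0 \<le> y" "0 = (1 - u) * x + u * y" for x y :: real
  proof -
    have "0 \<le> (1 - u) * x" "0 \<le> u * y" using u that by simp_all
    then have "(1 - u) * x = 0 \<and> u * y = 0" using that(3) by linarith
    then show ?thesis using u by simp
  qed
  have eq: "0 = (1 - u) * co a e + u * co b e" for e
    using arg_cong[OF u(4), of "\<lambda>x. x $ num e"] by simp
  have t: "triangle_ineqs (co x (rail s (k - 1))) (co x (Rung k)) (co x (rail s k))"
    if "x \<in> P" "k \<in> {1..g - 1}" for x s k
    using that P_iff by blast
  have "a = b"
  proof (rule vector_eqI)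
    show "co a (Rung k) = co b (Rung k)" if "k \<in> {1..g - 1}" for k
      using zero[OF coordinates_nonneg(1)[OF t[OF ab(1)]] coordinates_nonneg(1)[OF t[OF ab(2)]] eq] that
      by simp
    show "co a (rail s k) = co b (rail s k)" if "k \<le> g - 1" for s k
      using zero[OF coordinates_nonneg(2)[OF t[OF ab(1)]] coordinates_nonneg(2)[OF t[OF ab(2)]] eq] that
      by simp
  qed
  then show False using u(3) by simp
qed

lemmas dual_cone_iff = integral_polyhedron.vertex_cone_0_dual_iff[OF integral_polyhedron_P]

lemma toric_fixed_point_P: "toric_fixed_point \<Lambda> (normal_fan P) (vertex_cone P 0)"
proof (rule integral_polyhedron.toric_fixed_point_0[OF integral_polyhedron_P zero_extreme])
  show "m \<bullet> e \<in> \<int>" if "m \<in> dual_lattice \<Lambda>" "e \<in> Basis" for m e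
  proof -
    obtain i where "e = axis i 1" using \<open>e \<in> Basis\<close> by (auto simp: Basis_vec_def)
    moreover have "m $ i \<in> \<int>" using \<open>m \<in> dual_lattice \<Lambda>\<close> dual_iff[of m] by simp
    ultimately show ?thesis by (simp add: inner_axis)
  qed
  show "2 *\<^sub>R m \<in> dual_lattice \<Lambda>" if "\<And>e. e \<in> Basis \<Longrightarrow> m \<bullet> e \<in> \<int>" for m
  proof -
    have m: "m $ i \<in> \<int>" for i
      using that[of "axis i 1"] by (auto simp: inner_axis Basis_vec_def)
    have "(2 * a + 2 * b + 2 * c) / 2 = a + b + c" for a b c :: real by simp
    then show ?thesis unfolding dual_iff vector_scaleR_component real_scaleR_def using m by (simp only: Ints_add) simp
  qed
qed

abbreviation S0 where "S0 \<equiv> cone_semigroup \<Lambda> (vertex_cone P 0)"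

lemma S0_D:
  assumes "m \<in> S0"
  shows "m $ i \<in> \<int>"
    and "k \<in> {1..g - 1} \<Longrightarrow> triangle_ineqs (co m (rail s (k - 1))) (co m (Rung k)) (co m (rail s k))"
    and "k \<in> {1..g - 1} \<Longrightarrow> (co m (rail s (k - 1)) + co m (Rung k) + co m (rail s k)) / 2 \<in> \<int>"
    and "k \<in> {1..g - 1} \<Longrightarrow> 0 \<le> co m (Rung k)"
    and "k \<le> g - 1 \<Longrightarrow> 0 \<le> co m (rail s k)"
proof -
  have d: "m \<in> dual_lattice \<Lambda>" "\<forall>u \<in> vertex_cone P 0. 0 \<le> m \<bullet> u"
    using assms by (auto simp: cone_semigroup_def)
  obtain \<epsilon> where \<epsilon>: "\<epsilon> > 0" "\<epsilon> *\<^sub>R m \<in> P" using d(2) dual_cone_iff[of m] by auto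
  show "m $ i \<in> \<int>" using d(1) dual_iff[of m] by simp
  show "k \<in> {1..g - 1} \<Longrightarrow> (co m (rail s (k - 1)) + co m (Rung k) + co m (rail s k)) / 2 \<in> \<int>"
    using d(1) dual_iff[of m] by simp
  have t: "triangle_ineqs (co m (rail s (k - 1))) (co m (Rung k)) (co m (rail s k))"
    if "k \<in> {1..g - 1}" for s k
  proof -
    have "triangle_ineqs (\<epsilon> * co m (rail s (k - 1))) (\<epsilon> * co m (Rung k)) (\<epsilon> * co m (rail s k))"
      using \<epsilon>(2) that P_iff[of "\<epsilon> *\<^sub>R m"] by simp
    then show ?thesis using \<epsilon>(1) by (simp add: triangle_ineqs_def flip: distrib_left)
  qed
  show "k \<in> {1..g - 1} \<Longrightarrow> triangle_ineqs (co m (rail s (k - 1))) (co m (Rung k)) (co m (rail s k))"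
    by (rule t)
  show "k \<in> {1..g - 1} \<Longrightarrow> 0 \<le> co m (Rung k)" "k \<le> g - 1 \<Longrightarrow> 0 \<le> co m (rail s k)"
    using coordinates_nonneg[OF t] by blast+
qed

lemma emb_in_S0:
  assumes y: "\<And>s k. k \<in> {1..g - 1} \<Longrightarrow>
      y (rail s (k - 1)) + y (Rung k) + y (rail s k) \<le> 4 \<and>
      even (y (rail s (k - 1)) + y (Rung k) + y (rail s k)) \<and>
      y (rail s (k - 1)) \<le> y (Rung k) + y (rail s k) \<and>
      y (Rung k) \<le> y (rail s (k - 1)) + y (rail s k) \<and>
      y (rail s k) \<le> y (rail s (k - 1)) + y (Rung k)"
  shows "emb y \<in> S0"
proof -
  have co: "co (emb y) (rail s (k - 1)) = y (rail s (k - 1))" "co (emb y) (Rung k) = y (Rung k)"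
      "co (emb y) (rail s k) = y (rail s k)" if "k \<in> {1..g - 1}" for s k
    using that by (auto intro!: co_emb rail_in rung_in)
  have "emb y \<in> dual_lattice \<Lambda>"
    unfolding dual_iff
  proof (intro conjI allI ballI)
    show "emb y $ i \<in> \<int>" for i by (simp add: emb_def)
    fix s k assume k: "k \<in> {1..g - 1}"
    then obtain z where "y (rail s (k - 1)) + y (Rung k) + y (rail s k) = 2 * z"
      using y[OF k, of s] by (elim conjE evenE)
    then have "real_of_int (y (rail s (k - 1)) + y (Rung k) + y (rail s k)) / 2 = of_int z" by simp
    then show "(co (emb y) (rail s (k - 1)) + co (emb y) (Rung k) + co (emb y) (rail s k)) / 2 \<in> \<int>"
      unfolding co[OF k] by (metis Ints_of_int of_int_add)
  qed
  \<comment> \<open>Halving turns the assumed bound 4 on vertex sums into the bound 2 of the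
    polytope. The dumbbell attains 4.\<close>
  moreover have "(1 / 2) *\<^sub>R emb y \<in> P"
    unfolding P_iff
  proof (intro allI ballI)
    fix s k assume k: "k \<in> {1..g - 1}"
    show "co ((1 / 2) *\<^sub>R emb y) (rail s (k - 1)) + co ((1 / 2) *\<^sub>R emb y) (Rung k) +
        co ((1 / 2) *\<^sub>R emb y) (rail s k) \<le> 2 \<and>
        triangle_ineqs (co ((1 / 2) *\<^sub>R emb y) (rail s (k - 1))) (co ((1 / 2) *\<^sub>R emb y) (Rung k))
          (co ((1 / 2) *\<^sub>R emb y) (rail s k))"
      using y[OF k, of s] unfolding vector_scaleR_component co[OF k] triangle_ineqs_def by auto
  qed
  then have "\<exists>\<epsilon>>0. \<epsilon> *\<^sub>R emb y \<in> P" by (intro exI[of _ "1/2"]) simp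
  ultimately show ?thesis using dual_cone_iff[of "emb y"] by (simp add: cone_semigroup_def)
qed

text \<open>The edge vectors of the simple cycles: horizontal edges number \<open>i\<close> and \<open>j\<close> (of \<open>g + 1\<close>,
  counting the two arcs) joined along both sides.\<close>

definition cycle :: "nat \<Rightarrow> nat \<Rightarrow> theta_edge \<Rightarrow> int" where
  "cycle i j e = (case e of Rung k \<Rightarrow> of_bool (k = i \<or> k = j)
     | RailA k \<Rightarrow> of_bool (i \<le> k \<and> k < j) | RailB k \<Rightarrow> of_bool (i \<le> k \<and> k < j)
     | TopArc \<Rightarrow> of_bool (i = 0 \<and> 0 < j) | BottomArc \<Rightarrow> of_bool (i \<le> g - 1 \<and> g - 1 < j))"

text \<open>The top and the bottom double edge, joined by one side of the oval traversed twice.\<close>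

definition dumbbell :: "theta_edge \<Rightarrow> int" where
  "dumbbell e = (case e of Rung k \<Rightarrow> of_bool (k = 1 \<or> k = g - 1)
     | RailA k \<Rightarrow> 2 | RailB k \<Rightarrow> 0 | TopArc \<Rightarrow> 1 | BottomArc \<Rightarrow> 1)"

text \<open>With the numbering of \<open>rail\<close> the arcs obey the formula for the other path
  edges: \<open>rail s 0\<close> is used exactly if \<open>i = 0 < j\<close>, and
  \<open>rail s (g - 1)\<close> closes the cycle when \<open>j = g\<close>.\<close>

lemma cycle_simps [simp]:
  "cycle i j (Rung k) = of_bool (k = i \<or> k = j)"
  "k \<le> g - 1 \<Longrightarrow> cycle i j (rail s k) = of_bool (i \<le> k \<and> k < j)"
  using g by (auto simp: cycle_def rail_def)

lemma dumbbell_simps [simp]: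
  "dumbbell (Rung k) = of_bool (k = 1 \<or> k = g - 1)"
  "dumbbell (rail s 0) = 1" "k = g - 1 \<Longrightarrow> dumbbell (rail s k) = 1"
  "0 < k \<Longrightarrow> k < g - 1 \<Longrightarrow> dumbbell (rail s k) = (if s then 2 else 0)"
  using g by (auto simp: dumbbell_def rail_def)

lemma cycle_in_S0:
  assumes "i < j" "j \<le> g"
  shows "emb (cycle i j) \<in> S0"
proof (rule emb_in_S0)
  fix s k assume "k \<in> {1..g - 1}"
  then have k: "1 \<le> k" "k \<le> g - 1" "k - 1 \<le> g - 1" by auto
  show "cycle i j (rail s (k - 1)) + cycle i j (Rung k) + cycle i j (rail s k) \<le> 4 \<and>
      even (cycle i j (rail s (k - 1)) + cycle i j (Rung k) + cycle i j (rail s k)) \<and>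
      cycle i j (rail s (k - 1)) \<le> cycle i j (Rung k) + cycle i j (rail s k) \<and>
      cycle i j (Rung k) \<le> cycle i j (rail s (k - 1)) + cycle i j (rail s k) \<and>
      cycle i j (rail s k) \<le> cycle i j (rail s (k - 1)) + cycle i j (Rung k)"
    unfolding cycle_simps(1) cycle_simps(2)[OF k(2)] cycle_simps(2)[OF k(3)]
    using k assms by (cases "k = i"; cases "k = j"; cases "i < k"; cases "k < j") auto
qed

lemma dumbbell_in_S0: "emb dumbbell \<in> S0"
proof (rule emb_in_S0)
  fix s k assume "k \<in> {1..g - 1}"
  then consider "k = 1" | "k = g - 1" "k \<noteq> 1" | "1 < k" "k < g - 1" by force
  then show "dumbbell (rail s (k - 1)) + dumbbell (Rung k) + dumbbell (rail s k) \<le> 4 \<and>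
      even (dumbbell (rail s (k - 1)) + dumbbell (Rung k) + dumbbell (rail s k)) \<and>
      dumbbell (rail s (k - 1)) \<le> dumbbell (Rung k) + dumbbell (rail s k) \<and>
      dumbbell (Rung k) \<le> dumbbell (rail s (k - 1)) + dumbbell (rail s k) \<and>
      dumbbell (rail s k) \<le> dumbbell (rail s (k - 1)) + dumbbell (Rung k)"
  proof cases
    case 1
    then show ?thesis using g by simp
  next
    case 2
    then have "0 < k - 1" "k - 1 < g - 1" using g by auto
    then show ?thesis using dumbbell_simps(4)[of "k - 1" s] 2 by simp
  next
    case 3
    then show ?thesis using dumbbell_simps(4)[of "k - 1" s] dumbbell_simps(4)[of k s] by simp
  qed
qed

text \<open>Where the rung is labelled 0, the triangle inequalities force the two path edges at the
  vertex to have equal labels.\<close>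

lemma rail_constant:
  assumes "a \<in> S0" "i \<le> k" "k \<le> l" "l \<le> g - 1"
    and "\<And>n. i < n \<Longrightarrow> n \<le> l \<Longrightarrow> co a (Rung n) = 0"
  shows "co a (rail s k) = co a (rail s i)"
  using assms(2,3)
proof (induction k rule: dec_induct)
  case (step n)
  have "Suc n \<in> {1..g - 1}" using step assms(4) by auto
  from S0_D(2)[OF assms(1) this, of s] have "co a (rail s (Suc n)) = co a (rail s n)"
    using assms(5)[of "Suc n"] step by (simp add: triangle_ineqs_def)
  then show ?case using step by simp
qed simp

text \<open>By nonnegativity a summand vanishes off the cycle, so at each vertex of the cycle its
  labels on the two cycle edges agree. It is therefore \<open>c\<close> times the cycle, with an
  integer \<open>c\<close> between 0 and 1.\<close>

lemma cycle_irreducible: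
  assumes ij: "i < j" "j \<le> g" and ab: "a \<in> S0" "b \<in> S0" "a + b = emb (cycle i j)"
  shows "a = 0 \<or> b = 0"
proof -
  have sum: "co a e + co b e = of_int (cycle i j e)" if "e \<in> edges G" for e
    using arg_cong[OF ab(3), of "\<lambda>x. x $ num e"] co_emb[OF that] by simp
  have rung: "0 \<le> co a (Rung k)" "co a (Rung k) + co b (Rung k) = of_bool (k = i \<or> k = j)"
      "0 \<le> co b (Rung k)" if "k \<in> {1..g - 1}" for k
    using sum[OF rung_in[OF that]] S0_D(4)[OF ab(1) that] S0_D(4)[OF ab(2) that] by simp_all
  have rail: "0 \<le> co a (rail s k)" "co a (rail s k) + co b (rail s k) = of_bool (i \<le> k \<and> k < j)"
      "0 \<le> co b (rail s k)" if "k \<le> g - 1" for s k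
    using sum[OF rail_in[OF that]] S0_D(5)[OF ab(1) that] S0_D(5)[OF ab(2) that] that by simp_all
  define c where "c = co a (rail True i)"
  have const: "co a (rail s k) = co a (rail s i)" if "i \<le> k" "k < j" for s k
  proof (rule rail_constant[OF ab(1), of i k k])
    show "co a (Rung n) = 0" if n: "i < n" "n \<le> k" for n
    proof -
      have "n \<in> {1..g - 1}" using n \<open>k < j\<close> ij by auto
      moreover have "n \<noteq> i" "n \<noteq> j" using n \<open>k < j\<close> by auto
      ultimately show ?thesis using rung[of n] by simp
    qed
  qed (use that ij in auto)
  have rung_i: "co a (Rung i) = co a (rail s i)" if "i \<ge> 1" for s
  proof -
    have i: "i \<in> {1..g - 1}" "i - 1 \<le> g - 1" "\<not> i \<le> i - 1" using that ij by auto
    have "co a (rail s (i - 1)) = 0" using rail[OF i(2), of s] i(3) by simp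
    then show ?thesis using S0_D(2)[OF ab(1) i(1), of s] unfolding triangle_ineqs_def by linarith
  qed
  \<comment> \<open>The two sides carry the same label: they share the top arc if
    \<open>i = 0\<close>, and meet in rung \<open>i\<close> otherwise.\<close>
  have rail_i: "co a (rail s i) = c" for s
  proof (cases "i = 0")
    case True
    then show ?thesis by (simp add: c_def rail_def)
  next
    case False
    then show ?thesis using rung_i[of s] rung_i[of True] by (simp add: c_def)
  qed
  \<comment> \<open>For \<open>j = g\<close> the closing edge is the bottom arc, already covered as
    a path edge.\<close>
  have rung_j: "co a (Rung j) = c" if "j \<le> g - 1"
  proof -
    have j: "j \<in> {1..g - 1}" "i \<le> j - 1" "j - 1 < j" using that ij by auto
    have "co a (rail True j) = 0" using rail[OF that, of True] by simp
    moreover have "co a (rail True (j - 1)) = c" using const[OF j(2,3)] rail_i by simp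
    ultimately show ?thesis using S0_D(2)[OF ab(1) j(1), of True] unfolding triangle_ineqs_def by linarith
  qed
  have all_rail: "co a (rail s k) = c * of_bool (i \<le> k \<and> k < j)" if "k \<le> g - 1" for s k
    using const[of k s] rail_i[of s] rail[OF that, of s] by (cases "i \<le> k \<and> k < j") auto
  have all_rung: "co a (Rung k) = c * of_bool (k = i \<or> k = j)" if "k \<in> {1..g - 1}" for k
    using rung_i[of True] rail_i[of True] rung_j rung[OF that] that by (cases "k = i \<or> k = j") auto
  have "c \<in> \<int>" unfolding c_def by (rule S0_D(1)[OF ab(1)])
  then obtain z where z: "c = of_int z" by (rule Ints_cases)
  have "i \<le> g - 1" using ij by simp
  then have "0 \<le> c" "c \<le> 1" using rail[of i True] ij unfolding c_def by auto
  then have "z = 0 \<or> z = 1" using z by auto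
  then consider "c = 0" | "c = 1" using z by auto
  then show ?thesis
  proof cases
    case 1
    then have "a = 0" using all_rail all_rung by (intro vector_eqI) simp_all
    then show ?thesis ..
  next
    case 2
    have "b = 0"
    proof (rule vector_eqI)
      show "co b (Rung k) = co 0 (Rung k)" if "k \<in> {1..g - 1}" for k
        using all_rung[OF that] rung(2)[OF that] 2 by simp
      show "co b (rail s k) = co 0 (rail s k)" if "k \<le> g - 1" for s k
        using all_rail[OF that, of s] rail(2)[OF that, of s] 2 by simp
    qed
    then show ?thesis ..
  qed
qed

text \<open>Parity prevents splitting. A summand vanishes on the side where the dumbbell does, which
  makes its labels on the two parallel edges at either end equal; the even vertex sum then forces an
  even label on the connecting path. If that label is 2, the triangle inequalities require label 1
  on the double edges, so the summand is the whole dumbbell.\<close>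

lemma dumbbell_decomposition:
  assumes ab: "a \<in> S0" "b \<in> S0" "a + b = emb dumbbell"
  shows "co a (rail True 1) = 0 \<or> co a (rail True 1) = 2"
    and "co a (rail True 1) = 2 \<Longrightarrow> b = 0"
proof -
  have sum: "co a e + co b e = of_int (dumbbell e)" if "e \<in> edges G" for e
    using arg_cong[OF ab(3), of "\<lambda>x. x $ num e"] co_emb[OF that] by simp
  have rung: "0 \<le> co a (Rung k)" "co a (Rung k) + co b (Rung k) = of_bool (k = 1 \<or> k = g - 1)"
      "0 \<le> co b (Rung k)" if "k \<in> {1..g - 1}" for k
    using sum[OF rung_in[OF that]] S0_D(4)[OF ab(1) that] S0_D(4)[OF ab(2) that] by simp_all
  have rail: "0 \<le> co a (rail s k)" "co a (rail s k) + co b (rail s k) = dumbbell (rail s k)"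
      "0 \<le> co b (rail s k)" if "k \<le> g - 1" for s k
    using sum[OF rail_in[OF that]] S0_D(5)[OF ab(1) that] S0_D(5)[OF ab(2) that] by simp_all
  define c where "c = co a (rail True 1)"
  have const: "co a (rail True k) = c" if "1 \<le> k" "k < g - 1" for k
    unfolding c_def
  proof (rule rail_constant[OF ab(1), of 1 k k])
    show "co a (Rung n) = 0" if "1 < n" "n \<le> k" for n
      using rung[of n] that \<open>k < g - 1\<close> by simp
  qed (use that in auto)
  have B0: "co a (rail False k) = 0" if "1 \<le> k" "k < g - 1" for k
    using rail[of k False] that by simp
  have ends: "rail False 0 = rail True 0" "rail False (g - 1) = rail True (g - 1)"
    by (simp_all add: rail_def)
  have first: "1 \<in> {1..g - 1}" "(1 :: nat) < g - 1" and last: "g - 1 \<in> {1..g - 1}" "1 \<le> g - 1 - 1" "g - 1 - 1 < g - 1"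
    using g by auto
  have top: "co a (Rung 1) = co a (rail True 0)"
    using S0_D(2)[OF ab(1) first(1), of False] B0[OF order_refl first(2)]
    by (simp add: triangle_ineqs_def ends)
  have bottom: "co a (Rung (g - 1)) = co a (rail True (g - 1))"
    using S0_D(2)[OF ab(1) last(1), of False] B0[OF last(2,3)]
    unfolding triangle_ineqs_def ends by linarith
  have c_top: "c \<le> 2 * co a (rail True 0)"
    using S0_D(2)[OF ab(1) first(1), of True] top by (simp add: triangle_ineqs_def c_def)
  have c_bottom: "c \<le> 2 * co a (rail True (g - 1))"
    using S0_D(2)[OF ab(1) last(1), of True] const[OF last(2,3)] bottom
    unfolding triangle_ineqs_def by linarith
  have "(co a (rail True 0) + co a (Rung 1) + c) / 2 \<in> \<int>"
    using S0_D(3)[OF ab(1) first(1), of True] by (simp add: c_def)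
  moreover have "(co a (rail True 0) + co a (Rung 1) + c) / 2 = co a (rail True 0) + c / 2"
    using top by simp
  \<comment> \<open>The two equal labels contribute an integer to half the vertex sum, so
    \<open>c / 2\<close> is an integer.\<close>
  ultimately have "co a (rail True 0) + c / 2 - co a (rail True 0) \<in> \<int>"
    using S0_D(1)[OF ab(1)] by (metis Ints_diff)
  then have "c / 2 \<in> \<int>" by simp
  then obtain z where z: "c / 2 = of_int z" by (rule Ints_cases)
  have "1 \<le> g - 1" using first by simp
  then have "0 \<le> c" "c \<le> 2" using rail[of 1 True] dumbbell_simps(4)[of 1 True] first(2)
    unfolding c_def by auto
  then have "0 \<le> z" "z \<le> 1" using z by simp_all
  then have "z = 0 \<or> z = 1" by auto
  then show "co a (rail True 1) = 0 \<or> co a (rail True 1) = 2"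
    using z unfolding c_def by auto
  assume "co a (rail True 1) = 2"
  then have c: "c = 2" by (simp add: c_def)
  have arcs: "co b (rail True 0) = 0" "co b (rail True (g - 1)) = 0" "co b (Rung 1) = 0"
      "co b (Rung (g - 1)) = 0"
  proof -
    have "co a (rail True 0) + co b (rail True 0) = 1" "0 \<le> co b (rail True 0)"
      using rail[of 0 True] by simp_all
    then show 0: "co b (rail True 0) = 0" using c c_top by linarith
    have "co a (rail True (g - 1)) + co b (rail True (g - 1)) = 1" "0 \<le> co b (rail True (g - 1))"
      using rail[OF order_refl, of True] by simp_all
    then show 1: "co b (rail True (g - 1)) = 0" using c c_bottom by linarith
    show "co b (Rung 1) = 0"
      using rung[OF first(1)] top 0 \<open>co a (rail True 0) + co b (rail True 0) = 1\<close> by simp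
    show "co b (Rung (g - 1)) = 0"
      using rung(2)[OF last(1)] bottom 1 \<open>co a (rail True (g - 1)) + co b (rail True (g - 1)) = 1\<close> by simp
  qed
  show "b = 0"
  proof (rule vector_eqI)
    show "co b (Rung k) = co 0 (Rung k)" if "k \<in> {1..g - 1}" for k
      using rung[OF that] arcs by (cases "k = 1 \<or> k = g - 1") auto
    show "co b (rail s k) = co 0 (rail s k)" if "k \<le> g - 1" for s k
    proof -
      consider "k = 0" | "k = g - 1" | "1 \<le> k" "k < g - 1" using \<open>k \<le> g - 1\<close> by force
      then show ?thesis
      proof cases
        case 1
        then show ?thesis using arcs ends by (cases s) auto
      next
        case 2
        then show ?thesis using arcs ends by (cases s) auto
      next
        case 3
        then show ?thesis using rail[OF that, of s] const[OF 3] B0[OF 3] c by (cases s) auto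
      qed
    qed
  qed
qed

text \<open>The labels of the two summands on the connecting path are 0 or 2 and add up to 2, so one
  summand takes everything and the other is 0.\<close>

lemma dumbbell_irreducible:
  assumes ab: "a \<in> S0" "b \<in> S0" "a + b = emb dumbbell"
  shows "a = 0 \<or> b = 0"
proof -
  have ba: "b + a = emb dumbbell" using ab(3) by (simp add: add.commute)
  have "co a (rail True 1) + co b (rail True 1) = 2"
    using arg_cong[OF ab(3), of "\<lambda>x. x $ num (rail True 1)"] co_emb[OF rail_in[of 1 True]] g by simp
  then show ?thesis
    using dumbbell_decomposition[OF ab] dumbbell_decomposition(2)[OF ab(2,1) ba] by auto
qed

section \<open>Counting the irreducible elements\<close>

definition pairs :: "(nat \<times> nat) set" where
  "pairs = (SIGMA j:{..g}. {..<j})"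

definition irreducibles :: "(real ^ 'n) set" where
  "irreducibles = insert (emb dumbbell) ((\<lambda>(j, i). emb (cycle i j)) ` pairs)"

text \<open>The path edges labelled 1 are those with index from \<open>i\<close> to
  \<open>j - 1\<close>, and this nonempty interval determines both of its ends.\<close>

lemma inj_cycle: "inj_on (\<lambda>(j, i). emb (cycle i j)) pairs"
proof (rule inj_onI, clarify)
  fix i j i' j' assume p: "(j, i) \<in> pairs" "(j', i') \<in> pairs" and eq: "emb (cycle i j) = emb (cycle i' j')"
  have "cycle i j (rail True k) = cycle i' j' (rail True k)" if "k \<le> g - 1" for k
    using arg_cong[OF eq, of "\<lambda>x. x $ num (rail True k)"] co_emb[OF rail_in[OF that]] by simp
  then have iff: "i \<le> k \<and> k < j \<longleftrightarrow> i' \<le> k \<and> k < j'" if "k < g" for k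
    using that by (simp add: of_bool_eq_iff)
  have less: "i < j" "j \<le> g" "i' < j'" "j' \<le> g" using p by (auto simp: pairs_def)
  have "i' \<le> i" "i \<le> i'" using iff[of i] iff[of i'] less by auto
  moreover have "j \<le> j'"
  proof -
    have "j - 1 < g" "i \<le> j - 1" "j - 1 < j" using less by auto
    then have "j - 1 < j'" using iff[of "j - 1"] by blast
    then show ?thesis by simp
  qed
  moreover have "j' \<le> j"
  proof -
    have "j' - 1 < g" "i' \<le> j' - 1" "j' - 1 < j'" using less by auto
    then have "j' - 1 < j" using iff[of "j' - 1"] by blast
    then show ?thesis by simp
  qed
  ultimately show "j = j' \<and> i = i'" by simp
qed

text \<open>The dumbbell has label 2 on the first inner path edge, whereas cycles have labels 0 and
  1 only.\<close>

lemma dumbbell_not_cycle: "emb dumbbell \<noteq> emb (cycle i j)"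
proof
  assume "emb dumbbell = emb (cycle i j)"
  then have "co (emb dumbbell) (rail True 1) = co (emb (cycle i j)) (rail True 1)" by simp
  moreover have "rail True 1 \<in> edges G" using g by (intro rail_in) simp
  ultimately show False using g by (auto simp: co_emb of_bool_def split: if_splits)
qed

lemma card_edges: "CARD('n) = 3 * g - 3"
proof -
  have "CARD('n) = card (edges G)" using num by (simp add: bij_betw_same_card)
  also have "edges G = insert TopArc (insert BottomArc
      (Rung ` {1..g - 1} \<union> (RailA ` {1..g - 2} \<union> RailB ` {1..g - 2})))"
    by (auto simp: multi_theta_def)
  also have "card \<dots> = Suc (Suc (card (Rung ` {1..g - 1} \<union> (RailA ` {1..g - 2} \<union> RailB ` {1..g - 2}))))"
    by (subst card_insert_disjoint; auto)+
  also have "card (Rung ` {1..g - 1} \<union> (RailA ` {1..g - 2} \<union> RailB ` {1..g - 2})) =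
      card (Rung ` {1..g - 1}) + card (RailA ` {1..g - 2} \<union> RailB ` {1..g - 2})"
    by (rule card_Un_disjoint) auto
  also have "card (RailA ` {1..g - 2} \<union> RailB ` {1..g - 2}) = card (RailA ` {1..g - 2}) + card (RailB ` {1..g - 2})"
    by (rule card_Un_disjoint) auto
  also have "Suc (Suc (card (Rung ` {1..g - 1}) + \<dots>)) = Suc (Suc ((g - 1) + ((g - 2) + (g - 2))))"
    by (simp add: card_image inj_on_def)
  also have "\<dots> = 3 * g - 3" using g by simp
  finally show ?thesis .
qed

lemma card_irreducibles: "3 * g - 3 < card irreducibles"
proof -
  have fin: "finite pairs" by (simp add: pairs_def)
  have "emb dumbbell \<notin> (\<lambda>(j, i). emb (cycle i j)) ` pairs" using dumbbell_not_cycle by auto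
  then have "card irreducibles = Suc (card ((\<lambda>(j, i). emb (cycle i j)) ` pairs))"
    unfolding irreducibles_def using fin by (intro card_insert_disjoint) auto
  also have "card ((\<lambda>(j, i). emb (cycle i j)) ` pairs) = card pairs"
    by (rule card_image[OF inj_cycle])
  also have "card pairs = \<Sum>{..g}" by (simp add: pairs_def)
  finally have card: "card irreducibles = Suc (\<Sum>{..g})" .
  \<comment> \<open>Equality holds at \<open>n = 3\<close>, where both sides are 6; strictness comes
    from the dumbbell, counted by the outer \<open>Suc\<close>.\<close>
  have "3 * n - 3 \<le> \<Sum>{..n}" if "3 \<le> n" for n :: nat
    using that by (induction n rule: dec_induct) (simp_all add: numeral_3_eq_3)
  then show ?thesis using g card by (simp add: less_Suc_eq_le)
qed

theorem not_smooth_multi_theta: "\<not> smooth_variety (toric_variety P \<Lambda>)"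
  unfolding toric_variety_def
proof (rule toric_fixed_point.not_smooth[OF toric_fixed_point_P, of irreducibles])
  show "irreducibles \<subseteq> S0"
    unfolding irreducibles_def using dumbbell_in_S0 cycle_in_S0 by (auto simp: pairs_def)
  show "finite irreducibles" by (simp add: irreducibles_def pairs_def)
  show "DIM(real ^ 'n) < card irreducibles" using card_irreducibles by (simp add: card_edges)
  have "emb dumbbell \<noteq> 0"
  proof
    assume "emb dumbbell = 0"
    then have "co (emb dumbbell) (rail True 0) = 0" by simp
    then show False using co_emb[OF rail_in[of 0 True]] by simp
  qed
  moreover have "emb (cycle i j) \<noteq> 0" if "i < j" "j \<le> g" for i j
  proof
    assume "emb (cycle i j) = 0"
    then have "co (emb (cycle i j)) (rail True i) = 0" by simp
    then show False using co_emb[OF rail_in[of i True]] that by simp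
  qed
  ultimately show "0 \<notin> irreducibles" by (auto simp: irreducibles_def pairs_def)
  show "a = 0 \<or> b = 0" if "a \<in> S0" "b \<in> S0" "a + b \<in> irreducibles" for a b
  proof -
    consider "a + b = emb dumbbell" | i j where "i < j" "j \<le> g" "a + b = emb (cycle i j)"
      using \<open>a + b \<in> irreducibles\<close> by (auto simp: irreducibles_def pairs_def)
    then show ?thesis
    proof cases
      case 1
      then show ?thesis by (rule dumbbell_irreducible[OF that(1,2)])
    next
      case 2
      then show ?thesis using cycle_irreducible that(1,2) by blast
    qed
  qed
qed

end

theorem mainTheorem1:
  fixes g :: nat and num :: "theta_edge \<Rightarrow> 'n::finite"
  assumes "g \<ge> 3"
    and "bij_betw num (edges (multi_theta g)) (UNIV :: 'n set)"
  shows "\<not> smooth_variety (toric_variety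
           (graph_polytope num (multi_theta g)) (graph_lattice num (multi_theta g)))"
proof -
  interpret multi_theta_numbering g num by unfold_locales (rule assms)+
  show ?thesis by (rule not_smooth_multi_theta)
qed

end
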